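(* Let $s>0$ and $0<p,q\le\infty$. Then: (i) $\displaystyle \mathbf{B}^{s+}_{p,q,\mathrm{selfs}}(\mathbb{R}^n)\subset M(\mathbf{B}^s_{p,q}(\mathbb{R}^n))\hookrightarrow\mathbf{B}^s_{p,q,\mathrm{selfs}}(\mathbb{R}^n)$, where the second inclusion is a continuous embedding. (ii) If, additionally, $0<p\le1$, then $M(\mathbf{B}^s_p(\mathbb{R}^n))=\mathbf{B}^s_{p,\mathrm{selfs}}(\mathbb{R}^n)$.
   Context: Besov spaces: for $j\in\mathbb{N}_0$, $m\in\mathbb{Z}^n$, let $Q_{j,m}$ be the axis-parallel cube with centre $2^{-j}m$ and side length $2^{-j+1}$, $dQ_{j,m}$ the concentric cube with side length $d$ times as large. For complex $\lambda=\{\lambda_{j,m}\}$, $\|\lambda|b^s_{p,q}\|=\big(\sum_{j=0}^\infty2^{j(s-n/p)q}(\sum_{m\in\mathbb{Z}^n}|\lambda_{j,m}|^p)^{q/p}\big)^{1/q}$ (usual modification for $\infty$). Fix $d>1$ and $K\in\mathbb{N}_0$ with $K\ge1+[s]$; a $K$-atom located at $Q_{j,m}$ is a $C^K$ function $a:\mathbb{R}^n\to\mathbb{C}$ with $\operatorname{supp}a\subset dQ_{j,m}$ and $|D^\alpha a|\le2^{|\alpha|j}$ for $|\alpha|\le K$. $\mathbf{B}^s_{p,q}(\mathbb{R}^n)$, $s>0$, $0<p,q\le\infty$, is the set of $f\in L_p(\mathbb{R}^n)$ with $f=\sum_{j,m}\lambda_{j,m}a_{j,m}$ (convergence in $L_p$),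 $a_{j,m}$ $K$-atoms located at $Q_{j,m}$, $\|\lambda|b^s_{p,q}\|<\infty$; the quasi-norm is the infimum of $\|\lambda|b^s_{p,q}\|$ over all such representations. Up to equivalence it is independent of $d,K$, and equivalent to $\|f|L_p\|+\big(\int_0^1t^{-sq}\omega_r(f,t)_p^q\,\frac{dt}{t}\big)^{1/q}$, $r\in\mathbb{N}$, $r>s$, with $\omega_r(f,t)_p=\sup_{|h|\le t}\|\Delta_h^rf|L_p(\mathbb{R}^n)\|$. Write $\mathbf{B}^s_p=\mathbf{B}^s_{p,p}$. Multipliers: a function $m\in L^{loc}_{\min(1,p)}(\mathbb{R}^n)$ is a pointwise multiplier for $\mathbf{B}^s_{p,q}(\mathbb{R}^n)$ if $f\mapsto mf$ generates a bounded map in $\mathbf{B}^s_{p,q}(\mathbb{R}^n)$; $M(\mathbf{B}^s_{p,q}(\mathbb{R}^n))$ is the collection of all of them, quasi-normed by the operator quasi-norm of $f\mapsto mf$. Self-similar spaces: fix a non-negative $C^\infty$ function $\psi$ with $\operatorname{supp}\psi\subset\{y\in\mathbb{R}^n:|y|\le\sqrt n\}$ and $\sum_{l\in\mathbb{Z}^n}\psi(x-l)=1$ for $x\in\mathbb{R}^n$. $\mathbf{B}^s_{p,q,\mathrm{selfs}}(\mathbb{R}^n)$ is the set of all $f\in L^{loc}_{\min(1,p)}(\mathbb{R}^n)$ with $$\|f|\mathbf{B}^s_{p,q,\mathrm{selfs}}(\mathbb{R}^n)\|=\sup_{j\in\mathbb{N}_0,\,l\in\mathbb{Z}^n}\|\psi(\cdot-l)f(2^{-j}\cdot)|\mathbf{B}^s_{p,q}(\mathbb{R}^n)\|<\infty.$$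 Further $\mathbf{B}^s_{p,\mathrm{selfs}}=\mathbf{B}^s_{p,p,\mathrm{selfs}}$ and $\mathbf{B}^{s+}_{p,q,\mathrm{selfs}}(\mathbb{R}^n)=\bigcup_{\sigma>s}\mathbf{B}^\sigma_{p,q,\mathrm{selfs}}(\mathbb{R}^n)$. *)

theory Defs
  imports "HOL-Analysis.Analysis" "HOL-Probability.Essential_Supremum"
begin

section \<open>Lebesgue quasi-norms\<close>

text \<open>Integrability and smoothness exponents \<open>p, q \<in> (0, \<infinity>]\<close> have type \<^typ>\<open>ennreal\<close>.
  The power below is only used with exponents \<open>a > 0\<close>.\<close>

definition ennreal_pow :: "ennreal \<Rightarrow> real \<Rightarrow> ennreal" where
  "ennreal_pow x a = (if x = \<infinity> then \<infinity> else ennreal (enn2real x powr a))"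

text \<open>One definition covers \<open>L\<^sub>p(\<real>\<^sup>n)\<close> (with \<open>M = lebesgue\<close>) and \<open>\<ell>\<^sub>p\<close>
  (with \<open>M = count_space UNIV\<close>, where \<^const>\<open>esssup\<close> is the plain supremum).\<close>

definition Lp_qnorm :: "'a measure \<Rightarrow> ennreal \<Rightarrow> ('a \<Rightarrow> ennreal) \<Rightarrow> ennreal" where
  "Lp_qnorm M p f =
     (if p = \<infinity> then esssup M f
      else ennreal_pow (\<integral>\<^sup>+x. ennreal_pow (f x) (enn2real p) \<partial>M) (1 / enn2real p))"

text \<open>Functions are not identified when equal almost everywhere: all the spaces below are sets
  of representatives, closed under changes on null sets.\<close>

definition Lp :: "ennreal \<Rightarrow> (real^'n \<Rightarrow> complex) set" where
  "Lp p = {f \<in> borel_measurable lebesgue. Lp_qnorm lebesgue p (\<lambda>x. ennreal (norm (f x))) < \<infinity>}"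

definition Lp_loc :: "ennreal \<Rightarrow> (real^'n \<Rightarrow> complex) set" where
  "Lp_loc p = {f \<in> borel_measurable lebesgue.
     \<forall>C. compact C \<longrightarrow> (\<lambda>x. indicator C x *\<^sub>R f x) \<in> Lp p}"


section \<open>Partial derivatives and \<open>C\<^sup>K\<close> functions\<close>

definition partial_deriv :: "'n \<Rightarrow> (real^'n \<Rightarrow> 'b::real_normed_vector) \<Rightarrow> (real^'n \<Rightarrow> 'b)" where
  "partial_deriv i f = (\<lambda>x. frechet_derivative f (at x) (axis i 1))"

primrec C_class :: "nat \<Rightarrow> (real^'n \<Rightarrow> 'b::real_normed_vector) \<Rightarrow> bool" where
  "C_class 0 f \<longleftrightarrow> continuous_on UNIV f"
| "C_class (Suc k) f \<longleftrightarrow> (\<forall>x. f differentiable (at x)) \<and> (\<forall>i. C_class k (partial_deriv i f))"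

text \<open>A derivative \<open>D\<^sup>\<alpha>\<close> is written as the list of coordinate directions in which one
  differentiates successively, so \<open>|\<alpha>|\<close> is the length of the list. For functions of class \<open>C\<^sup>K\<close>
  and \<open>|\<alpha>| \<le> K\<close> the order of the list is irrelevant, i.e. lists amount to multi-indices.\<close>

definition D_iter :: "'n list \<Rightarrow> (real^'n \<Rightarrow> 'b::real_normed_vector) \<Rightarrow> (real^'n \<Rightarrow> 'b)" where
  "D_iter \<alpha> f = foldr partial_deriv \<alpha> f"

definition supp :: "(real^'n \<Rightarrow> 'b::zero) \<Rightarrow> (real^'n) set" where
  "supp f = closure {x. f x \<noteq> 0}"


section \<open>Atoms and Besov spaces\<close>

definition lattice_vec :: "int^'n \<Rightarrow> real^'n" where
  "lattice_vec m = (\<chi> i. of_int (m $ i))"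

text \<open>The cube \<open>d Q\<^sub>j\<^sub>,\<^sub>m\<close>: centre \<open>2\<^sup>-\<^sup>j m\<close>, side length \<open>d 2\<^sup>-\<^sup>j\<^sup>+\<^sup>1\<close>.\<close>

definition dil_cube :: "real \<Rightarrow> nat \<Rightarrow> int^'n \<Rightarrow> (real^'n) set" where
  "dil_cube d j m =
     {x. \<forall>i. \<bar>x $ i - (2 powr (- real j) *\<^sub>R lattice_vec m) $ i\<bar> \<le> (d * 2 powr (1 - real j)) / 2}"

definition atom :: "real \<Rightarrow> nat \<Rightarrow> nat \<Rightarrow> int^'n \<Rightarrow> (real^'n \<Rightarrow> complex) \<Rightarrow> bool" where
  "atom d K j m a \<longleftrightarrow>
     C_class K a \<and> supp a \<subseteq> dil_cube d j m \<and>
     (\<forall>\<alpha> x. length \<alpha> \<le> K \<longrightarrow> norm (D_iter \<alpha> a x) \<le> 2 ^ (length \<alpha> * j))"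

definition b_qnorm :: "real \<Rightarrow> ennreal \<Rightarrow> ennreal \<Rightarrow> (nat \<Rightarrow> int^'n \<Rightarrow> complex) \<Rightarrow> ennreal" where
  "b_qnorm s p q c = Lp_qnorm (count_space UNIV) q
     (\<lambda>j. ennreal (2 powr (real j * (s - real CARD('n) * enn2real (1 / p))))
           * Lp_qnorm (count_space UNIV) p (\<lambda>m. ennreal (norm (c j m))))"

text \<open>\<open>f = \<Sum>\<^sub>j\<^sub>,\<^sub>m c\<^sub>j\<^sub>,\<^sub>m a\<^sub>j\<^sub>,\<^sub>m\<close> with convergence in \<open>L\<^sub>p\<close>. For fixed \<open>j\<close> the sum over \<open>m\<close> is locally finite
  and is taken pointwise (for \<open>p = \<infinity>\<close> it does not converge in norm in general); the series over
  \<open>j\<close> of these functions converges in \<open>L\<^sub>p\<close>. For \<open>p < \<infinity>\<close> and \<open>c\<close> with finite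
  \<open>b\<close>-quasi-norm, \<open>s > 0\<close>, this is the same as unconditional convergence of the double series.\<close>

definition atomic_rep ::
  "real \<Rightarrow> nat \<Rightarrow> ennreal \<Rightarrow> (real^'n \<Rightarrow> complex) \<Rightarrow> (nat \<Rightarrow> int^'n \<Rightarrow> complex)
     \<Rightarrow> (nat \<Rightarrow> int^'n \<Rightarrow> real^'n \<Rightarrow> complex) \<Rightarrow> bool" where
  "atomic_rep d K p f c a \<longleftrightarrow>
     f \<in> Lp p \<and> (\<forall>j m. atom d K j m (a j m)) \<and>
     (\<lambda>J. Lp_qnorm lebesgue p
            (\<lambda>x. ennreal (norm (f x - (\<Sum>j<J. \<Sum>\<^sub>\<infinity>m. c j m * a j m x))))) \<longlonglongrightarrow> 0"

definition Besov ::
  "real \<Rightarrow> nat \<Rightarrow> real \<Rightarrow> ennreal \<Rightarrow> ennreal \<Rightarrow> (real^'n \<Rightarrow> complex) set" where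
  "Besov d K s p q = {f. \<exists>c a. atomic_rep d K p f c a \<and> b_qnorm s p q c < \<infinity>}"

definition Besov_qnorm ::
  "real \<Rightarrow> nat \<Rightarrow> real \<Rightarrow> ennreal \<Rightarrow> ennreal \<Rightarrow> (real^'n \<Rightarrow> complex) \<Rightarrow> ennreal" where
  "Besov_qnorm d K s p q f = Inf {b_qnorm s p q c |c. \<exists>a. atomic_rep d K p f c a}"


section \<open>Pointwise multipliers\<close>

definition multipliers ::
  "real \<Rightarrow> nat \<Rightarrow> real \<Rightarrow> ennreal \<Rightarrow> ennreal \<Rightarrow> (real^'n \<Rightarrow> complex) set" where
  "multipliers d K s p q =
     {m \<in> Lp_loc (min 1 p).
        \<exists>C::real. \<forall>f \<in> Besov d K s p q. (\<lambda>x. m x * f x) \<in> Besov d K s p q \<and>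
          Besov_qnorm d K s p q (\<lambda>x. m x * f x) \<le> ennreal C * Besov_qnorm d K s p q f}"

definition multiplier_qnorm ::
  "real \<Rightarrow> nat \<Rightarrow> real \<Rightarrow> ennreal \<Rightarrow> ennreal \<Rightarrow> (real^'n \<Rightarrow> complex) \<Rightarrow> ennreal" where
  "multiplier_qnorm d K s p q m =
     Inf {C. \<forall>f \<in> Besov d K s p q.
           Besov_qnorm d K s p q (\<lambda>x. m x * f x) \<le> C * Besov_qnorm d K s p q f}"


section \<open>Self-similar spaces\<close>

definition resolution_fun :: "(real^'n \<Rightarrow> real) \<Rightarrow> bool" where
  "resolution_fun \<psi> \<longleftrightarrow>
     (\<forall>x. 0 \<le> \<psi> x) \<and> (\<forall>k. C_class k \<psi>) \<and> supp \<psi> \<subseteq> {y. norm y \<le> sqrt (real CARD('n))} \<and>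
     (\<forall>x. ((\<lambda>l. \<psi> (x - lattice_vec l)) has_sum 1) UNIV)"

definition selfs_qnorm ::
  "(real^'n \<Rightarrow> real) \<Rightarrow> real \<Rightarrow> nat \<Rightarrow> real \<Rightarrow> ennreal \<Rightarrow> ennreal \<Rightarrow> (real^'n \<Rightarrow> complex) \<Rightarrow> ennreal" where
  "selfs_qnorm \<psi> d K s p q f =
     (SUP (j::nat, l) \<in> UNIV. Besov_qnorm d K s p q
        (\<lambda>x. of_real (\<psi> (x - lattice_vec l)) * f (2 powr (- real j) *\<^sub>R x)))"

definition selfs ::
  "(real^'n \<Rightarrow> real) \<Rightarrow> real \<Rightarrow> nat \<Rightarrow> real \<Rightarrow> ennreal \<Rightarrow> ennreal \<Rightarrow> (real^'n \<Rightarrow> complex) set" where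
  "selfs \<psi> d K s p q = {f \<in> Lp_loc (min 1 p). selfs_qnorm \<psi> d K s p q f < \<infinity>}"

text \<open>Admissible atoms for smoothness \<open>\<sigma>\<close> need \<open>K \<ge> 1 + [\<sigma>]\<close>, so in the union over \<open>\<sigma> > s\<close> the number
  \<open>K\<close> depends on \<open>\<sigma>\<close>.\<close>

definition selfs_plus ::
  "(real^'n \<Rightarrow> real) \<Rightarrow> real \<Rightarrow> (real \<Rightarrow> nat) \<Rightarrow> real \<Rightarrow> ennreal \<Rightarrow> ennreal \<Rightarrow> (real^'n \<Rightarrow> complex) set" where
  "selfs_plus \<psi> d K s p q = (\<Union>\<sigma>\<in>{s<..}. selfs \<psi> d (K \<sigma>) \<sigma> p q)"


section \<open>Continuous embeddings\<close>

definition cont_embedded ::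
  "'f set \<Rightarrow> ('f \<Rightarrow> ennreal) \<Rightarrow> 'f set \<Rightarrow> ('f \<Rightarrow> ennreal) \<Rightarrow> bool" where
  "cont_embedded A nA B nB \<longleftrightarrow> A \<subseteq> B \<and> (\<exists>C::real. 0 < C \<and> (\<forall>f\<in>A. nB f \<le> ennreal C * nA f))"

end

theory Submission
  imports Defs
begin

text \<open>
  All spaces are described by atomic series \<open>\<Sum>\<^sub>j\<^sub>,\<^sub>m c\<^sub>j\<^sub>,\<^sub>m a\<^sub>j\<^sub>,\<^sub>m\<close>, and the theorem follows from three
  operations on such series. Since \<open>s > 0\<close>, a series with coefficients in \<open>b\<^sup>s\<^sub>p\<^sub>,\<^sub>q\<close> converges
  absolutely almost everywhere, even with the moduli of the atoms replaced by the indicator functions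
  of their cubes. Convergence in \<open>L\<^sub>p\<close> may therefore be replaced by unconditional pointwise convergence
  (\<open>atomic_rep_of_decomp\<close>, \<open>decomp_of_atomic_rep\<close>), and multiplication, dilation and rearrangement of
  series become pointwise operations.

  Self-similar functions are multipliers. Let \<open>f\<close> be a series of atoms \<open>a\<^sub>k\<^sub>,\<^sub>\<mu>\<close> with coefficients
  \<open>c\<^sub>k\<^sub>,\<^sub>\<mu>\<close>. On the support of \<open>a\<^sub>k\<^sub>,\<^sub>\<mu>\<close> the function \<open>m\<close> is a finite sum of functions \<open>\<psi>(2\<^sup>k\<cdot> - l) m\<close>.
  These are dilations of functions with a bounded quasi-norm, so that \<open>m a\<^sub>k\<^sub>,\<^sub>\<mu>\<close> is a series of atoms
  of levels \<open>k + i\<close>, \<open>i \<ge> 0\<close>, located near \<open>Q\<^sub>k\<^sub>,\<^sub>\<mu>\<close>. At every position only finitely many terms meet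
  when these series are added up (\<open>decomp_synth\<close>). If \<open>m\<close> has smoothness \<open>\<sigma> > s\<close>, the level \<open>k + i\<close>
  gains \<open>2\<^bsup>-i(\<sigma>-s)\<^esup>\<close>, which makes the sum over \<open>i\<close> converge for all \<open>p, q\<close> (\<open>bn_synth_smoother\<close>). If
  \<open>p = q \<le> 1\<close>, the \<open>p\<close>-th powers of the quasi-norms add up without any gain (\<open>bn_synth_p_le_1\<close>).

  The orders \<open>K \<sigma>\<close> and \<open>K s\<close> of the atoms are unrelated, so the product may only have a
  representation by atoms of an order \<open>N > s\<close> below \<open>K s\<close>. An atom of class \<open>C\<^sup>N\<close> is a series of
  smooth atoms whose coefficients on level \<open>i\<close> have size \<open>2\<^bsup>-iN\<^esup>\<close>: this is the telescoping series of
  its approximations by local interpolation polynomials, glued by a smooth partition of unity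
  (\<open>smooth_pieces_exist\<close>). As \<open>N > s\<close>, the summation result for \<open>\<sigma> = N\<close> applies again
  (\<open>decomp_change_order\<close>).

  Multipliers are self-similar functions. The function \<open>\<psi>(2\<^sup>j\<cdot> - l)\<close> consists of boundedly many atoms
  of level \<open>j\<close> and has a quasi-norm of order \<open>2\<^bsup>j(s-n/p)\<^esup>\<close>. Hence the quasi-norm of
  \<open>h = m \<psi>(2\<^sup>j\<cdot> - l)\<close> is at most of this order times that of \<open>m\<close>, and what is needed is
  \<open>\<parallel>h(2\<^bsup>-j\<^esup>\<cdot>)\<parallel> \<le> C 2\<^bsup>-j(s-n/p)\<^esup> \<parallel>h\<parallel>\<close> for functions \<open>h\<close> supported in a ball of radius of order \<open>2\<^bsup>-j\<^esup>\<close>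
  (\<open>small_support_homogeneity\<close>). Atoms of levels \<open>k \<ge> j\<close> simply rescale. The atoms of coarser levels are
  controlled by taking a \<open>K\<close>-th difference of \<open>h(2\<^bsup>-j\<^esup>\<cdot>)\<close> with a fixed large step: it reproduces the
  compactly supported function up to sign, but it is tiny on the flat dilated atoms.
\<close>

section \<open>Functions with controlled derivatives\<close>

text \<open>The bounds for atoms with a free constant \<open>A\<close> and a free scale \<open>t\<close>; atoms of level \<open>j\<close> have
  \<open>A = 1\<close> and \<open>t = 2\<^sup>j\<close>.\<close>

definition Cbd :: "nat \<Rightarrow> real \<Rightarrow> real \<Rightarrow> (real^'n \<Rightarrow> 'b::real_normed_vector) \<Rightarrow> bool" where
  "Cbd K A t f \<longleftrightarrow> C_class K f \<and> (\<forall>\<alpha> x. length \<alpha> \<le> K \<longrightarrow> norm (D_iter \<alpha> f x) \<le> A * t ^ length \<alpha>)"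

lemma D_iter_Nil [simp]: "D_iter [] f = f"
  by (simp add: D_iter_def)

lemma D_iter_snoc: "D_iter (\<alpha> @ [i]) f = D_iter \<alpha> (partial_deriv i f)"
  by (simp add: D_iter_def)

lemma Cbd_0: "Cbd 0 A t f \<longleftrightarrow> continuous_on UNIV f \<and> (\<forall>x. norm (f x) \<le> A)"
  by (auto simp: Cbd_def)

text \<open>The recursive form, in which the innermost derivative is split off. It makes Leibniz' rule and
  the chain rule plain inductions on \<open>K\<close>.\<close>

lemma Cbd_Suc:
  "Cbd (Suc K) A t f \<longleftrightarrow> (\<forall>x. f differentiable (at x)) \<and> (\<forall>x. norm (f x) \<le> A)
     \<and> (\<forall>i. Cbd K (A * t) t (partial_deriv i f))"
proof (intro iffI conjI allI)
  assume L: "Cbd (Suc K) A t f"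
  show "f differentiable (at x)" for x using L by (auto simp: Cbd_def)
  show "norm (f x) \<le> A" for x using L unfolding Cbd_def
    by (metis D_iter_Nil list.size(3) mult.right_neutral power_0 zero_le)
  show "Cbd K (A * t) t (partial_deriv i f)" for i
    unfolding Cbd_def
  proof (intro conjI allI impI)
    show "C_class K (partial_deriv i f)" using L by (auto simp: Cbd_def)
    fix \<alpha> :: "'a list" and x assume "length \<alpha> \<le> K"
    then have "norm (D_iter (\<alpha> @ [i]) f x) \<le> A * t ^ length (\<alpha> @ [i])"
      using L unfolding Cbd_def by (metis Suc_le_mono length_append_singleton)
    then show "norm (D_iter \<alpha> (partial_deriv i f) x) \<le> A * t * t ^ length \<alpha>"
      by (simp add: D_iter_snoc mult_ac)
  qed
next
  assume R: "(\<forall>x. f differentiable (at x)) \<and> (\<forall>x. norm (f x) \<le> A)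
     \<and> (\<forall>i. Cbd K (A * t) t (partial_deriv i f))"
  show "Cbd (Suc K) A t f" unfolding Cbd_def
  proof (intro conjI allI impI)
    show "C_class (Suc K) f" using R by (auto simp: Cbd_def)
    fix \<alpha> :: "'a list" and x assume l: "length \<alpha> \<le> Suc K"
    show "norm (D_iter \<alpha> f x) \<le> A * t ^ length \<alpha>"
    proof (cases \<alpha> rule: rev_cases)
      case Nil then show ?thesis using R by simp
    next
      case (snoc \<beta> i)
      then have "norm (D_iter \<beta> (partial_deriv i f) x) \<le> A * t * t ^ length \<beta>"
        using R l unfolding Cbd_def by auto
      then show ?thesis by (simp add: snoc D_iter_snoc mult_ac)
    qed
  qed
qed

lemma Cbd_norm_le: "Cbd K A t f \<Longrightarrow> norm (f x) \<le> A"
  by (cases K) (auto simp: Cbd_0 Cbd_Suc)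

lemma Cbd_nonneg: "Cbd K A t f \<Longrightarrow> 0 \<le> A"
  using Cbd_norm_le[of K A t f undefined] norm_ge_zero[of "f undefined"] by linarith

lemma Cbd_continuous: "Cbd K A t f \<Longrightarrow> continuous_on UNIV f"
  by (cases K) (auto simp: Cbd_0 Cbd_Suc intro!: differentiable_imp_continuous_on
      simp: differentiable_on_def intro: differentiable_at_withinI)

lemma Cbd_mono: "Cbd K A t f \<Longrightarrow> A \<le> B \<Longrightarrow> 0 \<le> t \<Longrightarrow> t \<le> u \<Longrightarrow> Cbd K B u f"
proof (induction K arbitrary: A B f)
  case 0
  have "norm (f x) \<le> B" for x using order_trans[OF _ 0(2)] 0(1) unfolding Cbd_0 by blast
  then show ?case using 0(1) unfolding Cbd_0 by blast
next
  case (Suc K)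
  have "0 \<le> A" using Cbd_nonneg[OF Suc.prems(1)] .
  have "A * t \<le> B * u" using Suc.prems \<open>0 \<le> A\<close> by (intro mult_mono) auto
  then show ?case 
    using Suc.prems Suc.IH[of "A * t" _ "B * u"] order_trans[OF _ \<open>A \<le> B\<close>] unfolding Cbd_Suc by blast
qed

lemma Cbd_lower: "Cbd (Suc K) A t f \<Longrightarrow> Cbd K A t f"
proof (induction K arbitrary: A f)
  case 0 then show ?case using Cbd_continuous[OF 0] by (auto simp: Cbd_0 Cbd_Suc)
next
  case (Suc K)
  then show ?case unfolding Cbd_Suc[of "Suc K"] Cbd_Suc[of K A] by blast
qed

lemma Cbd_le: "Cbd K A t f \<Longrightarrow> L \<le> K \<Longrightarrow> Cbd L A t f"
  by (induction K) (auto simp: le_Suc_eq dest: Cbd_lower)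

lemma partial_deriv_eq: "(f has_derivative f') (at x) \<Longrightarrow> partial_deriv i f x = f' (axis i 1)"
  unfolding partial_deriv_def using frechet_derivative_at by metis

lemma has_derivative_frechet: "f differentiable (at x) \<Longrightarrow> (f has_derivative frechet_derivative f (at x)) (at x)"
  using frechet_derivative_works by blast

lemma partial_deriv_add:
  assumes "\<And>x. f differentiable (at x)" "\<And>x. g differentiable (at x)"
  shows "partial_deriv i (\<lambda>x. f x + g x) = (\<lambda>x. partial_deriv i f x + partial_deriv i g x)"
proof
  fix x
  have "((\<lambda>x. f x + g x) has_derivative (\<lambda>h. frechet_derivative f (at x) h + frechet_derivative g (at x) h)) (at x)"
    by (intro has_derivative_add has_derivative_frechet assms)
  from partial_deriv_eq[OF this, of i] show "partial_deriv i (\<lambda>x. f x + g x) x = partial_deriv i f x + partial_deriv i g x"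
    by (simp add: partial_deriv_def)
qed

lemma Cbd_add: "Cbd K A t f \<Longrightarrow> Cbd K B t g \<Longrightarrow> Cbd K (A + B) t (\<lambda>x. f x + g x)"
proof (induction K arbitrary: A B f g)
  case 0 then show ?case by (auto simp: Cbd_0 intro!: continuous_intros norm_triangle_mono)
next
  case (Suc K)
  then show ?case unfolding Cbd_Suc
    by (auto simp: partial_deriv_add distrib_right intro: norm_triangle_mono)
qed

text \<open>Both summands of the product rule double the constant at most once per order, which gives
  the factor \<open>2\<^sup>K\<close>; the scale \<open>t\<close> is preserved.\<close>

lemma Cbd_bilinear_aux:
  fixes f :: "real^'n \<Rightarrow> 'a::real_normed_vector" and g :: "real^'n \<Rightarrow> 'b::real_normed_vector"
    and op :: "'a \<Rightarrow> 'b \<Rightarrow> 'c::real_normed_vector"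
  assumes op: "bounded_bilinear op" and le: "\<And>a b. norm (op a b) \<le> norm a * norm b"
  shows "0 \<le> t \<Longrightarrow> Cbd K A t f \<Longrightarrow> Cbd K B t g \<Longrightarrow> Cbd K (2 ^ K * (A * B)) t (\<lambda>x. op (f x) (g x))"
proof (induction K arbitrary: A B f g)
  case 0
  have "norm (op (f x) (g x)) \<le> A * B" for x
    using le[of "f x" "g x"] mult_mono[of "norm (f x)" A "norm (g x)" B] 0 Cbd_nonneg[OF 0(2)]
    by (force simp: Cbd_0)
  then show ?case using 0 by (auto simp: Cbd_0 intro!: bounded_bilinear.continuous_on[OF op])
next
  case (Suc K)
  have A: "0 \<le> A" and B: "0 \<le> B" using Cbd_nonneg Suc.prems by blast+
  have d: "\<And>x. f differentiable (at x)" "\<And>x. g differentiable (at x)"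
    using Suc.prems by (auto simp: Cbd_Suc)
  have D: "((\<lambda>x. op (f x) (g x)) has_derivative
      (\<lambda>h. op (f x) (frechet_derivative g (at x) h) + op (frechet_derivative f (at x) h) (g x))) (at x)" for x
    by (intro bounded_bilinear.FDERIV[OF op] has_derivative_frechet d)
  have P: "partial_deriv i (\<lambda>x. op (f x) (g x)) = (\<lambda>x. op (f x) (partial_deriv i g x) + op (partial_deriv i f x) (g x))" for i
    by (rule ext, subst partial_deriv_eq[OF D]) (simp add: partial_deriv_def)
  have 1: "Cbd K (2^K * (A * (B*t)) + 2^K * (A * t * B)) t (partial_deriv i (\<lambda>x. op (f x) (g x)))" for i
    unfolding P using Suc.prems Cbd_lower
    by (intro Cbd_add Suc.IH) (auto simp: Cbd_Suc intro: Cbd_lower)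
  have 2: "2^K * (A * (B*t)) + 2^K * (A * t * B) = 2 ^ Suc K * (A * B) * t" by (simp add: algebra_simps)
  have 3: "norm (op (f x) (g x)) \<le> 2 ^ Suc K * (A * B)" for x
  proof -
    have "norm (op (f x) (g x)) \<le> A * B"
      using le[of "f x" "g x"] mult_mono[of "norm (f x)" A "norm (g x)" B] Suc.prems A B
      by (force simp: Cbd_Suc)
    also have "\<dots> \<le> 2 ^ Suc K * (A * B)"
      using A B mult_right_mono[of 1 "2^Suc K" "A*B"] one_le_power[of "2::real" "Suc K"] by auto
    finally show ?thesis .
  qed
  have 4: "(\<lambda>x. op (f x) (g x)) differentiable (at x)" for x using D differentiable_def by blast
  show ?case unfolding Cbd_Suc[of K "2 ^ Suc K * (A * B)"] using 1 3 4 unfolding 2 by blast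
qed

lemma Cbd_mult:
  fixes f g :: "real^'n \<Rightarrow> 'a::real_normed_algebra"
  shows "0 \<le> t \<Longrightarrow> Cbd K A t f \<Longrightarrow> Cbd K B t g \<Longrightarrow> Cbd K (2 ^ K * (A * B)) t (\<lambda>x. f x * g x)"
  by (rule Cbd_bilinear_aux[OF bounded_bilinear_mult norm_mult_ineq])

lemma C_class_const: "C_class K (\<lambda>x::real^'n. c)"
proof (induction K arbitrary: c)
  case 0 then show ?case by simp
next
  case (Suc K)
  have "partial_deriv i (\<lambda>x::real^'n. c) = (\<lambda>x. 0)" for i
    by (rule ext, rule partial_deriv_eq[where f' = "\<lambda>_. 0", simplified]) simp
  then show ?case using Suc[of 0] by auto
qed

lemma Cbd_const: "0 \<le> t \<Longrightarrow> norm c \<le> A \<Longrightarrow> Cbd K A t (\<lambda>x::real^'n. c)"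
proof (induction K arbitrary: c A)
  case 0 then show ?case by (simp add: Cbd_0)
next
  case (Suc K)
  have "partial_deriv i (\<lambda>x::real^'n. c) = (\<lambda>x. 0)" for i
    by (rule ext, rule partial_deriv_eq[where f' = "\<lambda>_. 0", simplified]) simp
  moreover have "0 \<le> A" using Suc.prems norm_ge_zero[of c] by linarith
  ultimately show ?case using Suc by (auto simp: Cbd_Suc)
qed

lemma Cbd_linear:
  assumes L: "bounded_linear L" and le: "\<And>a. norm (L a) \<le> B * norm a"
  shows "0 \<le> B \<Longrightarrow> Cbd K A t f \<Longrightarrow> Cbd K (B * A) t (\<lambda>x. L (f x))"
proof (induction K arbitrary: A f)
  case 0
  have "norm (L (f x)) \<le> B * A" for x
    using le[of "f x"] mult_left_mono[of "norm (f x)" A B] 0 by (force simp: Cbd_0)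
  then show ?case using 0 by (auto simp: Cbd_0 intro!: bounded_linear.continuous_on[OF L])
next
  case (Suc K)
  have d: "\<And>x. f differentiable (at x)" using Suc.prems by (auto simp: Cbd_Suc)
  have D: "((\<lambda>x. L (f x)) has_derivative (\<lambda>h. L (frechet_derivative f (at x) h))) (at x)" for x
    by (intro bounded_linear.has_derivative[OF L] has_derivative_frechet d)
  have P: "partial_deriv i (\<lambda>x. L (f x)) = (\<lambda>x. L (partial_deriv i f x))" for i
    by (rule ext, subst partial_deriv_eq[OF D]) (simp add: partial_deriv_def)
  have 1: "norm (L (f x)) \<le> B * A" for x
    using le[of "f x"] mult_left_mono[of "norm (f x)" A B] Suc.prems by (force simp: Cbd_Suc)
  have 4: "(\<lambda>x. L (f x)) differentiable (at x)" for x using D differentiable_def by blast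
  show ?case unfolding Cbd_Suc[of K "B * A"] P
    using 1 4 Suc.IH Suc.prems by (auto simp: Cbd_Suc mult.assoc)
qed

lemma Cbd_of_real: "Cbd K A t f \<Longrightarrow> Cbd K A t (\<lambda>x. of_real (f x) :: complex)"

  using Cbd_linear[of "of_real :: real \<Rightarrow> complex" 1 K A t f] by (simp add: bounded_linear_of_real)

lemma Cbd_cmult:
  fixes c :: "'a::real_normed_field" shows "Cbd K A t f \<Longrightarrow> Cbd K (norm c * A) t (\<lambda>x. c * f x)"
  by (rule Cbd_linear[OF bounded_linear_mult_right]) (auto simp: norm_mult)

lemma Cbd_sum:
  assumes "finite I" "0 \<le> t" "\<And>i. i \<in> I \<Longrightarrow> Cbd K (A i) t (f i)"
  shows "Cbd K (\<Sum>i\<in>I. A i) t (\<lambda>x. \<Sum>i\<in>I. f i x)"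
  using assms by (induction rule: finite_induct) (auto intro!: Cbd_add Cbd_const)

lemma Cbd_affine:
  fixes f :: "real^'n \<Rightarrow> 'b::real_normed_vector"
  shows "0 \<le> r \<Longrightarrow> 0 \<le> t \<Longrightarrow> Cbd K A t f \<Longrightarrow> Cbd K A (t * r) (\<lambda>x. f (r *\<^sub>R x + b))"
proof (induction K arbitrary: A f)
  case 0
  have "continuous_on UNIV (\<lambda>x. f (r *\<^sub>R x + b))"
    by (rule continuous_on_compose2[of UNIV f]) (use 0 in \<open>auto simp: Cbd_0 intro!: continuous_intros\<close>)
  then show ?case using 0 by (auto simp: Cbd_0)
next
  case (Suc K)
  have d: "\<And>x. f differentiable (at x)" using Suc.prems by (auto simp: Cbd_Suc)
  have D: "((\<lambda>x. f (r *\<^sub>R x + b)) has_derivative (\<lambda>h. frechet_derivative f (at (r *\<^sub>R x + b)) (r *\<^sub>R h))) (at x)" for x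
  proof (rule has_derivative_compose[where f = "\<lambda>x. r *\<^sub>R x + b"])
    show "((\<lambda>x. r *\<^sub>R x + b) has_derivative (\<lambda>h. r *\<^sub>R h)) (at x)"
      by (auto intro!: derivative_eq_intros)
    show "(f has_derivative frechet_derivative f (at (r *\<^sub>R x + b))) (at (r *\<^sub>R x + b))"
      by (rule has_derivative_frechet[OF d])
  qed
  have P: "partial_deriv i (\<lambda>x. f (r *\<^sub>R x + b)) = (\<lambda>x. r *\<^sub>R partial_deriv i f (r *\<^sub>R x + b))" for i
    by (rule ext, subst partial_deriv_eq[OF D])
      (simp add: partial_deriv_def linear_cmul[OF has_derivative_linear[OF has_derivative_frechet[OF d]]])
  have 1: "Cbd K (r * (A * t)) (t * r) (\<lambda>x. r *\<^sub>R partial_deriv i f (r *\<^sub>R x + b))" for i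
    by (rule Cbd_linear[OF bounded_linear_scaleR_right]) (use Suc.prems in \<open>auto intro!: Suc.IH simp: Cbd_Suc\<close>)
  have 4: "(\<lambda>x. f (r *\<^sub>R x + b)) differentiable (at x)" for x using D differentiable_def by blast
  show ?case unfolding Cbd_Suc P using 1 4 Suc.prems by (auto simp: Cbd_Suc mult_ac)
qed

lemma supp_iff:
  assumes "closed S" shows "supp f \<subseteq> S \<longleftrightarrow> (\<forall>x. x \<notin> S \<longrightarrow> f x = 0)"
proof
  assume "supp f \<subseteq> S"
  then have "{x. f x \<noteq> 0} \<subseteq> S" unfolding supp_def using closure_subset by (rule subset_trans[rotated])
  then show "\<forall>x. x \<notin> S \<longrightarrow> f x = 0" by blast
next
  assume "\<forall>x. x \<notin> S \<longrightarrow> f x = 0"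
  then have "{x. f x \<noteq> 0} \<subseteq> S" by blast
  then show "supp f \<subseteq> S" unfolding supp_def by (rule closure_minimal[OF _ assms])
qed

text \<open>A partial derivative vanishes off a closed set together with the function, so compactness of
  the support gives bounds for all derivatives in turn.\<close>

lemma C_class_compact_supp_bounded:
  fixes f :: "real^'n \<Rightarrow> 'b::real_normed_vector"
  assumes "C_class K f" "compact S" "\<And>x. x \<notin> S \<Longrightarrow> f x = 0"
  shows "\<exists>A. Cbd K A 1 f"
  using assms
proof (induction K arbitrary: f)
  case 0
  have "compact (f ` S)" using 0 by (auto intro!: compact_continuous_image intro: continuous_on_subset)
  then obtain B where B: "\<forall>y\<in>f ` S. norm y \<le> B" using compact_imp_bounded bounded_iff by metis
  have "norm (f x) \<le> max B 0" for x using B 0(3)[of x] by (cases "x \<in> S") (auto simp: le_max_iff_disj)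
  then show ?case using 0 by (auto simp: Cbd_0)
next
  case (Suc K)
  have d: "\<And>x. f differentiable (at x)" using Suc.prems by auto
  have z: "partial_deriv i f x = 0" if "x \<notin> S" for i x
  proof -
    have o: "open (- S)" using \<open>compact S\<close> compact_imp_closed by blast
    have "(f has_derivative (\<lambda>h. 0)) (at x)"
      by (rule has_derivative_transform_within_open[where f = "\<lambda>_. 0", OF _ o]) (use that Suc.prems in auto)
    then show ?thesis using partial_deriv_eq by blast
  qed
  have "\<forall>i. \<exists>A. Cbd K A 1 (partial_deriv i f)"
    using Suc.IH[OF _ Suc.prems(2) z] Suc.prems(1) by auto
  then obtain B where B: "\<And>i. Cbd K (B i) 1 (partial_deriv i f)" by metis
  have "continuous_on UNIV f" using d by (simp add: continuous_at_imp_continuous_on differentiable_imp_continuous_within)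
  then have "compact (f ` S)" using Suc by (auto intro!: compact_continuous_image intro: continuous_on_subset)
  then obtain B0 where B0: "\<forall>y\<in>f ` S. norm y \<le> B0" using compact_imp_bounded bounded_iff by metis
  have n0: "0 \<le> B i" for i using Cbd_nonneg[OF B] .
  let ?A = "\<bar>B0\<bar> + (\<Sum>i\<in>UNIV. B i)"
  have s0: "0 \<le> (\<Sum>i\<in>UNIV. B i)" using n0 by (simp add: sum_nonneg)
  have 1: "norm (f x) \<le> ?A" for x 
  proof (cases "x \<in> S")
    case True
    then have "norm (f x) \<le> B0" using B0 by blast
    then show ?thesis using s0 by linarith
  next
    case False
    then show ?thesis using Suc.prems(3)[of x] s0 by simp
  qed
  have 2: "Cbd K (?A * 1) 1 (partial_deriv i f)" for i
    using n0 member_le_sum[of i UNIV B] by (intro Cbd_mono[OF B[of i]]) auto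
  show ?case using 1 2 d by (intro exI[of _ ?A]) (auto simp: Cbd_Suc)
qed

subsection \<open>Iterated differences\<close>

definition diff_op :: "'a::plus \<Rightarrow> ('a \<Rightarrow> 'b::minus) \<Rightarrow> 'a \<Rightarrow> 'b" where
  "diff_op E f x = f (x + E) - f x"

lemma Cbd_translate: "0 \<le> t \<Longrightarrow> Cbd K A t f \<Longrightarrow> Cbd K A t (\<lambda>x. f (x + b))"
  using Cbd_affine[of 1 t K A f b] by simp

lemma Cbd_diff: "Cbd K A t f \<Longrightarrow> Cbd K B t g \<Longrightarrow> Cbd K (A + B) t (\<lambda>x. f x - g x :: 'b::real_normed_vector)"
  using Cbd_add[of K A t f B "\<lambda>x. - g x"]
    Cbd_linear[OF bounded_linear_minus[OF bounded_linear_ident], of 1 K B t g] by simp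

lemma partial_deriv_diff_op:
  fixes f :: "real^'n \<Rightarrow> 'b::real_normed_vector"
  assumes "\<And>x. f differentiable (at x)"
  shows "partial_deriv i (diff_op E f) = diff_op E (partial_deriv i f)"
    and "diff_op E f differentiable (at x)"
proof -
  have D1: "((\<lambda>x. f (x + E)) has_derivative (\<lambda>h. frechet_derivative f (at (x + E)) h)) (at x)" for x
    by (rule has_derivative_compose[where f = "\<lambda>x. x + E" and f' = "\<lambda>h. h"])
      (auto intro!: derivative_eq_intros has_derivative_frechet assms)
  have D: "(diff_op E f has_derivative (\<lambda>h. frechet_derivative f (at (x + E)) h - frechet_derivative f (at x) h)) (at x)" for x
    unfolding diff_op_def[abs_def] by (intro has_derivative_diff D1 has_derivative_frechet assms)
  show "partial_deriv i (diff_op E f) = diff_op E (partial_deriv i f)"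
    by (rule ext, subst partial_deriv_eq[OF D]) (simp add: partial_deriv_def diff_op_def)
  show "diff_op E f differentiable (at x)" using D differentiable_def by blast
qed

lemma partial_deriv_diff_pow:
  fixes f :: "real^'n \<Rightarrow> 'b::real_normed_vector"
  assumes "\<And>x. f differentiable (at x)"
  shows "partial_deriv i ((diff_op E ^^ r) f) = (diff_op E ^^ r) (partial_deriv i f)
    \<and> (\<forall>x. (diff_op E ^^ r) f differentiable (at x))"
  by (induction r) (auto simp: assms partial_deriv_diff_op)

lemma norm_diff_op_le:
  fixes f :: "real^'n \<Rightarrow> 'b::real_normed_vector"
  assumes "\<And>x. f differentiable (at x)" "\<And>x. norm (partial_deriv i f x) \<le> B" "0 \<le> H"
  shows "norm (diff_op (H *\<^sub>R axis i 1) f x) \<le> H * B"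
proof -
  define E :: "real^'n" where "E = axis i 1"
  have D: "((\<lambda>\<tau>. f (x + \<tau> *\<^sub>R E)) has_derivative (\<lambda>h. h *\<^sub>R partial_deriv i f (x + \<tau> *\<^sub>R E))) (at \<tau> within {0..H})" for \<tau>
  proof -
    have "((\<lambda>\<tau>. f (x + \<tau> *\<^sub>R E)) has_derivative (\<lambda>h. frechet_derivative f (at (x + \<tau> *\<^sub>R E)) (h *\<^sub>R E))) (at \<tau> within {0..H})"
      by (rule has_derivative_compose[where f = "\<lambda>\<tau>. x + \<tau> *\<^sub>R E"])
        (auto intro!: derivative_eq_intros has_derivative_frechet assms)
    then show ?thesis
      by (simp add: partial_deriv_def E_def linear_cmul[OF has_derivative_linear[OF has_derivative_frechet[OF assms(1)]]])
  qed
  have "onorm (\<lambda>h::real. h *\<^sub>R partial_deriv i f (x + \<tau> *\<^sub>R E)) \<le> B" for \<tau>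
    by (rule onorm_le) (use assms(2) in \<open>auto simp: mult.commute[of B] intro: mult_left_mono\<close>)
  then have "norm (f (x + H *\<^sub>R E) - f (x + 0 *\<^sub>R E)) \<le> B * norm (H - 0)"
    using D assms(3) by (intro differentiable_bound[where S = "{0..H}" and f = "\<lambda>\<tau>. f (x + \<tau> *\<^sub>R E)"]) auto
  then show ?thesis using assms(3) by (simp add: diff_op_def E_def mult.commute)
qed

text \<open>A \<open>K\<close>-th difference along a coordinate direction turns the slow variation of a function,
  \<open>|D\<^sup>\<alpha> f| \<le> A t\<^bsup>|\<alpha>|\<^esup>\<close> with small \<open>t\<close>, into overall smallness: each difference either meets a
  derivative, and gains a factor \<open>t\<close>, or all \<open>K\<close> factors have been gained already.\<close>

lemma Cbd_diff_pow:
  fixes f :: "real^'n \<Rightarrow> 'b::real_normed_vector"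
  assumes "1 \<le> H" "0 \<le> t"
  shows "Cbd K A t f \<Longrightarrow> Cbd K ((2 * H) ^ K * (A * t ^ K)) 1 ((diff_op (H *\<^sub>R axis i 1) ^^ K) f)"
proof (induction K arbitrary: A f)
  case 0 then show ?case by (simp add: Cbd_0)
next
  case (Suc K)
  let ?D = "diff_op (H *\<^sub>R axis i 1) :: (real^'n \<Rightarrow> 'b) \<Rightarrow> _"
  let ?B = "(2 * H) ^ K * ((A * t) * t ^ K)"
  have d: "\<And>x. f differentiable (at x)" using Suc.prems by (auto simp: Cbd_Suc)
  note pd = partial_deriv_diff_pow[OF d, where E = "H *\<^sub>R axis i 1"]
  have IH: "Cbd K ?B 1 ((?D ^^ K) (partial_deriv j f))" for j
    using Suc.IH[of "A * t"] Suc.prems by (auto simp: Cbd_Suc)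
  have B0: "0 \<le> ?B" using Cbd_nonneg[OF IH] .
  have b2: "2 * ?B \<le> (2 * H) ^ Suc K * (A * t ^ Suc K)"
    using mult_right_mono[OF assms(1), of "2 * ?B"] B0 by (simp add: mult_ac)
  have "Cbd K (?B + ?B) 1 (?D ((?D ^^ K) (partial_deriv j f)))" for j
    unfolding diff_op_def[abs_def] by (intro Cbd_diff Cbd_translate) (use IH in \<open>auto simp: diff_op_def[abs_def]\<close>)
  then have "Cbd K ((2 * H) ^ Suc K * (A * t ^ Suc K)) 1 (?D ((?D ^^ K) (partial_deriv j f)))" for j
    by (rule Cbd_mono) (use b2 in linarith)+
  then have 1: "Cbd K ((2 * H) ^ Suc K * (A * t ^ Suc K)) 1 (partial_deriv j ((?D ^^ Suc K) f))" for j
    using pd[of j "Suc K"] by (metis comp_apply funpow.simps(2))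
  have "norm (?D ((?D ^^ K) f) x) \<le> H * ?B" for x
    by (rule norm_diff_op_le) (use pd[of i K] IH[of i] assms in \<open>auto intro: Cbd_norm_le\<close>)
  moreover have "H * ?B \<le> (2 * H) ^ Suc K * (A * t ^ Suc K)"
  proof -
    have "0 \<le> H" using assms(1) by linarith
    from mult_nonneg_nonneg[OF this B0] have "0 \<le> H * ?B" .
    then have "H * ?B \<le> 2 * (H * ?B)" by linarith
    also have "\<dots> = (2 * H) ^ Suc K * (A * t ^ Suc K)" by (simp add: mult_ac)
    finally show ?thesis .
  qed
  ultimately have 2: "norm ((?D ^^ Suc K) f x) \<le> (2 * H) ^ Suc K * (A * t ^ Suc K)" for x
    by (metis comp_apply funpow.simps(2) order_trans)
  show ?case unfolding Cbd_Suc using 1 2 pd[of i "Suc K"] by auto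
qed

section \<open>Powers and quasi-norms\<close>

lemma ennreal_pow_0 [simp]: "ennreal_pow 0 a = 0"
  by (simp add: ennreal_pow_def)

lemma ennreal_pow_ennreal: "0 \<le> r \<Longrightarrow> ennreal_pow (ennreal r) a = ennreal (r powr a)"
  by (simp add: ennreal_pow_def)

lemma ennreal_pow_1 [simp]: "ennreal_pow x 1 = x"
  by (cases x) (auto simp: ennreal_pow_def)

lemma ennreal_pow_top [simp]: "ennreal_pow top a = top"
  by (simp add: ennreal_pow_def)

lemma ennreal_pow_eq_0 [simp]: "ennreal_pow x a = 0 \<longleftrightarrow> x = 0"
  by (cases x) (auto simp: ennreal_pow_def)

lemma ennreal_pow_eq_top [simp]: "ennreal_pow x a = top \<longleftrightarrow> x = top"
  by (cases x) (auto simp: ennreal_pow_def)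

lemma ennreal_pow_mono: "0 \<le> a \<Longrightarrow> x \<le> y \<Longrightarrow> ennreal_pow x a \<le> ennreal_pow y a"
  by (cases x; cases y) (auto simp: ennreal_pow_def top_unique intro!: ennreal_leI powr_mono2)

lemma ennreal_pow_pow: "ennreal_pow (ennreal_pow x a) b = ennreal_pow x (a * b)"
  by (cases x) (auto simp: ennreal_pow_def powr_powr)

lemma ennreal_pow_mult: "ennreal_pow (x * y) a = ennreal_pow x a * ennreal_pow y a"
proof (cases "x = 0 \<or> y = 0")
  case False
  then show ?thesis
    by (cases x; cases y) (auto simp: ennreal_pow_def powr_mult ennreal_mult[symmetric] ennreal_mult_top ennreal_top_mult)
qed auto

lemma ennreal_pow_le_iff: "0 < a \<Longrightarrow> ennreal_pow x a \<le> z \<longleftrightarrow> x \<le> ennreal_pow z (1 / a)"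
  using ennreal_pow_mono[of a x "ennreal_pow z (1 / a)"] ennreal_pow_mono[of "1 / a" "ennreal_pow x a" z]
  by (auto simp: ennreal_pow_pow)

lemma ennreal_pow_measurable [measurable]:
  assumes [measurable]: "f \<in> borel_measurable M" shows "(\<lambda>x. ennreal_pow (f x) a) \<in> borel_measurable M"
  unfolding ennreal_pow_def by measurable

lemma ennreal_pow_SUP_le: "0 < a \<Longrightarrow> ennreal_pow (SUP i. w i) a \<le> (\<Sum>i. ennreal_pow (w i) a)" for w :: "nat \<Rightarrow> ennreal"
proof -
  assume a: "0 < a"
  have "ennreal_pow (w i) a \<le> (\<Sum>i. ennreal_pow (w i) a)" for i
    using ennreal_suminf_lessD by (metis le_less_linear less_irrefl)
  then have "w i \<le> ennreal_pow (\<Sum>i. ennreal_pow (w i) a) (1 / a)" for i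
    using ennreal_pow_le_iff[OF a] by blast
  then show ?thesis unfolding ennreal_pow_le_iff[OF a] by (rule SUP_least)
qed

lemma ennreal_pow_sum_le:
  assumes "finite I" "card I \<le> N" "0 \<le> a"
  shows "ennreal_pow (\<Sum>i\<in>I. u i) a \<le> ennreal (real N powr a) * (\<Sum>i\<in>I. ennreal_pow (u i) a)"
proof (cases "I = {}")
  case False
  have "Max (u ` I) \<in> u ` I" using assms(1) False by (intro Max_in) auto
  then obtain k where "k \<in> I" "Max (u ` I) = u k" by blast
  then have k: "k \<in> I" "\<And>i. i \<in> I \<Longrightarrow> u i \<le> u k" using Max_ge[of "u ` I"] assms(1) by auto
  have "(\<Sum>i\<in>I. u i) \<le> of_nat (card I) * u k" using k by (intro sum_bounded_above) auto
  also have "\<dots> \<le> ennreal (real N) * u k"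
    using assms by (intro mult_right_mono) (auto simp: ennreal_of_nat_eq_real_of_nat intro!: ennreal_leI)
  finally have "ennreal_pow (\<Sum>i\<in>I. u i) a \<le> ennreal_pow (ennreal (real N) * u k) a"
    using assms by (intro ennreal_pow_mono)
  also have "\<dots> = ennreal (real N powr a) * ennreal_pow (u k) a"
    by (simp add: ennreal_pow_mult ennreal_pow_ennreal)
  also have "\<dots> \<le> ennreal (real N powr a) * (\<Sum>i\<in>I. ennreal_pow (u i) a)"
    using k assms by (intro mult_left_mono member_le_sum) auto
  finally show ?thesis .
qed auto

lemma enn2real_pos: "0 < p \<Longrightarrow> p \<noteq> \<infinity> \<Longrightarrow> 0 < enn2real p"
  using enn2real_positive_iff less_top by auto

lemma Lp_qnorm_le_iff:
  assumes "0 < p" "p \<noteq> \<infinity>"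
  shows "Lp_qnorm M p f \<le> B \<longleftrightarrow> (\<integral>\<^sup>+x. ennreal_pow (f x) (enn2real p) \<partial>M) \<le> ennreal_pow B (enn2real p)"
  using enn2real_pos[OF assms] assms ennreal_pow_le_iff[of "1 / enn2real p"] by (simp add: Lp_qnorm_def)

lemma Lp_qnorm_top_le: "f \<in> borel_measurable M \<Longrightarrow> AE x in M. f x \<le> B \<Longrightarrow> Lp_qnorm M \<infinity> f \<le> B"
  by (auto simp: Lp_qnorm_def)

lemma Lp_qnorm_top_AE: "AE x in M. f x \<le> Lp_qnorm M \<infinity> f"
  using esssup_AE[of f M] by (simp add: Lp_qnorm_def)

lemma Lp_qnorm_pow:
  assumes "0 < p" "p \<noteq> \<infinity>"
  shows "ennreal_pow (Lp_qnorm M p f) (enn2real p) = (\<integral>\<^sup>+x. ennreal_pow (f x) (enn2real p) \<partial>M)"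
  using enn2real_pos[OF assms] assms by (simp add: Lp_qnorm_def ennreal_pow_pow)

lemma Lp_qnorm_mono_AE:
  assumes "f \<in> borel_measurable M" "AE x in M. f x \<le> g x"
  shows "Lp_qnorm M p f \<le> Lp_qnorm M p g"
proof (cases "p = \<infinity>")
  case True then show ?thesis using assms by (simp add: Lp_qnorm_def esssup_AE_mono)
next
  case False then show ?thesis unfolding Lp_qnorm_def using assms(2)
    by (auto intro!: ennreal_pow_mono nn_integral_mono_AE elim!: eventually_mono)
qed

lemma Lp_qnorm_mono:
  assumes "f \<in> borel_measurable M" "\<And>x. f x \<le> g x"
  shows "Lp_qnorm M p f \<le> Lp_qnorm M p g"
  using assms by (intro Lp_qnorm_mono_AE) auto

lemma Lp_qnorm_finite_AE:
  assumes "f \<in> borel_measurable M" "0 < p" "Lp_qnorm M p f < \<infinity>" shows "AE x in M. f x < \<infinity>"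
proof (cases "p = \<infinity>")
  case True then show ?thesis using Lp_qnorm_top_AE[of f M] assms by (auto elim!: eventually_mono)
next
  case False
  have "(\<integral>\<^sup>+x. ennreal_pow (f x) (enn2real p) \<partial>M) \<noteq> \<infinity>"
    using assms Lp_qnorm_pow[OF assms(2) False, of M f, symmetric] by simp
  then have "AE x in M. ennreal_pow (f x) (enn2real p) \<noteq> \<infinity>"
    using assms by (intro nn_integral_PInf_AE) auto
  then show ?thesis by (auto elim!: eventually_mono simp: less_top)
qed

lemma Lp_qnorm_0_AE:
  assumes "f \<in> borel_measurable M" "0 < p" "Lp_qnorm M p f = 0" shows "AE x in M. f x = 0"
proof (cases "p = \<infinity>")
  case True then show ?thesis using Lp_qnorm_top_AE[of f M] assms by (auto elim!: eventually_mono)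
next
  case False
  have "(\<integral>\<^sup>+x. ennreal_pow (f x) (enn2real p) \<partial>M) = 0"
    using assms Lp_qnorm_pow[OF assms(2) False, of M f, symmetric] by simp
  then show ?thesis using assms(1) by (subst (asm) nn_integral_0_iff_AE) auto
qed

lemma Lp_qnorm_zero [simp]: "0 < p \<Longrightarrow> Lp_qnorm M p (\<lambda>x. 0) = 0"
  using Lp_qnorm_top_le[of "\<lambda>_. 0" M 0] by (cases "p = \<infinity>") (auto simp: Lp_qnorm_def)

lemma Lp_qnorm_cmult:
  assumes "f \<in> borel_measurable M" "0 < p"
  shows "Lp_qnorm M p (\<lambda>x. c * f x) \<le> c * Lp_qnorm M p f"
proof (cases "p = \<infinity>")
  case True
  have "AE x in M. c * f x \<le> c * Lp_qnorm M \<infinity> f"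
    using Lp_qnorm_top_AE[of f M] by (auto elim!: eventually_mono intro: mult_left_mono)
  then show ?thesis unfolding True using assms by (intro Lp_qnorm_top_le) auto
next
  case False
  show ?thesis unfolding Lp_qnorm_le_iff[OF assms(2) False] ennreal_pow_mult Lp_qnorm_pow[OF assms(2) False]
    using assms by (subst nn_integral_cmult) auto
qed

lemma Lp_qnorm_point_le: "0 < p \<Longrightarrow> f i \<le> Lp_qnorm (count_space UNIV) p f"
proof (cases "p = \<infinity>")
  case True then show ?thesis using Lp_qnorm_top_AE[of f "count_space UNIV"] by (auto simp: AE_count_space)
next
  case False assume p: "0 < p"
  have "ennreal_pow (f i) (enn2real p) \<le> (\<integral>\<^sup>+x. ennreal_pow (f x) (enn2real p) \<partial>count_space UNIV)"
    by (rule nn_integral_ge_point) simp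
  then show ?thesis using ennreal_pow_le_iff[of "enn2real p"] enn2real_pos[OF p False] False
    by (simp add: Lp_qnorm_def)
qed

lemma Lp_qnorm_count_mono: "(\<And>i. f i \<le> g i) \<Longrightarrow> Lp_qnorm (count_space UNIV) p f \<le> Lp_qnorm (count_space UNIV) p g"
  by (rule Lp_qnorm_mono) auto

lemma Lp_qnorm_count_inj:
  assumes "inj \<pi>" "0 < p"
  shows "Lp_qnorm (count_space UNIV) p (\<lambda>i. f (\<pi> i)) \<le> Lp_qnorm (count_space UNIV) p f"
proof (cases "p = \<infinity>")
  case True show ?thesis unfolding True
    by (intro Lp_qnorm_top_le AE_I2) (auto intro: Lp_qnorm_point_le)
next
  case False
  let ?g = "\<lambda>x. ennreal_pow (f x) (enn2real p)"
  have "(\<integral>\<^sup>+i. ?g (\<pi> i) \<partial>count_space UNIV) = (\<integral>\<^sup>+i. ?g i \<partial>count_space (range \<pi>))"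
    using assms(1) by (intro nn_integral_bij_count_space) (auto simp: bij_betw_def)
  also have "\<dots> \<le> (\<integral>\<^sup>+i. ?g i \<partial>count_space UNIV)"
    by (simp add: nn_integral_count_space_indicator nn_integral_mono indicator_def)
  finally show ?thesis unfolding Lp_qnorm_le_iff[OF assms(2) False] Lp_qnorm_pow[OF assms(2) False] .
qed

text \<open>The next constant replaces the triangle inequality, uniformly in \<open>p\<close>: a series with
  geometrically decaying quasi-norms is bounded like its first term. For \<open>p < \<infinity>\<close> half of the decay
  turns the series into a pointwise supremum, and the other half bounds this supremum, since
  the \<open>p\<close>-th power of a supremum is at most the sum of the \<open>p\<close>-th powers.\<close>

definition geo_const :: "ennreal \<Rightarrow> real \<Rightarrow> real" where
  "geo_const p \<epsilon> = (if p = \<infinity> then 1 / (1 - 2 powr - \<epsilon>)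
     else 1 / (1 - 2 powr - (\<epsilon> / 2)) * (1 / (1 - 2 powr - (\<epsilon> / 2 * enn2real p))) powr (1 / enn2real p))"

lemma two_powr_less_1: "0 < \<epsilon> \<Longrightarrow> (2::real) powr - \<epsilon> < 1"
  by (simp add: powr_less_one)

lemma geo_const_pos: "0 < p \<Longrightarrow> 0 < \<epsilon> \<Longrightarrow> 0 < geo_const p \<epsilon>"
  unfolding geo_const_def using two_powr_less_1[of \<epsilon>] two_powr_less_1[of "\<epsilon> / 2"]
    two_powr_less_1[of "\<epsilon> / 2 * enn2real p"] enn2real_pos[of p] by (auto intro!: mult_pos_pos divide_pos_pos)

lemma suminf_geometric_ennreal:
  assumes "0 < \<epsilon>" shows "(\<Sum>i. ennreal (2 powr - (real i * \<epsilon>))) = ennreal (1 / (1 - 2 powr - \<epsilon>))"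
proof -
  have "(2::real) powr - (real i * \<epsilon>) = (2 powr - \<epsilon>) ^ i" for i
    by (simp add: powr_realpow[symmetric] powr_powr mult.commute)
  moreover have "(\<lambda>i. (2 powr - \<epsilon>) ^ i) sums (1 / (1 - 2 powr - \<epsilon>))"
    using two_powr_less_1[OF assms] by (intro geometric_sums) simp
  ultimately show ?thesis by (intro suminf_ennreal_eq) auto
qed

lemma suminf_geometric_le:
  assumes "0 < \<epsilon>" "\<And>i. w i \<le> ennreal (2 powr - (real i * \<epsilon>)) * B"
  shows "(\<Sum>i. w i) \<le> ennreal (1 / (1 - 2 powr - \<epsilon>)) * B"
proof -
  have "(\<Sum>i. w i) \<le> (\<Sum>i. ennreal (2 powr - (real i * \<epsilon>)) * B)" using assms by (intro suminf_le) auto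
  then show ?thesis unfolding ennreal_suminf_multc suminf_geometric_ennreal[OF assms(1)] .
qed

lemma Lp_qnorm_suminf_le:
  assumes p: "0 < p" and \<epsilon>: "0 < \<epsilon>" and [measurable]: "\<And>i. w i \<in> borel_measurable M"
    and le: "\<And>i. Lp_qnorm M p (w i) \<le> ennreal (2 powr - (real i * \<epsilon>)) * B"
  shows "Lp_qnorm M p (\<lambda>x. \<Sum>i. w i x) \<le> ennreal (geo_const p \<epsilon>) * B"
proof (cases "p = \<infinity>")
  case True
  have "AE x in M. \<forall>i. w i x \<le> ennreal (2 powr - (real i * \<epsilon>)) * B"
    unfolding AE_all_countable
  proof
    fix i show "AE x in M. w i x \<le> ennreal (2 powr - (real i * \<epsilon>)) * B"
      using Lp_qnorm_top_AE[of "w i" M] le[of i] True by (auto elim!: eventually_mono)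
  qed
  then have "AE x in M. (\<Sum>i. w i x) \<le> ennreal (geo_const p \<epsilon>) * B"
    by (rule eventually_mono) (use True suminf_geometric_le[OF \<epsilon>] in \<open>auto simp: geo_const_def\<close>)
  then show ?thesis unfolding True by (intro Lp_qnorm_top_le) auto
next
  case False
  define P where "P = enn2real p"
  have P: "0 < P" using enn2real_pos[OF p False] by (simp add: P_def)
  define \<delta> where "\<delta> = \<epsilon> / 2"
  have \<delta>: "0 < \<delta>" "\<epsilon> = 2 * \<delta>" using \<epsilon> by (auto simp: \<delta>_def)
  define G where "G = 1 / (1 - 2 powr - \<delta>)"
  define G' where "G' = 1 / (1 - 2 powr - (\<delta> * P))"
  have G: "0 < G" "0 < G'" using two_powr_less_1[of \<delta>] two_powr_less_1[of "\<delta> * P"] \<delta> P by (auto simp: G_def G'_def)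
  define S where "S x = (SUP i. ennreal (2 powr (real i * \<delta>)) * w i x)" for x
  have Sm[measurable]: "S \<in> borel_measurable M" unfolding S_def[abs_def] by measurable
  have inv: "ennreal (2 powr - a) * (ennreal (2 powr a) * z) = z" for a z
    by (simp add: mult.assoc[symmetric] ennreal_mult[symmetric] powr_add[symmetric])
  have pw: "(\<Sum>i. w i x) \<le> ennreal G * S x" for x
    unfolding G_def
  proof (rule suminf_geometric_le[OF \<delta>(1)])
    fix i
    have "ennreal (2 powr (real i * \<delta>)) * w i x \<le> S x" unfolding S_def by (rule SUP_upper) simp
    then have "ennreal (2 powr - (real i * \<delta>)) * (ennreal (2 powr (real i * \<delta>)) * w i x) \<le> ennreal (2 powr - (real i * \<delta>)) * S x"
      by (rule mult_left_mono) simp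
    then show "w i x \<le> ennreal (2 powr - (real i * \<delta>)) * S x" unfolding inv .
  qed
  have I: "(\<integral>\<^sup>+x. ennreal_pow (w i x) P \<partial>M) \<le> ennreal_pow (ennreal (2 powr - (real i * \<epsilon>)) * B) P" for i
    using le[of i] unfolding Lp_qnorm_le_iff[OF p False] P_def .
  have J: "(\<integral>\<^sup>+x. ennreal_pow (ennreal (2 powr (real i * \<delta>)) * w i x) P \<partial>M) \<le> ennreal (2 powr - (real i * (\<delta> * P))) * ennreal_pow B P" for i
  proof -
    have "(\<integral>\<^sup>+x. ennreal_pow (ennreal (2 powr (real i * \<delta>)) * w i x) P \<partial>M)
        = ennreal_pow (ennreal (2 powr (real i * \<delta>))) P * (\<integral>\<^sup>+x. ennreal_pow (w i x) P \<partial>M)"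
      unfolding ennreal_pow_mult by (intro nn_integral_cmult) auto
    also have "\<dots> \<le> ennreal_pow (ennreal (2 powr (real i * \<delta>))) P * ennreal_pow (ennreal (2 powr - (real i * \<epsilon>)) * B) P"
      by (intro mult_left_mono I) auto
    also have "\<dots> = ennreal (2 powr - (real i * (\<delta> * P))) * ennreal_pow B P"
    proof -
      have e: "2 powr (real i * \<delta>) * 2 powr - (real i * \<epsilon>) = (2::real) powr - (real i * \<delta>)"
        unfolding powr_add[symmetric] by (simp add: \<delta>(2) mult.commute)
      have "ennreal_pow (ennreal (2 powr (real i * \<delta>))) P * ennreal_pow (ennreal (2 powr - (real i * \<epsilon>)) * B) P
          = ennreal_pow (ennreal (2 powr (real i * \<delta>)) * ennreal (2 powr - (real i * \<epsilon>))) P * ennreal_pow B P"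
        unfolding ennreal_pow_mult by (simp only: mult.assoc)
      also have "ennreal (2 powr (real i * \<delta>)) * ennreal (2 powr - (real i * \<epsilon>)) = ennreal (2 powr - (real i * \<delta>))"
        using e by (simp add: ennreal_mult[symmetric])
      also have "ennreal_pow \<dots> P = ennreal (2 powr - (real i * (\<delta> * P)))"
        by (simp add: ennreal_pow_ennreal powr_powr mult.assoc)
      finally show ?thesis .
    qed
    finally show ?thesis .
  qed
  have "(\<integral>\<^sup>+x. ennreal_pow (S x) P \<partial>M) \<le> (\<integral>\<^sup>+x. (\<Sum>i. ennreal_pow (ennreal (2 powr (real i * \<delta>)) * w i x) P) \<partial>M)"
    unfolding S_def using P by (intro nn_integral_mono ennreal_pow_SUP_le)
  also have "\<dots> = (\<Sum>i. \<integral>\<^sup>+x. ennreal_pow (ennreal (2 powr (real i * \<delta>)) * w i x) P \<partial>M)"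
    by (intro nn_integral_suminf) auto
  also have "\<dots> \<le> ennreal G' * ennreal_pow B P"
    unfolding G'_def using \<delta> P by (intro suminf_geometric_le J) auto
  finally have S_le: "(\<integral>\<^sup>+x. ennreal_pow (S x) P \<partial>M) \<le> ennreal G' * ennreal_pow B P" .
  have "(\<integral>\<^sup>+x. ennreal_pow (\<Sum>i. w i x) P \<partial>M) \<le> (\<integral>\<^sup>+x. ennreal_pow (ennreal G * S x) P \<partial>M)"
    using P pw by (intro nn_integral_mono ennreal_pow_mono) auto
  also have "\<dots> = ennreal_pow (ennreal G) P * (\<integral>\<^sup>+x. ennreal_pow (S x) P \<partial>M)"
    unfolding ennreal_pow_mult by (intro nn_integral_cmult) auto
  also have "\<dots> \<le> ennreal_pow (ennreal G) P * (ennreal G' * ennreal_pow B P)"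
    by (intro mult_left_mono S_le) auto
  also have "ennreal G' = ennreal_pow (ennreal (G' powr (1 / P))) P"
    using G P by (simp add: ennreal_pow_ennreal powr_powr)
  also have "ennreal_pow (ennreal G) P * (\<dots> * ennreal_pow B P) = ennreal_pow (ennreal (geo_const p \<epsilon>) * B) P"
  proof -
    have g: "geo_const p \<epsilon> = G * G' powr (1 / P)"
      unfolding geo_const_def G_def G'_def \<delta>_def P_def using False by simp
    show ?thesis unfolding g using G by (simp only: ennreal_pow_mult ennreal_mult less_imp_le powr_ge_zero mult.assoc)
  qed
  finally show ?thesis unfolding Lp_qnorm_le_iff[OF p False] P_def .
qed

definition sum_const :: "ennreal \<Rightarrow> nat \<Rightarrow> real" where
  "sum_const p N = geo_const p 1 * 2 ^ N"

lemma sum_const_pos: "0 < p \<Longrightarrow> 0 < sum_const p N"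
  by (simp add: sum_const_def geo_const_pos)

text \<open>Finite sums are padded with zeros to series, with an artificial geometric decay that costs
  a factor \<open>2\<^sup>N\<close>.\<close>

lemma Lp_qnorm_sum_le:
  assumes p: "0 < p" and I: "finite I" "card I \<le> N" and m: "\<And>i. i \<in> I \<Longrightarrow> f i \<in> borel_measurable M"
    and le: "\<And>i. i \<in> I \<Longrightarrow> Lp_qnorm M p (f i) \<le> B"
  shows "Lp_qnorm M p (\<lambda>x. \<Sum>i\<in>I. f i x) \<le> ennreal (sum_const p N) * B"
proof -
  obtain h where h: "bij_betw h {..<card I} I"
    using I(1) ex_bij_betw_nat_finite atLeast0LessThan by metis
  define w where "w i x = (if i < card I then f (h i) x else 0)" for i x
  have hI: "i < card I \<Longrightarrow> h i \<in> I" for i using h by (auto simp: bij_betw_def)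
  have [measurable]: "w i \<in> borel_measurable M" for i
    using m hI unfolding w_def[abs_def] by (cases "i < card I") auto
  have "Lp_qnorm M p (\<lambda>x. \<Sum>i. w i x) \<le> ennreal (geo_const p 1) * (ennreal (2 ^ N) * B)"
  proof (rule Lp_qnorm_suminf_le[OF p])
    fix i
    show "Lp_qnorm M p (w i) \<le> ennreal (2 powr - (real i * 1)) * (ennreal (2 ^ N) * B)"
    proof (cases "i < card I")
      case True
      have "(1::real) \<le> 2 powr (real N - real i)" using True I by (intro ge_one_powr_ge_zero) auto
      also have "\<dots> = 2 powr - real i * 2 ^ N" by (simp add: powr_diff powr_minus powr_realpow divide_simps)
      finally have "1 * B \<le> ennreal (2 powr - real i * 2 ^ N) * B"
        by (intro mult_right_mono) (auto simp: ennreal_1[symmetric] simp del: ennreal_1)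
      moreover have "Lp_qnorm M p (w i) \<le> B" using True le[OF hI[OF True]] by (simp add: w_def[abs_def])
      ultimately show ?thesis by (simp add: ennreal_mult mult.assoc)
    qed (use p in \<open>simp add: w_def[abs_def]\<close>)
  qed auto
  moreover have "(\<Sum>i. w i x) = (\<Sum>i\<in>I. f i x)" for x
  proof -
    have "(\<Sum>i. w i x) = (\<Sum>i<card I. w i x)" by (rule suminf_finite) (auto simp: w_def)
    also have "\<dots> = (\<Sum>i<card I. f (h i) x)" by (simp add: w_def)
    also have "\<dots> = (\<Sum>i\<in>I. f i x)" using sum.reindex_bij_betw[OF h] .
    finally show ?thesis .
  qed
  ultimately show ?thesis
    using geo_const_pos[OF p] by (simp add: sum_const_def ennreal_mult mult.assoc less_imp_le)
qed

lemma Lp_qnorm_add_le: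
  assumes "0 < p" "f \<in> borel_measurable M" "g \<in> borel_measurable M"
    "Lp_qnorm M p f \<le> B" "Lp_qnorm M p g \<le> B"
  shows "Lp_qnorm M p (\<lambda>x. f x + g x) \<le> ennreal (sum_const p 2) * B"
  using Lp_qnorm_sum_le[of p "UNIV :: bool set" 2 "\<lambda>i. if i then f else g" M B] assms
  by (simp add: UNIV_bool add.commute)

section \<open>Atomic decompositions as pointwise series\<close>

lemma mem_dil_cube:
  fixes x :: "real^'n"
  shows "x \<in> dil_cube d j m \<longleftrightarrow> (\<forall>i. \<bar>2 ^ j * x $ i - of_int (m $ i)\<bar> \<le> d)"
proof -
  have "\<bar>x $ i - (2 powr (- real j) *\<^sub>R lattice_vec m) $ i\<bar> \<le> (d * 2 powr (1 - real j)) / 2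
      \<longleftrightarrow> \<bar>2 ^ j * x $ i - of_int (m $ i)\<bar> \<le> d" for i
  proof -
    have "2 ^ j * (x $ i - (2 powr (- real j) *\<^sub>R lattice_vec m) $ i) = 2 ^ j * x $ i - of_int (m $ i)"
      by (simp add: lattice_vec_def powr_minus powr_realpow right_diff_distrib)
    then have "\<bar>2 ^ j * x $ i - of_int (m $ i)\<bar> = 2 ^ j * \<bar>x $ i - (2 powr (- real j) *\<^sub>R lattice_vec m) $ i\<bar>"
      by (metis abs_mult abs_numeral power_abs)
    moreover have "(d * 2 powr (1 - real j)) / 2 = d / 2 ^ j"
      by (simp add: powr_diff powr_realpow)
    ultimately show ?thesis by (simp add: pos_le_divide_eq mult.commute)
  qed
  then show ?thesis unfolding dil_cube_def by blast
qed

text \<open>A bound for the number of lattice points at distance at most \<open>R\<close>, in each of \<open>n\<close> coordinates,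
  from a given point.\<close>

definition cube_count :: "nat \<Rightarrow> real \<Rightarrow> nat" where
  "cube_count n R = (nat \<lfloor>2 * R\<rfloor> + 1) ^ n"

lemma near_lattice_points:
  fixes y :: "'n::finite \<Rightarrow> real" and R :: real
  defines "S \<equiv> {m::int^'n. \<forall>i. \<bar>y i - of_int (m $ i)\<bar> \<le> R}"
  shows "finite S" "card S \<le> cube_count CARD('n) R"
proof -
  let ?B = "\<lambda>i. {\<lceil>y i - R\<rceil>..\<lfloor>y i + R\<rfloor>}"
  have inj: "inj_on (\<lambda>m i. m $ i) S" by (rule inj_onI) (auto simp: vec_eq_iff fun_eq_iff)
  have sub: "(\<lambda>m i. m $ i) ` S \<subseteq> PiE UNIV ?B"
    by (auto simp: S_def PiE_def Pi_def abs_le_iff ceiling_le_iff le_floor_iff algebra_simps)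
  have fin: "finite (PiE UNIV ?B)" by (intro finite_PiE) auto
  show "finite S" using finite_subset[OF sub fin] inj finite_imageD by blast
  have "card S = card ((\<lambda>m i. m $ i) ` S)" using inj by (simp add: card_image)
  also have "\<dots> \<le> card (PiE UNIV ?B)" by (rule card_mono[OF fin sub])
  also have "\<dots> = (\<Prod>i\<in>UNIV. card (?B i))" by (simp add: card_PiE)
  also have "\<dots> \<le> (\<Prod>i\<in>(UNIV::'n set). nat \<lfloor>2 * R\<rfloor> + 1)"
  proof (rule prod_mono)
    fix i
    have "\<lfloor>y i + R\<rfloor> - \<lceil>y i - R\<rceil> \<le> \<lfloor>2 * R\<rfloor>" by linarith
    then show "0 \<le> card (?B i) \<and> card (?B i) \<le> nat \<lfloor>2 * R\<rfloor> + 1" by (simp add: nat_le_iff) linarith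
  qed
  finally show "card S \<le> cube_count CARD('n) R" by (simp add: cube_count_def)
qed

lemma finite_cubes_at:
  fixes x :: "real^'n"
  shows "finite {m. x \<in> dil_cube d j m}" "card {m. x \<in> dil_cube d j m} \<le> cube_count CARD('n) d"
  using near_lattice_points[of "\<lambda>i. 2 ^ j * x $ i" d] by (auto simp: mem_dil_cube)

lemma dil_cube_cbox:
  "dil_cube d j m = cbox (\<chi> i. (of_int (m $ i) - d) / 2 ^ j) (\<chi> i. (of_int (m $ i) + d) / 2 ^ j)"
  by (rule set_eqI) (auto simp: mem_dil_cube mem_box_cart abs_le_iff field_simps)

lemma closed_dil_cube [simp]: "closed (dil_cube d j m)"
  by (simp add: dil_cube_cbox closed_cbox)

lemma dil_cube_measurable [measurable]: "dil_cube d j m \<in> sets lebesgue"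
  by (simp add: dil_cube_cbox)

lemma emeasure_dil_cube:
  fixes m :: "int^'n" assumes "0 < d"
  shows "emeasure lebesgue (dil_cube d j m) = ennreal ((2 * d) ^ CARD('n) * 2 powr - (real j * real CARD('n)))"
proof -
  have e: "(\<chi> i. (of_int (m $ i) + d) / 2 ^ j) - (\<chi> i. (of_int (m $ i) - d) / 2 ^ j) = ((\<chi> i. 2 * d / 2 ^ j) :: real^'n)"
    by (simp add: vec_eq_iff field_simps)
  have b: "((\<chi> i. 2 * d / 2 ^ j) :: real^'n) \<bullet> b = 2 * d / 2 ^ j" if "b \<in> Basis" for b
    using that by (auto simp: Basis_vec_def inner_axis)
  have "emeasure lebesgue (dil_cube d j m) = emeasure lborel (dil_cube d j m)"
    by (simp add: dil_cube_cbox)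
  also have "\<dots> = ennreal (\<Prod>b\<in>(Basis::(real^'n) set). 2 * d / 2 ^ j)"
    unfolding dil_cube_cbox
  proof (subst emeasure_lborel_cbox)
    fix b :: "real^'n" assume B: "b \<in> Basis"
    have "0 \<le> ((\<chi> i. (of_int (m $ i) + d) / 2 ^ j) - (\<chi> i. (of_int (m $ i) - d) / 2 ^ j)) \<bullet> b"
      unfolding e b[OF B] using assms by simp
    then show "(\<chi> i. (of_int (m $ i) - d) / 2 ^ j) \<bullet> b \<le> (\<chi> i. (of_int (m $ i) + d) / 2 ^ j) \<bullet> b"
      by (simp add: inner_diff_left)
  qed (unfold e, simp add: b)
  also have "\<dots> = ennreal ((2 * d / 2 ^ j) ^ CARD('n))" by simp
  also have "(2 * d / 2 ^ j) ^ CARD('n) = (2 * d) ^ CARD('n) * 2 powr - (real j * real CARD('n))"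
    by (simp add: power_divide powr_minus powr_realpow[symmetric] powr_powr field_simps)
  finally show ?thesis .
qed

text \<open>An atom with its coefficient, the latter entering only through a bound for its modulus.
  Sums and products of such functions are again of this kind, with explicit bounds.\<close>

definition piece :: "real \<Rightarrow> nat \<Rightarrow> nat \<Rightarrow> int^'n \<Rightarrow> real \<Rightarrow> (real^'n \<Rightarrow> complex) \<Rightarrow> bool" where
  "piece d K j m A g \<longleftrightarrow> Cbd K A (2 ^ j) g \<and> (\<forall>x. x \<notin> dil_cube d j m \<longrightarrow> g x = 0)"

lemma piece_nonneg: "piece d K j m A g \<Longrightarrow> 0 \<le> A"
  using Cbd_nonneg by (auto simp: piece_def)

lemma piece_norm_le: "piece d K j m A g \<Longrightarrow> norm (g x) \<le> A"
  using Cbd_norm_le by (auto simp: piece_def)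

lemma piece_measurable: "piece d K j m A g \<Longrightarrow> g \<in> borel_measurable lebesgue"
  using measurable_completion[of g lborel borel] borel_measurable_continuous_onI[of g] Cbd_continuous[of K A "2 ^ j" g]
  by (auto simp: piece_def)

lemma atom_iff_piece: "atom d K j m a \<longleftrightarrow> piece d K j m 1 a"
  by (auto simp: atom_def piece_def Cbd_def supp_iff[OF closed_dil_cube] power_mult[symmetric] mult.commute)

lemma piece_cmult: "piece d K j m A g \<Longrightarrow> piece d K j m (norm c * A) (\<lambda>x. c * g x)"
  by (auto simp: piece_def intro: Cbd_cmult)

lemma piece_zero: "0 \<le> A \<Longrightarrow> piece d K j m A (\<lambda>x. 0)"
  by (auto simp: piece_def intro!: Cbd_const)

lemma piece_eq_cmult_atom:
  assumes "piece d K j m A g"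
  obtains a where "atom d K j m a" "g = (\<lambda>x. of_real A * a x)"
proof (cases "A = 0")
  case True
  then have "g = (\<lambda>x. of_real A * 0)" using piece_norm_le[OF assms] by auto
  then show ?thesis using that[of "\<lambda>x. 0"] piece_zero[of 1] by (auto simp: atom_iff_piece)
next
  case False
  then have A: "0 < A" using piece_nonneg[OF assms] by simp
  have "piece d K j m 1 (\<lambda>x. of_real (1 / A) * g x)"
    using piece_cmult[OF assms, of "of_real (1 / A)"] A by (simp add: norm_divide)
  then show ?thesis using that[of "\<lambda>x. of_real (1 / A) * g x"] A by (simp add: atom_iff_piece)
qed

text \<open>A pointwise form of atomic representations: convergence is unconditional almost everywhere
  instead of in \<open>L\<^sub>p\<close>, so that no exponent enters.\<close>

definition decomp :: "real \<Rightarrow> nat \<Rightarrow> (real^'n \<Rightarrow> complex) \<Rightarrow> (nat \<Rightarrow> int^'n \<Rightarrow> real) \<Rightarrow> bool" where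
  "decomp d K f u \<longleftrightarrow> (\<exists>g. (\<forall>j m. piece d K j m (u j m) (g j m)) \<and>
     (AE x in lebesgue. ((\<lambda>(j, m). g j m x) has_sum f x) UNIV))"

text \<open>The contribution of one level to the quasi-norm \<open>bn\<close> of the sequence space \<open>b\<^sup>s\<^sub>p\<^sub>,\<^sub>q\<close>.\<close>

definition lev :: "real \<Rightarrow> ennreal \<Rightarrow> (nat \<Rightarrow> int^'n \<Rightarrow> real) \<Rightarrow> nat \<Rightarrow> ennreal" where
  "lev s p u j = ennreal (2 powr (real j * (s - real CARD('n) * enn2real (1 / p))))
     * Lp_qnorm (count_space UNIV) p (\<lambda>m. ennreal (u j m))"

definition bn :: "real \<Rightarrow> ennreal \<Rightarrow> ennreal \<Rightarrow> (nat \<Rightarrow> int^'n \<Rightarrow> real) \<Rightarrow> ennreal" where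
  "bn s p q u = Lp_qnorm (count_space UNIV) q (lev s p u)"

lemma b_qnorm_eq_bn: "b_qnorm s p q c = bn s p q (\<lambda>j m. norm (c j m))"
  by (simp add: b_qnorm_def bn_def lev_def[abs_def])

lemma lev_le_bn: "0 < q \<Longrightarrow> lev s p u j \<le> bn s p q u"
  unfolding bn_def by (rule Lp_qnorm_point_le)

lemma ennreal_powr_cancel [simp]:
  "ennreal (2 powr a) * (ennreal (2 powr b) * z) = ennreal (2 powr (a + b)) * z"
  by (simp add: mult.assoc[symmetric] ennreal_mult[symmetric] powr_add)

lemma level_norm_le:
  fixes u :: "nat \<Rightarrow> int^'n \<Rightarrow> real"
  assumes "0 < q"
  shows "Lp_qnorm (count_space UNIV) p (\<lambda>m. ennreal (u j m))
     \<le> ennreal (2 powr - (real j * (s - real CARD('n) * enn2real (1 / p)))) * bn s p q u"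
proof -
  have "Lp_qnorm (count_space UNIV) p (\<lambda>m. ennreal (u j m))
      = ennreal (2 powr - (real j * (s - real CARD('n) * enn2real (1 / p)))) * lev s p u j"
    by (simp add: lev_def)
  then show ?thesis using mult_left_mono[OF lev_le_bn[OF assms, of s p u j]] by simp
qed

subsection \<open>Sums over one level\<close>

lemma measurable_locally_finite_sum:
  fixes g :: "'m::countable \<Rightarrow> 'a \<Rightarrow> complex"
  assumes [measurable]: "\<And>m. g m \<in> borel_measurable M"
    and "\<And>x. finite (I x)" "\<And>x m. m \<notin> I x \<Longrightarrow> g m x = 0"
  shows "(\<lambda>x. \<Sum>m\<in>I x. g m x) \<in> borel_measurable M"
proof -
  define h where "h i x = (if i \<in> range (to_nat :: 'm \<Rightarrow> nat) then g (from_nat i) x else 0)" for i x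
  have [measurable]: "h i \<in> borel_measurable M" for i unfolding h_def[abs_def] by measurable
  have "(\<Sum>i. h i x) = (\<Sum>m\<in>I x. g m x)" for x
  proof -
    have "(\<Sum>i. h i x) = (\<Sum>i\<in>to_nat ` I x. h i x)"
    proof (rule suminf_finite)
      fix n assume n: "n \<notin> to_nat ` I x"
      show "h n x = 0"
      proof (cases "n \<in> range (to_nat :: 'm \<Rightarrow> nat)")
        case True
        then obtain m :: 'm where "n = to_nat m" by blast
        then show ?thesis using n assms(3)[of m x] by (auto simp: h_def)
      qed (simp add: h_def)
    qed (use assms(2) in auto)
    also have "\<dots> = (\<Sum>m\<in>I x. g m x)"
      by (subst sum.reindex) (auto simp: h_def inj_on_def)
    finally show ?thesis .
  qed
  moreover have "(\<lambda>x. \<Sum>i. h i x) \<in> borel_measurable M" by measurable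
  ultimately show ?thesis by simp
qed

definition level_sum :: "real \<Rightarrow> nat \<Rightarrow> (int^'n \<Rightarrow> real) \<Rightarrow> real^'n \<Rightarrow> ennreal" where
  "level_sum d j u x = (\<Sum>m | x \<in> dil_cube d j m. ennreal (u m))"

lemma finite_sum_eq_nn_integral:
  assumes "finite {m. P m}"
  shows "(\<Sum>m | P m. c m) = (\<integral>\<^sup>+m. c m * indicator {m. P m} m \<partial>count_space UNIV)"
  using assms by (subst nn_integral_count_space'[where A = "{m. P m}"]) auto

lemma level_sum_eq:
  "(\<Sum>m | x \<in> dil_cube d j m. c m) = (\<integral>\<^sup>+m. c m * indicator (dil_cube d j m) x \<partial>count_space UNIV)"
  by (subst finite_sum_eq_nn_integral[OF finite_cubes_at(1)]) (auto simp: indicator_def intro!: nn_integral_cong)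

text \<open>For \<open>p = \<infinity>\<close> the quasi-norm of a non-measurable function is infinite by convention, so
  measurability has to be established even for upper bounds.\<close>

lemma level_sum_measurable [measurable]: "level_sum d j u \<in> borel_measurable lebesgue"
proof -
  have "level_sum d j u = (\<lambda>x. ennreal (norm (\<Sum>m | x \<in> dil_cube d j m. complex_of_real (max 0 (u m)) * indicator (dil_cube d j m) x)))"
  proof
    fix x
    have "(\<Sum>m | x \<in> dil_cube d j m. complex_of_real (max 0 (u m)) * indicator (dil_cube d j m) x)
        = complex_of_real (\<Sum>m | x \<in> dil_cube d j m. max 0 (u m))"
      by (subst of_real_sum) (auto intro!: sum.cong)
    then show "level_sum d j u x = ennreal (norm (\<Sum>m | x \<in> dil_cube d j m. complex_of_real (max 0 (u m)) * indicator (dil_cube d j m) x))"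
    proof -
      assume e: "(\<Sum>m | x \<in> dil_cube d j m. complex_of_real (max 0 (u m)) * indicator (dil_cube d j m) x)
        = complex_of_real (\<Sum>m | x \<in> dil_cube d j m. max 0 (u m))"
      have "ennreal (norm (complex_of_real (\<Sum>m | x \<in> dil_cube d j m. max 0 (u m)))) = ennreal (\<Sum>m | x \<in> dil_cube d j m. max 0 (u m))"
        by (subst norm_of_real) (simp add: sum_nonneg)
      also have "\<dots> = (\<Sum>m | x \<in> dil_cube d j m. ennreal (max 0 (u m)))" by (rule sum_ennreal[symmetric]) simp
      also have "\<dots> = level_sum d j u x"
        unfolding level_sum_def by (intro sum.cong refl) (simp add: max_def ennreal_neg)
      finally show ?thesis unfolding e ..
    qed
  qed
  moreover have "(\<lambda>x. \<Sum>m | x \<in> dil_cube d j m. complex_of_real (max 0 (u m)) * indicator (dil_cube d j m) x) \<in> borel_measurable lebesgue"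
    by (rule measurable_locally_finite_sum) (auto simp: finite_cubes_at indicator_def)
  ultimately show ?thesis by simp
qed

definition level_const :: "real \<Rightarrow> nat \<Rightarrow> ennreal \<Rightarrow> real" where
  "level_const d n p = real (cube_count n d) * ((2 * d) ^ n) powr enn2real (1 / p)"

lemma enn2real_inverse: "enn2real (1 / p) = 1 / enn2real p"
proof (cases p)
  case (real r)
  have "0 < r \<Longrightarrow> 1 / ennreal r = ennreal (1 / r)" using divide_ennreal[of 1 r] by simp
  then show ?thesis using real by (cases "r = 0") auto
qed auto

text \<open>At each point at most a bounded number of cubes of one level overlap.\<close>

lemma Lp_level_sum_le:
  fixes u :: "int^'n \<Rightarrow> real"
  assumes p: "0 < p" and d: "0 < d"
  shows "Lp_qnorm lebesgue p (level_sum d j u) \<le> ennreal (level_const d CARD('n) p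
      * 2 powr - (real j * (real CARD('n) * enn2real (1 / p)))) * Lp_qnorm (count_space UNIV) p (\<lambda>m. ennreal (u m))"
proof (cases "p = \<infinity>")
  case True
  have "level_sum d j u x \<le> of_nat (cube_count CARD('n) d) * Lp_qnorm (count_space UNIV) p (\<lambda>m. ennreal (u m))" for x
  proof -
    have "level_sum d j u x \<le> of_nat (card {m. x \<in> dil_cube d j m}) * Lp_qnorm (count_space UNIV) p (\<lambda>m. ennreal (u m))"
      unfolding level_sum_def by (intro sum_bounded_above Lp_qnorm_point_le[OF p])
    also have "\<dots> \<le> of_nat (cube_count CARD('n) d) * Lp_qnorm (count_space UNIV) p (\<lambda>m. ennreal (u m))"
      using finite_cubes_at(2)[of x d j] by (intro mult_right_mono) auto
    finally show ?thesis .
  qed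
  then have "Lp_qnorm lebesgue \<infinity> (level_sum d j u) \<le> of_nat (cube_count CARD('n) d) * Lp_qnorm (count_space UNIV) p (\<lambda>m. ennreal (u m))"
    by (intro Lp_qnorm_top_le) auto
  then show ?thesis using d True by (simp add: level_const_def ennreal_of_nat_eq_real_of_nat)
next
  case False
  define P where "P = enn2real p"
  have P: "0 < P" using enn2real_pos[OF p False] by (simp add: P_def)
  let ?N = "cube_count CARD('n) d"
  let ?V = "(2 * d) ^ CARD('n) * 2 powr - (real j * real CARD('n))"
  have "(\<integral>\<^sup>+x. ennreal_pow (level_sum d j u x) P \<partial>lebesgue)
      \<le> (\<integral>\<^sup>+x. ennreal (real ?N powr P) * (\<integral>\<^sup>+m. ennreal_pow (ennreal (u m)) P * indicator (dil_cube d j m) x \<partial>count_space UNIV) \<partial>lebesgue)"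
    unfolding level_sum_def level_sum_eq[symmetric]
    using finite_cubes_at P by (intro nn_integral_mono ennreal_pow_sum_le) auto
  also have "\<dots> \<le> ennreal (real ?N powr P) * (\<integral>\<^sup>+x. (\<integral>\<^sup>+m. ennreal_pow (ennreal (u m)) P * indicator (dil_cube d j m) x \<partial>count_space UNIV) \<partial>lebesgue)"
  proof (subst nn_integral_cmult)
    have "(\<lambda>x. level_sum d j (\<lambda>m. enn2real (ennreal_pow (ennreal (u m)) P)) x) \<in> borel_measurable lebesgue" by measurable
    moreover have "ennreal (enn2real (ennreal_pow (ennreal (u m)) P)) = ennreal_pow (ennreal (u m)) P" for m
      by (simp add: ennreal_pow_def)
    ultimately show "(\<lambda>x. \<integral>\<^sup>+m. ennreal_pow (ennreal (u m)) P * indicator (dil_cube d j m) x \<partial>count_space UNIV) \<in> borel_measurable lebesgue"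
      unfolding level_sum_def level_sum_eq by simp
  qed simp
  also have "(\<integral>\<^sup>+x. (\<integral>\<^sup>+m. ennreal_pow (ennreal (u m)) P * indicator (dil_cube d j m) x \<partial>count_space UNIV) \<partial>lebesgue)
      = (\<integral>\<^sup>+m. (\<integral>\<^sup>+x. ennreal_pow (ennreal (u m)) P * indicator (dil_cube d j m) x \<partial>lebesgue) \<partial>count_space UNIV)"
    by (rule nn_integral_count_space_nn_integral) auto
  also have "\<dots> = (\<integral>\<^sup>+m. ennreal_pow (ennreal (u m)) P * ennreal ?V \<partial>count_space UNIV)"
    by (subst nn_integral_cmult_indicator, rule dil_cube_measurable, unfold emeasure_dil_cube[OF d], rule refl)
  also have "\<dots> = (\<integral>\<^sup>+m. ennreal_pow (ennreal (u m)) P \<partial>count_space UNIV) * ennreal ?V"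
    by (rule nn_integral_multc) simp
  finally have "(\<integral>\<^sup>+x. ennreal_pow (level_sum d j u x) P \<partial>lebesgue) \<le> ennreal (real ?N powr P) *
      ((\<integral>\<^sup>+m. ennreal_pow (ennreal (u m)) P \<partial>count_space UNIV) * ennreal ?V)" .
  also have "\<dots> = ennreal (real ?N powr P * ?V) * ennreal_pow (Lp_qnorm (count_space UNIV) p (\<lambda>m. ennreal (u m))) P"
    using d by (simp add: Lp_qnorm_pow[OF p False] P_def ennreal_mult mult_ac)
  also have "real ?N powr P * ?V = (level_const d CARD('n) p * 2 powr - (real j * (real CARD('n) * enn2real (1 / p)))) powr P"
    using d P by (simp add: level_const_def enn2real_inverse P_def[symmetric] powr_mult powr_powr)
  also have "ennreal \<dots> = ennreal_pow (ennreal (level_const d CARD('n) p * 2 powr - (real j * (real CARD('n) * enn2real (1 / p))))) P"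
    using d by (subst ennreal_pow_ennreal) (auto simp: level_const_def)
  finally show ?thesis unfolding Lp_qnorm_le_iff[OF p False] P_def[symmetric] ennreal_pow_mult .
qed

lemma level_const_nonneg: "0 \<le> level_const d n p"
  by (simp add: level_const_def)

text \<open>The quasi-norm of level \<open>j\<close> in \<open>L\<^sub>p\<close> is at most \<open>2\<^bsup>-jn/p\<^esup>\<close> times the \<open>\<ell>\<^sub>p\<close>-quasi-norm of its
  coefficients, hence of order \<open>2\<^bsup>-js\<^esup>\<close>. This geometric decay is the reason for the convergence of
  atomic series with \<open>s > 0\<close>.\<close>

lemma Lp_tail_le:
  fixes u :: "nat \<Rightarrow> int^'n \<Rightarrow> real"
  assumes p: "0 < p" and q: "0 < q" and d: "0 < d" and s: "0 < s"
  shows "Lp_qnorm lebesgue p (\<lambda>x. \<Sum>i. level_sum d (i + J) (u (i + J)) x)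
     \<le> ennreal (geo_const p s * level_const d CARD('n) p * 2 powr - (real J * s)) * bn s p q u"
proof -
  have "Lp_qnorm lebesgue p (\<lambda>x. \<Sum>i. level_sum d (i + J) (u (i + J)) x)
    \<le> ennreal (geo_const p s) * (ennreal (level_const d CARD('n) p) * (ennreal (2 powr - (real J * s)) * bn s p q u))"
  proof (rule Lp_qnorm_suminf_le[OF p s])
    fix i
    let ?L = "ennreal (level_const d CARD('n) p)" and ?t = "real CARD('n) * enn2real (1 / p)"
    have "Lp_qnorm lebesgue p (level_sum d (i + J) (u (i + J))) \<le> ?L * (ennreal (2 powr - (real (i + J) * ?t))
        * Lp_qnorm (count_space UNIV) p (\<lambda>m. ennreal (u (i + J) m)))"
      using Lp_level_sum_le[OF p d, of "i + J" "u (i + J)"] by (simp add: ennreal_mult level_const_nonneg mult.assoc)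
    also have "\<dots> \<le> ?L * (ennreal (2 powr - (real (i + J) * ?t)) * (ennreal (2 powr - (real (i + J) * (s - ?t))) * bn s p q u))"
      by (intro mult_left_mono level_norm_le[OF q]) auto
    also have "\<dots> = ennreal (2 powr - (real i * s)) * (?L * (ennreal (2 powr - (real J * s)) * bn s p q u))"
    proof -
      have e: "2 powr - (real (i + J) * ?t) * 2 powr - (real (i + J) * (s - ?t)) = (2::real) powr - (real i * s) * 2 powr - (real J * s)"
        unfolding powr_add[symmetric] by (rule arg_cong[where f = "\<lambda>z. 2 powr z"]) (simp add: algebra_simps)
      have "ennreal (2 powr - (real (i + J) * ?t)) * ennreal (2 powr - (real (i + J) * (s - ?t)))
          = ennreal (2 powr - (real i * s)) * ennreal (2 powr - (real J * s))"
        unfolding ennreal_mult[symmetric, OF powr_ge_zero powr_ge_zero] e ..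
      then show ?thesis by (simp only: mult.assoc[symmetric] mult.commute[of ?L]) (simp only: mult_ac)
    qed
    finally show "Lp_qnorm lebesgue p (level_sum d (i + J) (u (i + J)))
      \<le> ennreal (2 powr - (real i * s)) * (?L * (ennreal (2 powr - (real J * s)) * bn s p q u))" .
  qed auto
  then show ?thesis using geo_const_pos[OF p s] by (simp add: ennreal_mult level_const_nonneg mult.assoc)
qed

lemma AE_level_sums_finite:
  assumes "0 < p" "0 < q" "0 < d" "0 < s" "bn s p q u < \<infinity>"
  shows "AE x in lebesgue. (\<Sum>j. level_sum d j (u j) x) < \<infinity>"
  by (rule Lp_qnorm_finite_AE[OF _ assms(1)])
    (use Lp_tail_le[OF assms(1-4), of 0 u] assms(5) in \<open>auto simp: ennreal_mult_less_top intro: le_less_trans\<close>)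

lemma sizes_summable:
  fixes u :: "nat \<Rightarrow> int^'n \<Rightarrow> real"
  assumes u0: "\<And>j m. 0 \<le> u j m" and fin: "(\<Sum>j. level_sum d j (u j) x) < \<infinity>"
  shows "(\<lambda>(j, m). u j m * indicator (dil_cube d j m) x) summable_on UNIV"
    and "summable (\<lambda>j. \<Sum>m | x \<in> dil_cube d j m. u j m)"
proof -
  let ?Q = "\<lambda>j. {m. x \<in> dil_cube d j m}"
  define U where "U j = (\<Sum>m\<in>?Q j. u j m)" for j
  have U0: "0 \<le> U j" for j unfolding U_def using u0 by (simp add: sum_nonneg)
  have lU: "level_sum d j (u j) x = ennreal (U j)" for j
    unfolding level_sum_def U_def using u0 by (simp add: sum_ennreal)
  have sU: "summable U" using fin U0 unfolding lU by (intro summable_suminf_not_top) auto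
  then show "summable (\<lambda>j. \<Sum>m\<in>?Q j. u j m)" unfolding U_def .
  have outer: "(\<lambda>j. norm (U j)) summable_on UNIV"
    using sU U0 by (intro norm_summable_imp_summable_on) simp
  have inner: "((\<lambda>m. norm (u j m * indicator (dil_cube d j m) x)) has_sum U j) UNIV" for j
    unfolding U_def by (rule has_sum_finite_neutralI[of "?Q j"]) (use finite_cubes_at u0 in \<open>auto intro!: sum.cong\<close>)
  have "(\<lambda>y. norm ((\<lambda>(j, m). u j m * indicator (dil_cube d j m) x) y)) summable_on Sigma UNIV (\<lambda>_. UNIV)"
    unfolding Infinite_Sum.abs_summable_on_Sigma_iff
    unfolding prod.case infsumI[OF inner] using outer has_sum_imp_summable[OF inner] by blast
  then show "(\<lambda>(j, m). u j m * indicator (dil_cube d j m) x) summable_on UNIV"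
    using abs_summable_summable[of "\<lambda>(j, m). u j m * indicator (dil_cube d j m) x" UNIV] by simp
qed

lemma pieces_abs_summable:
  fixes g :: "nat \<Rightarrow> int^'n \<Rightarrow> 'b::banach"
  assumes u0: "\<And>j m. 0 \<le> u j m" and fin: "(\<Sum>j. level_sum d j (u j) x) < \<infinity>"
    and le: "\<And>j m. norm (g j m) \<le> u j m * indicator (dil_cube d j m) x"
  shows "(\<lambda>(j, m). norm (g j m)) summable_on UNIV"
proof -
  have "(\<lambda>y. norm (case y of (j, m) \<Rightarrow> g j m)) summable_on UNIV"
  proof (rule Infinite_Sum.abs_summable_on_comparison_test')
    show "(\<lambda>(j, m). u j m * indicator (dil_cube d j m) x) summable_on UNIV" by (rule sizes_summable[OF u0 fin])
  qed (use le in auto)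
  then show ?thesis by (simp add: case_prod_unfold)
qed

lemma pieces_has_sum_iff:
  fixes g :: "nat \<Rightarrow> int^'n \<Rightarrow> real^'n \<Rightarrow> complex"
  assumes g: "\<And>j m. piece d K j m (u j m) (g j m)"
    and fin: "(\<Sum>j. level_sum d j (u j) x) < \<infinity>"
  shows "((\<lambda>(j, m). g j m x) has_sum s) UNIV \<longleftrightarrow> (\<lambda>j. \<Sum>m | x \<in> dil_cube d j m. g j m x) sums s"
    and "summable (\<lambda>j. norm (\<Sum>m | x \<in> dil_cube d j m. g j m x))"
    and "(\<lambda>(j, m). g j m x) summable_on UNIV"
proof -
  let ?Q = "\<lambda>j. {m. x \<in> dil_cube d j m}"
  let ?h = "\<lambda>j. \<Sum>m\<in>?Q j. g j m x"
  have u0: "0 \<le> u j m" for j m using piece_nonneg[OF g] .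
  have z: "m \<notin> ?Q j \<Longrightarrow> g j m x = 0" for j m using g[of j m] by (auto simp: piece_def)
  have inner: "((\<lambda>m. g j m x) has_sum ?h j) UNIV" for j
    by (rule has_sum_finite_neutralI[of "?Q j"]) (use finite_cubes_at z in auto)
  have "norm (?h j) \<le> (\<Sum>m\<in>?Q j. u j m)" for j
    using piece_norm_le[OF g] by (intro order_trans[OF norm_sum] sum_mono)
  then show "summable (\<lambda>j. norm (?h j))"
    by (intro summable_comparison_test'[OF sizes_summable(2)[OF u0 fin], of 0]) auto
  have "(\<lambda>(j, m). norm (g j m x)) summable_on UNIV"
    by (rule pieces_abs_summable[OF u0 fin]) (use piece_norm_le[OF g] z in \<open>auto simp: indicator_def\<close>)
  then show S: "(\<lambda>(j, m). g j m x) summable_on UNIV"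
    using abs_summable_summable[of "\<lambda>(j, m). g j m x" UNIV] by (simp add: case_prod_unfold)
  have sums: "?h sums s" if "((\<lambda>(j, m). g j m x) has_sum s) UNIV" for s
  proof -
    have "(?h has_sum s) UNIV"
      by (rule has_sum_SigmaD[where f = "\<lambda>(j, m). g j m x" and A = UNIV and B = "\<lambda>_. UNIV"])
        (use that inner in auto)
    then show ?thesis by (rule has_sum_imp_sums)
  qed
  show "((\<lambda>(j, m). g j m x) has_sum s) UNIV \<longleftrightarrow> ?h sums s"
  proof
    assume h: "?h sums s"
    from S obtain t where t: "((\<lambda>(j, m). g j m x) has_sum t) UNIV" unfolding summable_on_def by blast
    have "t = s" by (rule sums_unique2[OF sums[OF t] h])
    then show "((\<lambda>(j, m). g j m x) has_sum s) UNIV" using t by simp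
  qed (rule sums)
qed

lemma pieces_tail_le:
  fixes g :: "nat \<Rightarrow> int^'n \<Rightarrow> real^'n \<Rightarrow> complex"
  assumes g: "\<And>j m. piece d K j m (u j m) (g j m)"
    and fin: "(\<Sum>j. level_sum d j (u j) x) < \<infinity>"
    and s: "((\<lambda>(j, m). g j m x) has_sum s) UNIV"
  shows "ennreal (norm (s - (\<Sum>j<J. \<Sum>m | x \<in> dil_cube d j m. g j m x))) \<le> (\<Sum>i. level_sum d (i + J) (u (i + J)) x)"
proof -
  let ?h = "\<lambda>j. \<Sum>m | x \<in> dil_cube d j m. g j m x"
  note P = pieces_has_sum_iff[OF g fin]
  have "(\<lambda>i. ?h (i + J)) sums (s - (\<Sum>j<J. ?h j))"
    using P(1)[of s] s by (auto intro: sums_split_initial_segment)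
  then have e: "s - (\<Sum>j<J. ?h j) = (\<Sum>i. ?h (i + J))" by (rule sums_unique)
  have sn: "summable (\<lambda>i. norm (?h (i + J)))" using P(2) by (rule summable_ignore_initial_segment)
  have "ennreal (norm (s - (\<Sum>j<J. ?h j))) \<le> ennreal (\<Sum>i. norm (?h (i + J)))"
    unfolding e by (intro ennreal_leI summable_norm sn)
  also have "\<dots> = (\<Sum>i. ennreal (norm (?h (i + J))))"
    by (rule suminf_ennreal2[symmetric]) (use sn in auto)
  also have "\<dots> \<le> (\<Sum>i. level_sum d (i + J) (u (i + J)) x)"
  proof (rule suminf_le)
    fix i
    have "ennreal (norm (?h (i + J))) \<le> ennreal (\<Sum>m | x \<in> dil_cube d (i + J) m. u (i + J) m)"
      using piece_norm_le[OF g] by (intro ennreal_leI order_trans[OF norm_sum] sum_mono)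
    then show "ennreal (norm (?h (i + J))) \<le> level_sum d (i + J) (u (i + J)) x"
      unfolding level_sum_def using piece_nonneg[OF g] by (simp add: sum_ennreal)
  qed auto
  finally show ?thesis .
qed

lemma piece_infsum:
  assumes "\<And>m. piece d K j m (u m) (g m)"
  shows "(\<Sum>\<^sub>\<infinity>m. g m x) = (\<Sum>m | x \<in> dil_cube d j m. g m x)"
  using assms by (intro infsumI has_sum_finite_neutralI) (auto simp: finite_cubes_at piece_def)

lemma piece_level_measurable:
  assumes "\<And>m. piece d K j m (u m) (g m)"
  shows "(\<lambda>x. \<Sum>m | x \<in> dil_cube d j m. g m x) \<in> borel_measurable lebesgue"
proof (rule measurable_locally_finite_sum)
  show "g m \<in> borel_measurable lebesgue" for m by (rule piece_measurable[OF assms])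
  show "g m x = 0" if "m \<notin> {m. x \<in> dil_cube d j m}" for x m using assms[of m] that by (auto simp: piece_def)
qed (rule finite_cubes_at)

lemma tail_tendsto_0:
  fixes u :: "nat \<Rightarrow> int^'n \<Rightarrow> real"
  assumes "0 < p" "0 < q" "0 < d" "0 < s" "bn s p q u < \<infinity>"
  shows "(\<lambda>J. Lp_qnorm lebesgue p (\<lambda>x. \<Sum>i. level_sum d (i + J) (u (i + J)) x)) \<longlonglongrightarrow> 0"
proof -
  define c where "c = geo_const p s * level_const d CARD('n) p"
  obtain b where b: "bn s p q u = ennreal b" "0 \<le> b" using assms(5) by (cases "bn s p q u") auto
  have c0: "0 \<le> c" using geo_const_pos[OF assms(1,4)] by (simp add: c_def level_const_nonneg)
  have "(\<lambda>J. (2 powr - s) ^ J) \<longlonglongrightarrow> (0::real)" 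
  proof (rule LIMSEQ_power_zero)
    show "norm (2 powr - s) < 1"
      unfolding real_norm_def abs_of_nonneg[OF powr_ge_zero] by (rule two_powr_less_1[OF assms(4)])
  qed
  then have "(\<lambda>J. c * (2 powr - s) ^ J * b) \<longlonglongrightarrow> c * 0 * b" by (intro tendsto_mult tendsto_const)
  from tendsto_ennrealI[OF this] have lim: "(\<lambda>J. ennreal (c * (2 powr - s) ^ J * b)) \<longlonglongrightarrow> 0"
    by (simp only: mult_zero_right mult_zero_left ennreal_0)
  have "(2 powr - s) ^ J = (2::real) powr - (real J * s)" for J
    by (simp add: powr_realpow[symmetric] powr_powr mult.commute)
  then have "Lp_qnorm lebesgue p (\<lambda>x. \<Sum>i. level_sum d (i + J) (u (i + J)) x) \<le> ennreal (c * (2 powr - s) ^ J * b)" for J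
    using Lp_tail_le[OF assms(1-4), of J u] c0 b by (simp add: c_def ennreal_mult[symmetric])
  then show ?thesis by (intro tendsto_sandwich[OF _ _ tendsto_const lim]) auto
qed

text \<open>For coefficients with finite quasi-norm and \<open>s > 0\<close>, convergence in \<open>L\<^sub>p\<close> of an atomic series
  is the same as unconditional pointwise convergence almost everywhere: the tails of the series of moduli tend to
  zero in \<open>L\<^sub>p\<close> and are finite almost everywhere.\<close>

lemma atomic_rep_of_decomp:
  assumes pos: "0 < p" "0 < q" "0 < d" "0 < s" and b: "bn s p q u < \<infinity>"
    and f: "f \<in> borel_measurable lebesgue" and dec: "decomp d K f u"
  obtains c a where "atomic_rep d K p f c a" "b_qnorm s p q c = bn s p q u"
proof -
  obtain g where g: "\<And>j m. piece d K j m (u j m) (g j m)"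
    and S: "AE x in lebesgue. ((\<lambda>(j, m). g j m x) has_sum f x) UNIV"
    using dec unfolding decomp_def by blast
  have "\<forall>j m. \<exists>a. atom d K j m a \<and> g j m = (\<lambda>x. of_real (u j m) * a x)"
    using piece_eq_cmult_atom[OF g] by metis
  then obtain a where a: "\<And>j m. atom d K j m (a j m)" "\<And>j m. g j m = (\<lambda>x. of_real (u j m) * a j m x)" by metis
  let ?T = "\<lambda>J x. \<Sum>i. level_sum d (i + J) (u (i + J)) x"
  let ?S = "\<lambda>J x. \<Sum>j<J. \<Sum>\<^sub>\<infinity>m. complex_of_real (u j m) * a j m x"
  have eqS: "?S J x = (\<Sum>j<J. \<Sum>m | x \<in> dil_cube d j m. g j m x)" for J x
    using piece_infsum[OF g] by (simp add: a(2))
  have mS[measurable]: "?S J \<in> borel_measurable lebesgue" for J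
    unfolding eqS by (intro borel_measurable_sum piece_level_measurable[OF g])
  note [measurable] = f
  have ae: "AE x in lebesgue. ennreal (norm (f x - ?S J x)) \<le> ?T J x" for J
    using S AE_level_sums_finite[OF pos b]
    by (rule AE_mp[OF AE_conjI AE_I2]) (use pieces_tail_le[OF g] in \<open>auto simp: eqS\<close>)
  have le: "Lp_qnorm lebesgue p (\<lambda>x. ennreal (norm (f x - ?S J x))) \<le> Lp_qnorm lebesgue p (?T J)" for J
    by (rule Lp_qnorm_mono_AE[OF _ ae]) measurable
  have "Lp_qnorm lebesgue p (\<lambda>x. ennreal (norm (f x))) < \<infinity>"
    using order_trans[OF le[of 0] Lp_tail_le[OF pos, of 0 u]] b
    by (auto simp: ennreal_mult_less_top intro: le_less_trans)
  moreover have lim: "(\<lambda>J. Lp_qnorm lebesgue p (\<lambda>x. ennreal (norm (f x - ?S J x)))) \<longlonglongrightarrow> 0"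
    by (rule tendsto_sandwich[OF _ _ tendsto_const tail_tendsto_0[OF pos b]]) (use le in auto)
  ultimately have "atomic_rep d K p f (\<lambda>j m. of_real (u j m)) a"
    unfolding atomic_rep_def Lp_def using f a(1) lim by simp
  moreover have "b_qnorm s p q (\<lambda>j m. complex_of_real (u j m)) = bn s p q u"
    using piece_nonneg[OF g] by (simp add: b_qnorm_eq_bn)
  ultimately show ?thesis using that by blast
qed

lemma decomp_of_atomic_rep:
  assumes pos: "0 < p" "0 < q" "0 < d" "0 < s" and b: "b_qnorm s p q c < \<infinity>"
    and rep: "atomic_rep d K p f c a"
  shows "decomp d K f (\<lambda>j m. norm (c j m))"
proof -
  let ?u = "\<lambda>j m. norm (c j m)"
  let ?g = "\<lambda>j m x. c j m * a j m x"
  have bb: "bn s p q ?u < \<infinity>" using b by (simp add: b_qnorm_eq_bn)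
  have g: "piece d K j m (?u j m) (?g j m)" for j m
    using rep piece_cmult[of d K j m 1 "a j m" "c j m"] by (simp add: atomic_rep_def atom_iff_piece)
  have f[measurable]: "f \<in> borel_measurable lebesgue" using rep by (auto simp: atomic_rep_def Lp_def)
  let ?h = "\<lambda>j x. \<Sum>m | x \<in> dil_cube d j m. ?g j m x"
  have hm[measurable]: "?h j \<in> borel_measurable lebesgue" for j by (rule piece_level_measurable[OF g])
  define S where "S x = (\<Sum>j. ?h j x)" for x
  have Sm[measurable]: "S \<in> borel_measurable lebesgue" unfolding S_def by measurable
  let ?T = "\<lambda>J x. \<Sum>i. level_sum d (i + J) (?u (i + J)) x"
  have AES: "AE x in lebesgue. ((\<lambda>(j, m). ?g j m x) has_sum S x) UNIV"
    using AE_level_sums_finite[OF pos bb]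
  proof eventually_elim
    case (elim x)
    note P = pieces_has_sum_iff[OF g elim]
    show ?case unfolding P(1) S_def by (rule summable_sums[OF summable_norm_cancel[OF P(2)]])
  qed
  have eqS: "(\<Sum>j<J. \<Sum>\<^sub>\<infinity>m. ?g j m x) = (\<Sum>j<J. ?h j x)" for J x
    using piece_infsum[OF g] by simp
  have l1: "(\<lambda>J. Lp_qnorm lebesgue p (\<lambda>x. ennreal (norm (f x - (\<Sum>j<J. ?h j x))))) \<longlonglongrightarrow> 0"
    using rep unfolding atomic_rep_def eqS by blast
  have le: "Lp_qnorm lebesgue p (\<lambda>x. ennreal (norm (S x - (\<Sum>j<J. ?h j x)))) \<le> Lp_qnorm lebesgue p (?T J)" for J
  proof (rule Lp_qnorm_mono_AE)
    show "AE x in lebesgue. ennreal (norm (S x - (\<Sum>j<J. ?h j x))) \<le> ?T J x"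
      using AES AE_level_sums_finite[OF pos bb]
      by (rule AE_mp[OF AE_conjI AE_I2]) (use pieces_tail_le[OF g] in auto)
  qed measurable
  have l2: "(\<lambda>J. Lp_qnorm lebesgue p (\<lambda>x. ennreal (norm (S x - (\<Sum>j<J. ?h j x))))) \<longlonglongrightarrow> 0"
    by (rule tendsto_sandwich[OF _ _ tendsto_const tail_tendsto_0[OF pos bb]]) (use le in auto)
  let ?A = "\<lambda>J. Lp_qnorm lebesgue p (\<lambda>x. ennreal (norm (f x - (\<Sum>j<J. ?h j x))))
      + Lp_qnorm lebesgue p (\<lambda>x. ennreal (norm (S x - (\<Sum>j<J. ?h j x))))"
  have "Lp_qnorm lebesgue p (\<lambda>x. ennreal (norm (f x - S x))) \<le> ennreal (sum_const p 2) * ?A J" for J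
  proof -
    have "Lp_qnorm lebesgue p (\<lambda>x. ennreal (norm (f x - S x))) \<le> Lp_qnorm lebesgue p
       (\<lambda>x. ennreal (norm (f x - (\<Sum>j<J. ?h j x))) + ennreal (norm (S x - (\<Sum>j<J. ?h j x))))"
    proof (rule Lp_qnorm_mono)
      fix x
      have "norm (f x - S x) \<le> norm (f x - (\<Sum>j<J. ?h j x)) + norm (S x - (\<Sum>j<J. ?h j x))"
        by (rule norm_diff_triangle_le[of _ "\<Sum>j<J. ?h j x"]) (auto simp: norm_minus_commute)
      then show "ennreal (norm (f x - S x)) \<le> ennreal (norm (f x - (\<Sum>j<J. ?h j x))) + ennreal (norm (S x - (\<Sum>j<J. ?h j x)))"
        using ennreal_leI[of "norm (f x - S x)" "norm (f x - (\<Sum>j<J. ?h j x)) + norm (S x - (\<Sum>j<J. ?h j x))"]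
        by (simp only: ennreal_plus norm_ge_zero)
    qed measurable
    also have "\<dots> \<le> ennreal (sum_const p 2) * ?A J"
      by (rule Lp_qnorm_add_le[OF pos(1)]) (auto simp del: ennreal_plus)
    finally show ?thesis .
  qed
  moreover have "(\<lambda>J. ennreal (sum_const p 2) * ?A J) \<longlonglongrightarrow> ennreal (sum_const p 2) * (0 + 0)"
    by (intro ennreal_tendsto_cmult tendsto_add l1 l2) simp
  ultimately have "Lp_qnorm lebesgue p (\<lambda>x. ennreal (norm (f x - S x))) \<le> 0"
    by (intro LIMSEQ_le_const[where a = "Lp_qnorm lebesgue p (\<lambda>x. ennreal (norm (f x - S x)))"]) auto
  then have "AE x in lebesgue. ennreal (norm (f x - S x)) = 0"
    by (intro Lp_qnorm_0_AE[OF _ pos(1)]) auto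
  then have "AE x in lebesgue. ((\<lambda>(j, m). ?g j m x) has_sum f x) UNIV"
    using AES by eventually_elim auto
  then show ?thesis unfolding decomp_def by (intro exI[of _ ?g] conjI allI g)
qed

lemma Besov_qnorm_le_bn:
  assumes "0 < p" "0 < q" "0 < d" "0 < s" "f \<in> borel_measurable lebesgue" "decomp d K f u" "bn s p q u < \<infinity>"
  shows "Besov_qnorm d K s p q f \<le> bn s p q u" "f \<in> Besov d K s p q"
proof -
  obtain c a where c: "atomic_rep d K p f c a" "b_qnorm s p q c = bn s p q u"
    using atomic_rep_of_decomp[OF assms(1-4,7,5,6)] .
  show "Besov_qnorm d K s p q f \<le> bn s p q u"
    unfolding Besov_qnorm_def c(2)[symmetric] using c by (intro Inf_lower) blast
  show "f \<in> Besov d K s p q" unfolding Besov_def using c assms(7) by auto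
qed

lemma Besov_qnorm_lessD:
  assumes "0 < p" "0 < q" "0 < d" "0 < s" "Besov_qnorm d K s p q f < B"
  obtains u where "decomp d K f u" "bn s p q u < B" "f \<in> borel_measurable lebesgue" "f \<in> Besov d K s p q"
proof -
  obtain c a where c: "atomic_rep d K p f c a" "b_qnorm s p q c < B"
    using assms(5) unfolding Besov_qnorm_def Inf_less_iff by blast
  have "b_qnorm s p q c < \<infinity>" using c(2) by (metis infinity_ennreal_def less_le_trans top_greatest)
  then have "decomp d K f (\<lambda>j m. norm (c j m))" "f \<in> Besov d K s p q"
    using decomp_of_atomic_rep[OF assms(1-4) _ c(1)] c(1) by (auto simp: Besov_def)
  then show ?thesis using that c by (auto simp: b_qnorm_eq_bn atomic_rep_def Lp_def)
qed

lemma Besov_qnorm_finite: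
  assumes "f \<in> Besov d K s p q" shows "Besov_qnorm d K s p q f < \<infinity>"
proof -
  obtain c a where c: "atomic_rep d K p f c a" "b_qnorm s p q c < \<infinity>" using assms by (auto simp: Besov_def)
  then have "Besov_qnorm d K s p q f \<le> b_qnorm s p q c" unfolding Besov_qnorm_def by (intro Inf_lower) blast
  then show ?thesis using c(2) by (rule le_less_trans)
qed

lemma Besov_measurable: "f \<in> Besov d K s p q \<Longrightarrow> f \<in> borel_measurable lebesgue"
  by (auto simp: Besov_def atomic_rep_def Lp_def)

section \<open>A partition of unity fitted to the cubes\<close>

lemma resolution_fun_supp:
  fixes \<psi> :: "real^'n \<Rightarrow> real"
  assumes "resolution_fun \<psi>" "\<psi> x \<noteq> 0" shows "\<bar>x $ i\<bar> \<le> sqrt (real CARD('n))"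
proof -
  have "x \<in> supp \<psi>" unfolding supp_def by (rule subsetD[OF closure_subset]) (use assms(2) in simp)
  then have "norm x \<le> sqrt (real CARD('n))" using assms(1) by (auto simp: resolution_fun_def)
  then show ?thesis using component_le_norm_cart[of x i] by linarith
qed

lemma resolution_fun_Cbd:
  fixes \<psi> :: "real^'n \<Rightarrow> real"
  assumes "resolution_fun \<psi>" obtains A where "Cbd K A 1 \<psi>"
proof -
  have "\<exists>A. Cbd K A 1 \<psi>"
  proof (rule C_class_compact_supp_bounded)
    show "compact (cball (0::real^'n) (sqrt (real CARD('n))))" by simp
    show "\<psi> x = 0" if "x \<notin> cball 0 (sqrt (real CARD('n)))" for x
    proof (rule ccontr)
      assume "\<psi> x \<noteq> 0"
      then have "x \<in> supp \<psi>" unfolding supp_def by (intro subsetD[OF closure_subset]) simp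
      then show False using assms that by (auto simp: resolution_fun_def)
    qed
  qed (use assms in \<open>auto simp: resolution_fun_def\<close>)
  then show ?thesis using that by blast
qed

text \<open>The sum extends over those lattice points whose summand may be nonzero.\<close>

definition cube_partition :: "(real^'n \<Rightarrow> real) \<Rightarrow> bool" where
  "cube_partition \<phi> \<longleftrightarrow> (\<forall>K. \<exists>A. Cbd K A 1 \<phi>) \<and> (\<forall>x. \<phi> x \<noteq> 0 \<longrightarrow> (\<forall>i. \<bar>x $ i\<bar> \<le> 1)) \<and>
     (\<forall>x. (\<Sum>m | \<forall>i. \<bar>x $ i - of_int (m $ i)\<bar> \<le> 1. \<phi> (x - lattice_vec m)) = 1)"

text \<open>The support of \<open>\<psi>\<close> need not fit into the cubes \<open>d Q\<^sub>j\<^sub>,\<^sub>m\<close> when \<open>d\<close> is close to \<open>1\<close>. The dilated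
  resolution \<open>\<psi>(2\<^sup>J x - l)\<close> has small supports, and collecting the points \<open>l\<close> of the fine lattice
  that lie in the same unit cell gives a resolution of unity with supports in \<open>[-1,1]\<^sup>n + m\<close>.\<close>

lemma ex_cube_partition:
  fixes \<psi> :: "real^'n \<Rightarrow> real"
  assumes \<psi>: "resolution_fun \<psi>"
  shows "\<exists>\<phi> :: real^'n \<Rightarrow> real. cube_partition \<phi>"
proof -
  let ?r = "sqrt (real CARD('n))"
  obtain J0 where J0: "?r < 2 ^ J0" using real_arch_pow[of 2 ?r] by auto
  \<comment> \<open>the fine lattice has \<open>2M\<close> points per unit length; the cell around a coarse point is \<open>[-M, M)\<^sup>n\<close>\<close>
  define M :: int where "M = 2 ^ J0"
  define c :: real where "c = 2 ^ Suc J0"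
  have M: "0 < M" "of_int (2 * M) = c" by (simp_all add: M_def c_def)
  have c: "0 < c" "2 * ?r < c" using J0 by (simp_all add: c_def)
  define T :: "(int^'n) set" where "T = {t. \<forall>i. - M \<le> t $ i \<and> t $ i < M}"
  have "T \<subseteq> {m. \<forall>i. \<bar>(0::real) - of_int (m $ i)\<bar> \<le> of_int M}"
  proof
    fix t assume t: "t \<in> T"
    have "\<bar>(0::real) - of_int (t $ i)\<bar> \<le> of_int M" for i
    proof -
      have "- M \<le> t $ i" "t $ i < M" using t by (auto simp: T_def)
      then have "\<bar>t $ i\<bar> \<le> M" by simp
      then have "real_of_int \<bar>t $ i\<bar> \<le> of_int M" by (simp only: of_int_le_iff)
      then show ?thesis by simp
    qed
    then show "t \<in> {m. \<forall>i. \<bar>(0::real) - of_int (m $ i)\<bar> \<le> of_int M}" by blast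
  qed
  then have finT: "finite T" using near_lattice_points(1)[of "\<lambda>_. 0" "of_int M"] by (rule finite_subset)
  define \<phi> where "\<phi> x = (\<Sum>t\<in>T. \<psi> (c *\<^sub>R x - lattice_vec t))" for x
  have supp: "\<bar>x $ i\<bar> \<le> 1" if "\<phi> x \<noteq> 0" for x i
  proof -
    obtain t where t: "t \<in> T" "\<psi> (c *\<^sub>R x - lattice_vec t) \<noteq> 0"
      using \<open>\<phi> x \<noteq> 0\<close> unfolding \<phi>_def by (meson sum.neutral)
    have "\<bar>c * x $ i - of_int (t $ i)\<bar> \<le> ?r"
      using resolution_fun_supp[OF \<psi> t(2), of i] by (simp add: lattice_vec_def)
    moreover have "\<bar>real_of_int (t $ i)\<bar> \<le> of_int M"
    proof -
      have "- M \<le> t $ i" "t $ i < M" using t by (auto simp: T_def)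
      then have "\<bar>t $ i\<bar> \<le> M" by simp
      then show ?thesis by (simp only: of_int_abs[symmetric] of_int_le_iff)
    qed
    moreover have "of_int M = c / 2" using M(2) by simp
    ultimately have "\<bar>c * x $ i\<bar> \<le> c" using c by linarith
    then show ?thesis using c by (simp add: abs_mult)
  qed
  have Cbd\<phi>: "\<exists>A. Cbd K A 1 \<phi>" for K
  proof (rule C_class_compact_supp_bounded)
    obtain A where A: "Cbd K A 1 \<psi>" using resolution_fun_Cbd[OF \<psi>] .
    have "Cbd K (\<Sum>t\<in>T. A) c \<phi>" unfolding \<phi>_def
      using c Cbd_affine[of c 1 K A \<psi> "- lattice_vec t" for t] A finT by (intro Cbd_sum) auto
    then show "C_class K \<phi>" by (simp add: Cbd_def)
    show "compact (cbox (\<chi> i. -1) (\<chi> i. 1) :: (real^'n) set)" by (rule compact_cbox)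
    show "\<phi> x = 0" if "x \<notin> cbox (\<chi> i. -1) (\<chi> i. 1)" for x
      using supp[of x] that by (force simp: mem_box_cart abs_le_iff)
  qed
  have sum1: "(\<Sum>m | \<forall>i. \<bar>x $ i - of_int (m $ i)\<bar> \<le> 1. \<phi> (x - lattice_vec m)) = 1" for x :: "real^'n"
  proof -
    let ?l = "\<lambda>(m::int^'n, t). (\<chi> i. 2 * M * m $ i + t $ i) :: int^'n"
    \<comment> \<open>division with remainder, shifted by \<open>M\<close> so that the remainders are centred\<close>
    let ?m = "\<lambda>l::int^'n. ((\<chi> i. (l $ i + M) div (2 * M)) :: int^'n, (\<chi> i. (l $ i + M) mod (2 * M) - M) :: int^'n)"
    have eq: "c *\<^sub>R x - lattice_vec (?l (m, t)) = c *\<^sub>R (x - lattice_vec m) - lattice_vec t" for m t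
      unfolding M(2)[symmetric] by (simp add: vec_eq_iff lattice_vec_def algebra_simps)
    have "((\<lambda>(m, t). \<psi> (c *\<^sub>R (x - lattice_vec m) - lattice_vec t)) has_sum 1) (UNIV \<times> T)
        = ((\<lambda>l. \<psi> (c *\<^sub>R x - lattice_vec l)) has_sum 1) UNIV"
    proof (rule has_sum_reindex_bij_witness[where j = ?l and i = ?m])
      fix a :: "(int^'n) \<times> (int^'n)" assume a: "a \<in> UNIV \<times> T"
      obtain m t where mt: "a = (m, t)" "t \<in> T" using a by auto
      have ti: "0 \<le> t $ i + M \<and> t $ i + M < 2 * M" for i
      proof -
        have "- M \<le> t $ i \<and> t $ i < M" using mt(2) by (auto simp: T_def)
        then show ?thesis by linarith
      qed
      have e: "?l a $ i + M = (t $ i + M) + 2 * M * m $ i" for i by (simp add: mt)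
      have "(?l a $ i + M) div (2 * M) = m $ i" "(?l a $ i + M) mod (2 * M) = t $ i + M" for i
        unfolding e using ti[of i] M(1) by (auto simp: div_pos_pos_trivial mod_pos_pos_trivial)
      then show "?m (?l a) = a" by (simp add: mt vec_eq_iff)
      show "\<psi> (c *\<^sub>R x - lattice_vec (?l a)) = (case a of (m, t) \<Rightarrow> \<psi> (c *\<^sub>R (x - lattice_vec m) - lattice_vec t))"
        unfolding mt(1) prod.case using eq[of m t] by simp
    next
      fix b :: "int^'n"
      have "2 * M * ((b $ i + M) div (2 * M)) + ((b $ i + M) mod (2 * M) - M) = b $ i" for i
        using mult_div_mod_eq[of "2 * M" "b $ i + M"] by linarith
      then show "?l (?m b) = b" by (simp add: vec_eq_iff)
      have "0 \<le> (b $ i + M) mod (2 * M) \<and> (b $ i + M) mod (2 * M) < 2 * M" for i using M(1) by simp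
      then show "?m b \<in> UNIV \<times> T" by (auto simp: T_def)
    qed auto
    then have "((\<lambda>(m, t). \<psi> (c *\<^sub>R (x - lattice_vec m) - lattice_vec t)) has_sum 1) (Sigma UNIV (\<lambda>_. T))"
      using \<psi> by (simp add: resolution_fun_def)
    then have h1: "((\<lambda>m. \<phi> (x - lattice_vec m)) has_sum 1) UNIV"
      by (rule has_sum_SigmaD) (use finT in \<open>auto simp: \<phi>_def intro!: has_sum_finiteI\<close>)
    have h2: "((\<lambda>m. \<phi> (x - lattice_vec m)) has_sum
        (\<Sum>m | \<forall>i. \<bar>x $ i - of_int (m $ i)\<bar> \<le> 1. \<phi> (x - lattice_vec m))) UNIV"
    proof (rule has_sum_finite_neutralI)
      fix m assume "m \<in> UNIV - {m. \<forall>i. \<bar>x $ i - of_int (m $ i)\<bar> \<le> 1}"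
      then show "\<phi> (x - lattice_vec m) = 0" using supp[of "x - lattice_vec m"] by (auto simp: lattice_vec_def)
    qed (use near_lattice_points(1)[of "\<lambda>i. x $ i" 1] in auto)
    show ?thesis by (rule has_sum_unique[OF h2 h1])
  qed
  have "cube_partition \<phi>" unfolding cube_partition_def using Cbd\<phi> supp sum1 by blast
  then show ?thesis by (intro exI[of _ \<phi>])
qed

section \<open>Rescaling\<close>

text \<open>The preimage of a null set under an invertible affine map is a null set.\<close>

lemma AE_affine:
  fixes b :: "real^'n"
  assumes "AE x in lebesgue. P x" "r \<noteq> 0" shows "AE x in lebesgue. P (r *\<^sub>R x + b)"
proof -
  obtain N where N: "{x. \<not> P x} \<subseteq> N" "N \<in> null_sets lebesgue"
    using assms(1) unfolding eventually_ae_filter by (auto simp: Collect_neg_eq)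
  let ?f = "\<lambda>y. (1 / r) *\<^sub>R (y - b)"
  have "negligible (?f ` N)"
    by (rule negligible_differentiable_image_negligible) (use N in \<open>auto simp: negligible_iff_null_sets intro!: derivative_intros\<close>)
  moreover have "{x. \<not> P (r *\<^sub>R x + b)} \<subseteq> ?f ` N"
  proof
    fix x assume "x \<in> {x. \<not> P (r *\<^sub>R x + b)}"
    then have "r *\<^sub>R x + b \<in> N" using N by auto
    moreover have "x = ?f (r *\<^sub>R x + b)" using assms(2) by simp
    ultimately show "x \<in> ?f ` N" by (rule rev_image_eqI)
  qed
  ultimately show ?thesis by (intro AE_I'[of "?f ` N"]) (auto simp: negligible_iff_null_sets)
qed

lemma measurable_scale_lebesgue:
  fixes f :: "real^'n \<Rightarrow> complex"
  assumes "f \<in> borel_measurable lebesgue" shows "(\<lambda>x. f (r *\<^sub>R x)) \<in> borel_measurable lebesgue"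
  using measurable_compose[OF lebesgue_measurable_scaling assms] .

text \<open>The grids are nested: dilation by \<open>2\<^sup>k\<close> raises the level by \<open>k\<close>, and a translation by a lattice
  vector \<open>l\<close> shifts the positions on level \<open>j\<close> by \<open>2\<^sup>j l\<close>.\<close>

lemma piece_dilate:
  fixes g :: "real^'n \<Rightarrow> complex"
  assumes "piece d K j m A g"
  shows "piece d K (j + k) (\<chi> i. m $ i - 2 ^ j * l $ i) A (\<lambda>x. g (2 ^ k *\<^sub>R x + lattice_vec l))"
proof -
  have "Cbd K A (2 ^ j * 2 ^ k) (\<lambda>x. g (2 ^ k *\<^sub>R x + lattice_vec l))"
    using assms by (intro Cbd_affine) (auto simp: piece_def)
  moreover have "2 ^ k *\<^sub>R x + lattice_vec l \<in> dil_cube d j m \<longleftrightarrow> x \<in> dil_cube d (j + k) (\<chi> i. m $ i - 2 ^ j * l $ i)" for x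
    by (simp add: mem_dil_cube lattice_vec_def power_add algebra_simps)
  ultimately show ?thesis using assms by (auto simp: piece_def power_add)
qed

lemma piece_dilate_inverse:
  fixes g :: "real^'n \<Rightarrow> complex"
  assumes "piece d K (j + k) m A g" shows "piece d K j m A (\<lambda>x. g ((1 / 2 ^ k) *\<^sub>R x))"
proof -
  have "Cbd K A (2 ^ (j + k) * (1 / 2 ^ k)) (\<lambda>x. g ((1 / 2 ^ k) *\<^sub>R x + 0))"
    using assms by (intro Cbd_affine) (auto simp: piece_def)
  moreover have "(1 / 2 ^ k) *\<^sub>R x \<in> dil_cube d (j + k) m \<longleftrightarrow> x \<in> dil_cube d j m" for x
    by (simp add: mem_dil_cube power_add)
  ultimately show ?thesis using assms by (auto simp: piece_def power_add)
qed

lemma piece_add: "piece d K j m A f \<Longrightarrow> piece d K j m B g \<Longrightarrow> piece d K j m (A + B) (\<lambda>x. f x + g x)"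
  by (auto simp: piece_def intro: Cbd_add)

lemma piece_sum:
  "finite I \<Longrightarrow> (\<And>i. i \<in> I \<Longrightarrow> piece d K j m (A i) (f i)) \<Longrightarrow> piece d K j m (\<Sum>i\<in>I. A i) (\<lambda>x. \<Sum>i\<in>I. f i x)"
  by (auto simp: piece_def intro: Cbd_sum)

lemma piece_mult:
  assumes "Cbd K A t f" "0 \<le> t" "t \<le> 2 ^ j" "piece d K j m B g"
  shows "piece d K j m (2 ^ K * (A * B)) (\<lambda>x. f x * g x)"
proof -
  have "Cbd K A (2 ^ j) f" using Cbd_mono[OF assms(1) order_refl assms(2,3)] .
  then show ?thesis using assms(4) by (auto simp: piece_def intro: Cbd_mult)
qed

lemma piece_mono: "piece d K j m A g \<Longrightarrow> A \<le> B \<Longrightarrow> piece d K j m B g"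
  by (auto simp: piece_def intro: Cbd_mono)

lemma piece_le: "piece d K j m A g \<Longrightarrow> L \<le> K \<Longrightarrow> piece d L j m A g"
  by (auto simp: piece_def intro: Cbd_le)

lemma cube_partition_piece:
  assumes "Cbd K A 1 \<phi>" "cube_partition \<phi>" "1 \<le> d"
  shows "piece d K j m A (\<lambda>x. of_real (\<phi> (2 ^ j *\<^sub>R x - lattice_vec m)))"
proof -
  have "Cbd K A (1 * 2 ^ j) (\<lambda>x. \<phi> (2 ^ j *\<^sub>R x + (- lattice_vec m)))"
    by (intro Cbd_affine assms) auto
  then have "Cbd K A (2 ^ j) (\<lambda>x. complex_of_real (\<phi> (2 ^ j *\<^sub>R x - lattice_vec m)))"
    by (intro Cbd_of_real) simp
  moreover have "\<phi> (2 ^ j *\<^sub>R x - lattice_vec m) = 0" if "x \<notin> dil_cube d j m" for x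
  proof (rule ccontr)
    assume "\<phi> (2 ^ j *\<^sub>R x - lattice_vec m) \<noteq> 0"
    then have "\<bar>(2 ^ j *\<^sub>R x - lattice_vec m) $ i\<bar> \<le> 1" for i using assms(2) unfolding cube_partition_def by blast
    then have "x \<in> dil_cube d j m" using assms(3) by (auto simp: mem_dil_cube lattice_vec_def intro: order_trans)
    with that show False ..
  qed
  ultimately show ?thesis by (auto simp: piece_def)
qed

subsection \<open>Operations on decompositions\<close>

lemma decomp_cong_AE: "decomp d K f u \<Longrightarrow> AE x in lebesgue. f x = f' x \<Longrightarrow> decomp d K f' u"
  unfolding decomp_def by (elim exE conjE) (intro exI conjI, assumption, erule (1) AE_mp[OF AE_conjI AE_I2], auto)

lemma decomp_add:
  assumes "decomp d K f u" "decomp d K g v"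
  shows "decomp d K (\<lambda>x. f x + g x) (\<lambda>j m. u j m + v j m)"
proof -
  obtain a b where a: "\<And>j m. piece d K j m (u j m) (a j m)" "AE x in lebesgue. ((\<lambda>(j, m). a j m x) has_sum f x) UNIV"
    and b: "\<And>j m. piece d K j m (v j m) (b j m)" "AE x in lebesgue. ((\<lambda>(j, m). b j m x) has_sum g x) UNIV"
    using assms unfolding decomp_def by blast
  have "AE x in lebesgue. ((\<lambda>(j, m). a j m x + b j m x) has_sum (f x + g x)) UNIV"
    using a(2) b(2)
  proof eventually_elim
    case (elim x) then show ?case using has_sum_add[OF elim] by (simp add: case_prod_unfold)
  qed
  then show ?thesis unfolding decomp_def using piece_add[OF a(1) b(1)] by (intro exI[of _ "\<lambda>j m x. a j m x + b j m x"]) auto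
qed

lemma decomp_cmult:
  assumes "decomp d K f u" "Cbd K A 1 \<eta>"
  shows "decomp d K (\<lambda>x. \<eta> x * f x) (\<lambda>j m. 2 ^ K * (A * u j m))"
proof -
  obtain a where a: "\<And>j m. piece d K j m (u j m) (a j m)" "AE x in lebesgue. ((\<lambda>(j, m). a j m x) has_sum f x) UNIV"
    using assms unfolding decomp_def by blast
  have p: "piece d K j m (2 ^ K * (A * u j m)) (\<lambda>x. \<eta> x * a j m x)" for j m
    by (rule piece_mult[OF assms(2) _ _ a(1)]) auto
  have "AE x in lebesgue. ((\<lambda>(j, m). \<eta> x * a j m x) has_sum (\<eta> x * f x)) UNIV"
    using a(2)
  proof eventually_elim
    case (elim x) then show ?case using has_sum_cmult_right[OF elim, of "\<eta> x"] by (simp add: case_prod_unfold)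
  qed
  then show ?thesis unfolding decomp_def using p by (intro exI[of _ "\<lambda>j m x. \<eta> x * a j m x"]) auto
qed

lemma decomp_shift:
  assumes "decomp d K f u"
  shows "decomp d K (\<lambda>x. f (x + lattice_vec l)) (\<lambda>j m. u j (\<chi> i. m $ i + 2 ^ j * l $ i))"
proof -
  obtain a where a: "\<And>j m. piece d K j m (u j m) (a j m)" "AE x in lebesgue. ((\<lambda>(j, m). a j m x) has_sum f x) UNIV"
    using assms unfolding decomp_def by blast
  have p: "piece d K j m (u j (\<chi> i. m $ i + 2 ^ j * l $ i)) (\<lambda>x. a j (\<chi> i. m $ i + 2 ^ j * l $ i) (x + lattice_vec l))" for j m
    using piece_dilate[OF a(1)[of j "\<chi> i. m $ i + 2 ^ j * l $ i"], of 0 l] by (simp add: vec_eq_iff)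
  have "AE x in lebesgue. ((\<lambda>(j, m). a j m (1 *\<^sub>R x + lattice_vec l)) has_sum f (1 *\<^sub>R x + lattice_vec l)) UNIV"
    by (rule AE_affine[OF a(2)]) simp
  then have "AE x in lebesgue. ((\<lambda>(j, m). a j (\<chi> i. m $ i + 2 ^ j * l $ i) (x + lattice_vec l)) has_sum f (x + lattice_vec l)) UNIV"
  proof eventually_elim
    case (elim x)
    have "((\<lambda>(j, m). a j (\<chi> i. m $ i + 2 ^ j * l $ i) (x + lattice_vec l)) has_sum f (x + lattice_vec l)) UNIV
      = ((\<lambda>(j, m). a j m (1 *\<^sub>R x + lattice_vec l)) has_sum f (1 *\<^sub>R x + lattice_vec l)) UNIV"
      by (rule has_sum_reindex_bij_witness[where j = "\<lambda>(j, m). (j, \<chi> i. m $ i + 2 ^ j * l $ i)"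
            and i = "\<lambda>(j, m). (j, \<chi> i. m $ i - 2 ^ j * l $ i)"]) (auto simp: vec_eq_iff)
    then show ?case using elim by simp
  qed
  then show ?thesis unfolding decomp_def using p by (intro exI[of _ "\<lambda>j m x. a j (\<chi> i. m $ i + 2 ^ j * l $ i) (x + lattice_vec l)"]) auto
qed

lemma decomp_single_level:
  assumes "finite M" "\<And>m. m \<in> M \<Longrightarrow> piece d K j m A (g m)" "0 \<le> A"
  shows "decomp d K (\<lambda>x. \<Sum>m\<in>M. g m x) (\<lambda>i m. if i = j \<and> m \<in> M then A else 0)"
proof -
  let ?a = "\<lambda>i m x. if i = j \<and> m \<in> M then g m x else 0"
  have "((\<lambda>(i, m). ?a i m x) has_sum (\<Sum>m\<in>M. g m x)) UNIV" for x
  proof (rule has_sum_finite_neutralI[where B = "{j} \<times> M"])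
    show "(\<Sum>m\<in>M. g m x) = (\<Sum>y\<in>{j} \<times> M. case y of (i, m) \<Rightarrow> ?a i m x)"
      by (simp add: sum.cartesian_product[symmetric])
  qed (use assms(1) in \<open>auto split: if_splits\<close>)
  moreover have "piece d K i m (if i = j \<and> m \<in> M then A else 0) (?a i m)" for i m
    using assms by (auto simp: piece_zero)
  ultimately show ?thesis unfolding decomp_def by (intro exI[of _ ?a]) auto
qed

section \<open>Synthesis from decompositions of the single terms\<close>

text \<open>Fubini for absolutely summable double series with given inner sums in both orders.\<close>

lemma has_sum_rearrange:
  fixes H :: "'a \<Rightarrow> 'b \<Rightarrow> complex"
  assumes F: "\<And>a. (H a has_sum F a) UNIV" and G: "\<And>b. ((\<lambda>a. H a b) has_sum G b) UNIV"
    and abs: "(\<lambda>(b, a). norm (H a b)) summable_on UNIV"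
    and s: "(F has_sum s) UNIV"
  shows "(G has_sum s) UNIV"
proof -
  have "(\<lambda>(b, a). H a b) summable_on UNIV"
    using abs abs_summable_summable[of "\<lambda>(b, a). H a b" UNIV] by (simp add: case_prod_unfold)
  then obtain t where t: "((\<lambda>(b, a). H a b) has_sum t) UNIV" unfolding summable_on_def by blast
  have "((\<lambda>(b, a). H a b) has_sum t) UNIV = ((\<lambda>(a, b). H a b) has_sum t) UNIV"
    by (rule has_sum_reindex_bij_witness[where i = prod.swap and j = prod.swap]) auto
  then have t': "((\<lambda>(a, b). H a b) has_sum t) (Sigma UNIV (\<lambda>_. UNIV))" using t by simp
  have "(F has_sum t) UNIV" by (rule has_sum_SigmaD[OF t']) (use F in simp)
  then have "t = s" using s has_sum_unique by blast
  have t'': "((\<lambda>(b, a). H a b) has_sum t) (Sigma UNIV (\<lambda>_. UNIV))" using t by simp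
  show ?thesis unfolding \<open>t = s\<close>[symmetric] by (rule has_sum_SigmaD[OF t'']) (use G in simp)
qed

definition near :: "real \<Rightarrow> nat \<Rightarrow> nat \<Rightarrow> int^'n \<Rightarrow> (int^'n) set" where
  "near R k L \<nu> = {\<mu>. \<forall>i. \<bar>of_int (\<nu> $ i) / 2 ^ (L - k) - of_int (\<mu> $ i)\<bar> \<le> R}"

lemma near_finite: "finite (near R k L \<nu>)" "card (near R k L (\<nu>::int^'n)) \<le> cube_count CARD('n) R"
  using near_lattice_points[of "\<lambda>i. of_int (\<nu> $ i) / 2 ^ (L - k)" R] by (auto simp: near_def)

text \<open>If the term with index \<open>(k, \<mu>)\<close> of a series is itself decomposed, with sizes \<open>v k \<mu>\<close>
  supported in levels \<open>L \<ge> k\<close> and near the cube \<open>Q\<^sub>k\<^sub>,\<^sub>\<mu>\<close>, then at each position \<open>(L, \<nu>)\<close> only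
  finitely many terms contribute.\<close>

definition synth :: "real \<Rightarrow> (nat \<Rightarrow> int^'n \<Rightarrow> nat \<Rightarrow> int^'n \<Rightarrow> real) \<Rightarrow> nat \<Rightarrow> int^'n \<Rightarrow> real" where
  "synth R v L \<nu> = (\<Sum>k\<le>L. \<Sum>\<mu>\<in>near R k L \<nu>. v k \<mu> L \<nu>)"

text \<open>The sizes \<open>synth R v\<close> bound the sums of the moduli of all terms at one position. If they have finite
  quasi-norm, the double series converges absolutely almost everywhere and may be rearranged.\<close>

lemma decomp_synth:
  fixes v :: "nat \<Rightarrow> int^'n \<Rightarrow> nat \<Rightarrow> int^'n \<Rightarrow> real"
  assumes pos: "0 < p" "0 < q" "0 < d" "0 < s" and b: "bn s p q (synth R v) < \<infinity>"
    and h: "\<And>k \<mu> L \<nu>. piece d K L \<nu> (v k \<mu> L \<nu>) (h k \<mu> L \<nu>)"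
    and nr: "\<And>k \<mu> L \<nu>. v k \<mu> L \<nu> \<noteq> 0 \<Longrightarrow> k \<le> L \<and> \<mu> \<in> near R k L \<nu>"
    and F: "AE x in lebesgue. \<forall>k \<mu>. ((\<lambda>(L, \<nu>). h k \<mu> L \<nu> x) has_sum F k \<mu> x) UNIV"
    and f: "AE x in lebesgue. ((\<lambda>(k, \<mu>). F k \<mu> x) has_sum f x) UNIV"
  shows "decomp d K f (synth R v)"
proof -
  define g where "g L \<nu> x = (\<Sum>k\<le>L. \<Sum>\<mu>\<in>near R k L \<nu>. h k \<mu> L \<nu> x)" for L \<nu> x
  have g: "piece d K L \<nu> (synth R v L \<nu>) (g L \<nu>)" for L \<nu>
    unfolding g_def[abs_def] synth_def using near_finite(1) h by (intro piece_sum) auto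
  have v0: "0 \<le> v k \<mu> L \<nu>" for k \<mu> L \<nu> using piece_nonneg[OF h] .
  have hz: "h k \<mu> L \<nu> x = 0" if "\<not> (k \<le> L \<and> \<mu> \<in> near R k L \<nu>)" for k \<mu> L \<nu> x
  proof -
    have "v k \<mu> L \<nu> = 0" using nr that by blast
    then show ?thesis using piece_norm_le[OF h, of k \<mu> L \<nu> x] by simp
  qed
  have "AE x in lebesgue. ((\<lambda>(L, \<nu>). g L \<nu> x) has_sum f x) UNIV"
    using F f AE_level_sums_finite[OF pos b]
  proof eventually_elim
    case (elim x)
    let ?H = "\<lambda>(k, \<mu>) (L, \<nu>). h k \<mu> L \<nu> x"
    let ?B = "\<lambda>(L, \<nu>). Sigma {..L} (\<lambda>k. near R k L \<nu>)"
    have fin: "finite (?B b)" for b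
      by (cases b) (auto intro!: finite_SigmaI near_finite(1))
    have out: "?H a b = 0" if "a \<notin> ?B b" for a b using that hz by (cases a; cases b) auto
    have 1: "(?H a has_sum (case a of (k, \<mu>) \<Rightarrow> F k \<mu> x)) UNIV" for a
      using elim(1) by (cases a) auto
    have G: "((\<lambda>a. ?H a b) has_sum (case b of (L, \<nu>) \<Rightarrow> g L \<nu> x)) UNIV" for b
    proof (rule has_sum_finite_neutralI[OF fin[of b]])
      show "(case b of (L, \<nu>) \<Rightarrow> g L \<nu> x) = (\<Sum>a\<in>?B b. ?H a b)"
        by (cases b) (simp add: g_def sum.Sigma near_finite(1) case_prod_unfold)
    qed (use out in auto)
    have N: "((\<lambda>a. norm (?H a b)) has_sum (\<Sum>a\<in>?B b. norm (?H a b))) UNIV" for b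
      by (rule has_sum_finite_neutralI[OF fin[of b]]) (use out in auto)
    have bd: "norm (\<Sum>a\<in>?B (L, \<nu>). norm (?H a (L, \<nu>))) \<le> synth R v L \<nu> * indicator (dil_cube d L \<nu>) x" for L \<nu>
    proof -
      have le: "norm (h k \<mu> L \<nu> x) \<le> v k \<mu> L \<nu> * indicator (dil_cube d L \<nu>) x" for k \<mu>
        using piece_norm_le[OF h, of k \<mu> L \<nu> x] h[of L \<nu> k \<mu>] by (auto simp: piece_def indicator_def)
      have "norm (\<Sum>a\<in>?B (L, \<nu>). norm (?H a (L, \<nu>))) = (\<Sum>a\<in>?B (L, \<nu>). norm (?H a (L, \<nu>)))"
        by (simp add: sum_nonneg)
      also have "\<dots> \<le> (\<Sum>(k, \<mu>)\<in>?B (L, \<nu>). v k \<mu> L \<nu> * indicator (dil_cube d L \<nu>) x)"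
        by (rule sum_mono) (use le in auto)
      also have "\<dots> = synth R v L \<nu> * indicator (dil_cube d L \<nu>) x"
        by (simp add: synth_def sum_distrib_right sum.Sigma near_finite(1) case_prod_unfold)
      finally show ?thesis .
    qed
    have "(\<lambda>(L, \<nu>). norm (\<Sum>a\<in>?B (L, \<nu>). norm (?H a (L, \<nu>)))) summable_on UNIV"
      by (rule pieces_abs_summable[OF piece_nonneg[OF g] elim(3) bd])
    then have outer: "(\<lambda>b. norm (\<Sum>a\<in>?B b. norm (?H a b))) summable_on UNIV"
      by (simp add: case_prod_unfold)
    have "(\<lambda>y. norm ((\<lambda>(b, a). ?H a b) y)) summable_on Sigma UNIV (\<lambda>_. UNIV)"
      unfolding Infinite_Sum.abs_summable_on_Sigma_iff
      unfolding prod.case infsumI[OF N] using outer has_sum_imp_summable[OF N] by blast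
    then have abs: "(\<lambda>(b, a). norm (?H a b)) summable_on UNIV" by (simp add: case_prod_unfold)
    have "((\<lambda>b. case b of (L, \<nu>) \<Rightarrow> g L \<nu> x) has_sum f x) UNIV"
      by (rule has_sum_rearrange[OF 1 G abs]) (use elim(2) in \<open>simp add: case_prod_unfold\<close>)
    then show ?case by (simp add: case_prod_unfold)
  qed
  then show ?thesis unfolding decomp_def using g by (intro exI[of _ g]) auto
qed

subsection \<open>Norm estimates\<close>

text \<open>Only boundedly many \<open>\<mu>\<close> contribute to each \<open>\<nu>\<close>, so the sum over \<open>\<mu>\<close> may be replaced by the
  \<open>\<ell>\<^sub>p\<close>-quasi-norm, and the two \<open>\<ell>\<^sub>p\<close>-quasi-norms are interchangeable.\<close>

lemma Lp_near_sum_le: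
  fixes w :: "'a::countable \<Rightarrow> 'b::countable \<Rightarrow> ennreal"
  assumes p: "0 < p" and I: "\<And>\<nu>. finite (I \<nu>)" "\<And>\<nu>. card (I \<nu>) \<le> N"
  shows "Lp_qnorm (count_space UNIV) p (\<lambda>\<nu>. \<Sum>\<mu>\<in>I \<nu>. w \<mu> \<nu>)
     \<le> ennreal (real N) * Lp_qnorm (count_space UNIV) p (\<lambda>\<mu>. Lp_qnorm (count_space UNIV) p (w \<mu>))"
proof (cases "p = \<infinity>")
  case True
  let ?X = "Lp_qnorm (count_space UNIV) p (\<lambda>\<mu>. Lp_qnorm (count_space UNIV) p (w \<mu>))"
  have "(\<Sum>\<mu>\<in>I \<nu>. w \<mu> \<nu>) \<le> ennreal (real N) * ?X" for \<nu>
  proof -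
    have "w \<mu> \<nu> \<le> ?X" for \<mu>
      by (rule order_trans[OF Lp_qnorm_point_le[OF p, of "w \<mu>" \<nu>]
            Lp_qnorm_point_le[OF p, of "\<lambda>\<mu>. Lp_qnorm (count_space UNIV) p (w \<mu>)" \<mu>]])
    then have "(\<Sum>\<mu>\<in>I \<nu>. w \<mu> \<nu>) \<le> of_nat (card (I \<nu>)) * ?X" by (intro sum_bounded_above)
    also have "\<dots> \<le> ennreal (real N) * ?X"
      using I(2)[of \<nu>] by (intro mult_right_mono) (auto simp: ennreal_of_nat_eq_real_of_nat intro!: ennreal_leI)
    finally show ?thesis .
  qed
  then show ?thesis unfolding True by (intro Lp_qnorm_top_le) auto
next
  case False
  define P where "P = enn2real p"
  have P: "0 < P" using enn2real_pos[OF p False] by (simp add: P_def)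
  have "(\<integral>\<^sup>+\<nu>. ennreal_pow (\<Sum>\<mu>\<in>I \<nu>. w \<mu> \<nu>) P \<partial>count_space UNIV)
      \<le> (\<integral>\<^sup>+\<nu>. ennreal (real N powr P) * (\<integral>\<^sup>+\<mu>. ennreal_pow (w \<mu> \<nu>) P \<partial>count_space UNIV) \<partial>count_space UNIV)"
  proof (rule nn_integral_mono)
    fix \<nu>
    have 1: "ennreal_pow (\<Sum>\<mu>\<in>I \<nu>. w \<mu> \<nu>) P \<le> ennreal (real N powr P) * (\<Sum>\<mu>\<in>I \<nu>. ennreal_pow (w \<mu> \<nu>) P)"
      using I P by (intro ennreal_pow_sum_le) auto
    have "(\<Sum>\<mu>\<in>I \<nu>. ennreal_pow (w \<mu> \<nu>) P) = (\<integral>\<^sup>+\<mu>. ennreal_pow (w \<mu> \<nu>) P * indicator (I \<nu>) \<mu> \<partial>count_space UNIV)"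
      using finite_sum_eq_nn_integral[of "\<lambda>\<mu>. \<mu> \<in> I \<nu>"] I(1) by simp
    also have "\<dots> \<le> (\<integral>\<^sup>+\<mu>. ennreal_pow (w \<mu> \<nu>) P \<partial>count_space UNIV)"
      by (intro nn_integral_mono) (auto simp: indicator_def)
    finally have 2: "(\<Sum>\<mu>\<in>I \<nu>. ennreal_pow (w \<mu> \<nu>) P) \<le> (\<integral>\<^sup>+\<mu>. ennreal_pow (w \<mu> \<nu>) P \<partial>count_space UNIV)" .
    show "ennreal_pow (\<Sum>\<mu>\<in>I \<nu>. w \<mu> \<nu>) P \<le> ennreal (real N powr P) * (\<integral>\<^sup>+\<mu>. ennreal_pow (w \<mu> \<nu>) P \<partial>count_space UNIV)"
      by (rule order_trans[OF 1 mult_left_mono[OF 2]]) simp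
  qed
  also have "\<dots> = ennreal (real N powr P) * (\<integral>\<^sup>+\<nu>. (\<integral>\<^sup>+\<mu>. ennreal_pow (w \<mu> \<nu>) P \<partial>count_space UNIV) \<partial>count_space UNIV)"
    by (rule nn_integral_cmult) simp
  also have "(\<integral>\<^sup>+\<nu>. (\<integral>\<^sup>+\<mu>. ennreal_pow (w \<mu> \<nu>) P \<partial>count_space UNIV) \<partial>count_space UNIV)
      = (\<integral>\<^sup>+\<mu>. (\<integral>\<^sup>+\<nu>. ennreal_pow (w \<mu> \<nu>) P \<partial>count_space UNIV) \<partial>count_space UNIV)"
    by (rule nn_integral_count_space_nn_integral) auto
  also have "\<dots> = (\<integral>\<^sup>+\<mu>. ennreal_pow (Lp_qnorm (count_space UNIV) p (w \<mu>)) P \<partial>count_space UNIV)"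
    unfolding P_def Lp_qnorm_pow[OF p False] ..
  also have "\<dots> = ennreal_pow (Lp_qnorm (count_space UNIV) p (\<lambda>\<mu>. Lp_qnorm (count_space UNIV) p (w \<mu>))) P"
    unfolding P_def Lp_qnorm_pow[OF p False] ..
  finally show ?thesis
    unfolding Lp_qnorm_le_iff[OF p False] P_def[symmetric] ennreal_pow_mult by (simp add: ennreal_pow_ennreal)
qed

lemma Lp_qnorm_shift_le:
  fixes y :: "nat \<Rightarrow> ennreal"
  assumes q: "0 < q"
  shows "Lp_qnorm (count_space UNIV) q (\<lambda>L. if i \<le> L then y (L - i) else 0) \<le> Lp_qnorm (count_space UNIV) q y"
proof (cases "q = \<infinity>")
  case True
  show ?thesis unfolding True by (intro Lp_qnorm_top_le AE_I2) (auto intro: Lp_qnorm_point_le)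
next
  case False
  let ?g = "\<lambda>x. ennreal_pow (y x) (enn2real q)"
  have "(\<integral>\<^sup>+L. ennreal_pow (if i \<le> L then y (L - i) else 0) (enn2real q) \<partial>count_space UNIV)
      = (\<integral>\<^sup>+L. ?g (L - i) * indicator {i..} L \<partial>count_space UNIV)"
    by (intro nn_integral_cong) (auto simp: indicator_def)
  also have "\<dots> = (\<integral>\<^sup>+L. ?g (L - i) \<partial>count_space {i..})"
    by (simp add: nn_integral_count_space_indicator)
  also have "\<dots> = (\<integral>\<^sup>+k. ?g k \<partial>count_space UNIV)"
    by (rule nn_integral_bij_count_space, rule bij_betw_byWitness[where f' = "\<lambda>k. k + i"]) auto
  finally show ?thesis unfolding Lp_qnorm_le_iff[OF q False] Lp_qnorm_pow[OF q False] by simp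
qed

definition synth_const :: "nat \<Rightarrow> real \<Rightarrow> ennreal \<Rightarrow> ennreal \<Rightarrow> real \<Rightarrow> real" where
  "synth_const n R p q \<epsilon> = geo_const q \<epsilon> * (geo_const p \<epsilon> * real (cube_count n R))"

text \<open>When the decompositions of the single terms are smoother than the target, the levels
  \<open>L = k + i\<close> gain a factor \<open>2\<^bsup>-i(\<sigma>-s)\<^esup>\<close>. Half of it is spent on summing the contributions in \<open>\<ell>\<^sub>p\<close> and
  half of it on the convolution over the levels in \<open>\<ell>\<^sub>q\<close>.\<close>

lemma bn_synth_smoother:
  fixes u :: "nat \<Rightarrow> int^'n \<Rightarrow> real"
  assumes p: "0 < p" and q: "0 < q" and \<sigma>: "s < \<sigma>" and A: "0 \<le> A"
    and le: "\<And>k \<mu> i. Lp_qnorm (count_space UNIV) p (\<lambda>\<nu>. ennreal (v k \<mu> (k + i) \<nu>))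
       \<le> ennreal (A * 2 powr - (real i * (\<sigma> - real CARD('n) * enn2real (1 / p)))) * ennreal (u k \<mu>)"
    and v0: "\<And>k \<mu> L \<nu>. 0 \<le> v k \<mu> L \<nu>"
  shows "bn s p q (synth R v) \<le> ennreal (synth_const CARD('n) R p q ((\<sigma> - s) / 2) * A) * bn s p q u"
proof -
  define \<epsilon> where "\<epsilon> = (\<sigma> - s) / 2"
  have \<epsilon>: "0 < \<epsilon>" "\<sigma> = s + 2 * \<epsilon>" using \<sigma> by (auto simp: \<epsilon>_def field_simps)
  define e where "e = real CARD('n) * enn2real (1 / p)"
  define N where "N = cube_count CARD('n) R"
  let ?cs = "count_space UNIV"
  \<comment> \<open>the part of level \<open>L\<close> that stems from the terms of level \<open>L - i\<close>\<close>
  define z where "z L i \<nu> = (if i \<le> L then \<Sum>\<mu>\<in>near R (L - i) L \<nu>. ennreal (v (L - i) \<mu> L \<nu>) else 0)" for L i and \<nu> :: "int^'n"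
  define Y where "Y i L = (if i \<le> L then ennreal (2 powr - (real i * \<epsilon>)) * lev s p u (L - i) else 0)" for i L
  have zle: "Lp_qnorm ?cs p (z L i) \<le> ennreal (2 powr - (real i * \<epsilon>))
      * (ennreal (2 powr - (real L * (s - e))) * (ennreal (real N * A) * (\<Sum>i. Y i L)))" for L i
  proof (cases "i \<le> L")
    case False then show ?thesis using p by (simp add: z_def[abs_def])
  next
    case True
    then obtain k where L: "L = k + i" by (metis add.commute le_add_diff_inverse)
    let ?a = "A * 2 powr - (real i * (\<sigma> - e))"
    have a0: "0 \<le> ?a" using A by simp
    have "Lp_qnorm ?cs p (z L i) = Lp_qnorm ?cs p (\<lambda>\<nu>. \<Sum>\<mu>\<in>near R k L \<nu>. ennreal (v k \<mu> L \<nu>))"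
      by (simp add: z_def[abs_def] L)
    also have "\<dots> \<le> ennreal (real N) * Lp_qnorm ?cs p (\<lambda>\<mu>. Lp_qnorm ?cs p (\<lambda>\<nu>. ennreal (v k \<mu> L \<nu>)))"
      unfolding N_def by (rule Lp_near_sum_le[OF p near_finite])
    also have "\<dots> \<le> ennreal (real N) * Lp_qnorm ?cs p (\<lambda>\<mu>. ennreal ?a * ennreal (u k \<mu>))"
      using le[of k _ i] by (intro mult_left_mono Lp_qnorm_count_mono) (auto simp: L e_def)
    also have "\<dots> \<le> ennreal (real N) * (ennreal ?a * Lp_qnorm ?cs p (\<lambda>\<mu>. ennreal (u k \<mu>)))"
      by (intro mult_left_mono Lp_qnorm_cmult p) auto
    also have "Lp_qnorm ?cs p (\<lambda>\<mu>. ennreal (u k \<mu>)) = ennreal (2 powr - (real k * (s - e))) * lev s p u k"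
      by (simp add: lev_def e_def)
    also have "ennreal (real N) * (ennreal ?a * (ennreal (2 powr - (real k * (s - e))) * lev s p u k))
        = ennreal (real N * (?a * 2 powr - (real k * (s - e)))) * lev s p u k"
      using A by (simp add: ennreal_mult mult.assoc)
    also have "real N * (?a * 2 powr - (real k * (s - e)))
        = 2 powr - (real i * \<epsilon>) * (2 powr - (real L * (s - e)) * ((real N * A) * 2 powr - (real i * \<epsilon>)))"
    proof -
      have "2 powr - (real i * (\<sigma> - e)) * 2 powr - (real k * (s - e))
          = 2 powr - (real i * \<epsilon>) * 2 powr - (real L * (s - e)) * (2::real) powr - (real i * \<epsilon>)"
        unfolding powr_add[symmetric] by (rule arg_cong[where f = "\<lambda>z. 2 powr z"]) (simp add: L \<epsilon>(2) algebra_simps)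
      moreover have "n * (A * x * y) = a * (b * (n * A * a))" if "x * y = a * b * a" for n x y a b :: real
        using that by algebra
      ultimately show ?thesis by blast
    qed
    also have "ennreal \<dots> * lev s p u k = ennreal (2 powr - (real i * \<epsilon>))
      * (ennreal (2 powr - (real L * (s - e))) * (ennreal (real N * A) * Y i L))"
      using A by (simp add: Y_def L ennreal_mult mult.assoc)
    also have "\<dots> \<le> ennreal (2 powr - (real i * \<epsilon>))
      * (ennreal (2 powr - (real L * (s - e))) * (ennreal (real N * A) * (\<Sum>i. Y i L)))"
    proof -
      have "Y i L \<le> (\<Sum>i. Y i L)" using sum_le_suminf[of "\<lambda>i. Y i L" "{i}"] by simp
      then show ?thesis by (intro mult_left_mono) auto
    qed
    finally show ?thesis .
  qed
  have lv: "lev s p (synth R v) L \<le> ennreal (geo_const p \<epsilon> * (real N * A)) * (\<Sum>i. Y i L)" for L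
  proof -
    have "ennreal (synth R v L \<nu>) = (\<Sum>i. z L i \<nu>)" for \<nu>
    proof -
      have "(\<Sum>i. z L i \<nu>) = (\<Sum>i\<le>L. z L i \<nu>)" by (rule suminf_finite) (auto simp: z_def)
      also have "\<dots> = (\<Sum>i\<le>L. \<Sum>\<mu>\<in>near R (L - i) L \<nu>. ennreal (v (L - i) \<mu> L \<nu>))" by (simp add: z_def)
      also have "\<dots> = (\<Sum>k\<le>L. \<Sum>\<mu>\<in>near R k L \<nu>. ennreal (v k \<mu> L \<nu>))"
        by (rule sum.reindex_bij_witness[where i = "\<lambda>k. L - k" and j = "\<lambda>k. L - k"]) auto
      also have "\<dots> = ennreal (synth R v L \<nu>)"
        unfolding synth_def using v0 by (simp add: sum_ennreal sum_nonneg)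
      finally show ?thesis by simp
    qed
    then have "lev s p (synth R v) L = ennreal (2 powr (real L * (s - e))) * Lp_qnorm ?cs p (\<lambda>\<nu>. \<Sum>i. z L i \<nu>)"
      by (simp add: lev_def e_def)
    also have "\<dots> \<le> ennreal (2 powr (real L * (s - e))) * (ennreal (geo_const p \<epsilon>) *
        (ennreal (2 powr - (real L * (s - e))) * (ennreal (real N * A) * (\<Sum>i. Y i L))))"
      by (intro mult_left_mono Lp_qnorm_suminf_le[OF p \<epsilon>(1)] zle) auto
    also have "\<dots> = ennreal (geo_const p \<epsilon> * (real N * A)) * (\<Sum>i. Y i L)"
      using A geo_const_pos[OF p \<epsilon>(1)] by (simp add: mult.left_commute[of "ennreal (geo_const p \<epsilon>)"] ennreal_mult mult.assoc)
    finally show ?thesis .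
  qed
  have "bn s p q (synth R v) \<le> Lp_qnorm ?cs q (\<lambda>L. ennreal (geo_const p \<epsilon> * (real N * A)) * (\<Sum>i. Y i L))"
    unfolding bn_def by (intro Lp_qnorm_count_mono lv)
  also have "\<dots> \<le> ennreal (geo_const p \<epsilon> * (real N * A)) * Lp_qnorm ?cs q (\<lambda>L. \<Sum>i. Y i L)"
    by (intro Lp_qnorm_cmult q) auto
  also have "\<dots> \<le> ennreal (geo_const p \<epsilon> * (real N * A)) * (ennreal (geo_const q \<epsilon>) * bn s p q u)"
  proof (intro mult_left_mono Lp_qnorm_suminf_le[OF q \<epsilon>(1)])
    fix i
    have "Lp_qnorm ?cs q (Y i) = Lp_qnorm ?cs q (\<lambda>L. ennreal (2 powr - (real i * \<epsilon>)) * (if i \<le> L then lev s p u (L - i) else 0))"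
      by (simp add: Y_def[abs_def] if_distrib cong: if_cong)
    also have "\<dots> \<le> ennreal (2 powr - (real i * \<epsilon>)) * Lp_qnorm ?cs q (\<lambda>L. if i \<le> L then lev s p u (L - i) else 0)"
      by (intro Lp_qnorm_cmult q) auto
    also have "\<dots> \<le> ennreal (2 powr - (real i * \<epsilon>)) * bn s p q u"
      unfolding bn_def by (intro mult_left_mono Lp_qnorm_shift_le q) auto
    finally show "Lp_qnorm ?cs q (Y i) \<le> ennreal (2 powr - (real i * \<epsilon>)) * bn s p q u" .
  qed auto
  also have "\<dots> = ennreal (synth_const CARD('n) R p q ((\<sigma> - s) / 2) * A) * bn s p q u"
    unfolding synth_const_def \<epsilon>_def[symmetric] N_def[symmetric]
    using A geo_const_pos[OF p \<epsilon>(1)] geo_const_pos[OF q \<epsilon>(1)] by (simp add: ennreal_mult mult_ac)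
  finally show ?thesis .
qed

lemma powr_subadditive: "0 < a \<Longrightarrow> a \<le> 1 \<Longrightarrow> 0 \<le> x \<Longrightarrow> 0 \<le> y \<Longrightarrow> (x + y) powr a \<le> x powr a + y powr (a::real)"
proof (cases "x + y = 0")
  case False
  assume a: "0 < a" "a \<le> 1" and xy: "0 \<le> x" "0 \<le> y"
  have S: "0 < x + y" using False xy by simp
  have le: "t \<le> t powr a" if "0 \<le> t" "t \<le> 1" for t :: real
    using powr_mono'[of a 1 t] a that by (cases "t = 0") auto
  have "1 = x / (x + y) + y / (x + y)" using S by (simp add: add_divide_distrib[symmetric])
  also have "\<dots> \<le> (x / (x + y)) powr a + (y / (x + y)) powr a"
    using S xy by (intro add_mono le) auto
  also have "\<dots> = (x powr a + y powr a) / (x + y) powr a"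
    using S xy by (simp add: powr_divide add_divide_distrib)
  finally show ?thesis using S by (simp add: le_divide_eq)
qed auto

lemma ennreal_pow_sum_subadditive:
  assumes "0 < a" "a \<le> 1" "finite I"
  shows "ennreal_pow (\<Sum>i\<in>I. x i) a \<le> (\<Sum>i\<in>I. ennreal_pow (x i) a)"
  using assms(3)
proof (induction rule: finite_induct)
  case (insert i I)
  have two: "ennreal_pow (y + z) a \<le> ennreal_pow y a + ennreal_pow z a" for y z
  proof (cases "y = top \<or> z = top")
    case False
    then obtain r t where "y = ennreal r" "z = ennreal t" "0 \<le> r" "0 \<le> t" by (metis ennreal_cases)
    then show ?thesis using powr_subadditive[OF assms(1,2), of r t]
      by (simp add: ennreal_plus[symmetric] ennreal_pow_ennreal ennreal_leI del: ennreal_plus)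
  qed auto
  show ?case using insert two[of "x i" "\<Sum>i\<in>I. x i"] by (auto intro: order_trans add_left_mono)
qed simp

lemma bn_pow:
  fixes u :: "nat \<Rightarrow> int^'n \<Rightarrow> real"
  assumes "0 < p" "p \<noteq> \<infinity>"
  shows "ennreal_pow (bn s p p u) (enn2real p) = (\<integral>\<^sup>+j. (\<integral>\<^sup>+m. ennreal_pow (ennreal (2 powr
    (real j * (s - real CARD('n) * enn2real (1 / p))))) (enn2real p) * ennreal_pow (ennreal (u j m)) (enn2real p) \<partial>count_space UNIV) \<partial>count_space UNIV)"
  unfolding bn_def Lp_qnorm_pow[OF assms] lev_def ennreal_pow_mult
  by (intro nn_integral_cong nn_integral_cmult[symmetric]) auto

text \<open>For \<open>p \<le> 1\<close> no smoothness has to be given away: the \<open>p\<close>-th power of a sum is at most the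
  sum of the \<open>p\<close>-th powers, so that the \<open>p\<close>-th powers of all quasi-norms just add up.\<close>

lemma bn_synth_p_le_1:
  fixes u :: "nat \<Rightarrow> int^'n \<Rightarrow> real"
  assumes p: "0 < p" "p \<le> 1"
    and le: "\<And>k \<mu>. bn s p p (\<lambda>i. v k \<mu> (k + i)) \<le> ennreal A * ennreal (u k \<mu>)"
    and v0: "\<And>k \<mu> L \<nu>. 0 \<le> v k \<mu> L \<nu>"
  shows "bn s p p (synth R v) \<le> ennreal A * bn s p p u"
proof -
  have pf: "p \<noteq> \<infinity>" using p(2) by (auto simp: top_unique)
  define P where "P = enn2real p"
  have P: "0 < P" using enn2real_pos[OF p(1) pf] by (simp add: P_def)
  have P1: "P \<le> 1" using enn2real_mono[of p 1] p(2) by (simp add: P_def)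
  let ?cs = "count_space UNIV"
  define t where "t = s - real CARD('n) * enn2real (1 / p)"
  define W where "W j = ennreal_pow (ennreal (2 powr (real j * t))) P" for j
  have W: "W (k + i) = W k * W i" for k i
    unfolding W_def ennreal_pow_mult[symmetric] by (simp add: ennreal_mult[symmetric] powr_add[symmetric] distrib_right)
  define V where "V k \<mu> L \<nu> = ennreal_pow (ennreal (v k \<mu> L \<nu>)) P" for k \<mu> L \<nu>
  have pw: "ennreal_pow (ennreal (synth R v L \<nu>)) P \<le> (\<integral>\<^sup>+k. (\<integral>\<^sup>+\<mu>. V k \<mu> L \<nu> \<partial>?cs) * indicator {..L} k \<partial>?cs)" for L \<nu>
  proof -
    have "ennreal_pow (ennreal (synth R v L \<nu>)) P = ennreal_pow (\<Sum>k\<le>L. ennreal (\<Sum>\<mu>\<in>near R k L \<nu>. v k \<mu> L \<nu>)) P"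
      unfolding synth_def using v0 by (simp add: sum_nonneg)
    also have "\<dots> \<le> (\<Sum>k\<le>L. ennreal_pow (ennreal (\<Sum>\<mu>\<in>near R k L \<nu>. v k \<mu> L \<nu>)) P)"
      by (intro ennreal_pow_sum_subadditive P P1) auto
    also have "\<dots> \<le> (\<Sum>k\<le>L. \<integral>\<^sup>+\<mu>. V k \<mu> L \<nu> \<partial>?cs)"
    proof (rule sum_mono)
      fix k
      have "ennreal_pow (ennreal (\<Sum>\<mu>\<in>near R k L \<nu>. v k \<mu> L \<nu>)) P = ennreal_pow (\<Sum>\<mu>\<in>near R k L \<nu>. ennreal (v k \<mu> L \<nu>)) P"
        using v0 by simp
      also have "\<dots> \<le> (\<Sum>\<mu>\<in>near R k L \<nu>. V k \<mu> L \<nu>)"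
        unfolding V_def by (intro ennreal_pow_sum_subadditive P P1 near_finite)
      also have "\<dots> = (\<integral>\<^sup>+\<mu>. V k \<mu> L \<nu> * indicator (near R k L \<nu>) \<mu> \<partial>?cs)"
        using finite_sum_eq_nn_integral[of "\<lambda>\<mu>. \<mu> \<in> near R k L \<nu>" "\<lambda>\<mu>. V k \<mu> L \<nu>"] near_finite(1)[of R k L \<nu>] by simp
      also have "\<dots> \<le> (\<integral>\<^sup>+\<mu>. V k \<mu> L \<nu> \<partial>?cs)" by (intro nn_integral_mono) (auto simp: indicator_def)
      finally show "ennreal_pow (ennreal (\<Sum>\<mu>\<in>near R k L \<nu>. v k \<mu> L \<nu>)) P \<le> (\<integral>\<^sup>+\<mu>. V k \<mu> L \<nu> \<partial>?cs)" .
    qed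
    also have "\<dots> = (\<integral>\<^sup>+k. (\<integral>\<^sup>+\<mu>. V k \<mu> L \<nu> \<partial>?cs) * indicator {..L} k \<partial>?cs)"
      using finite_sum_eq_nn_integral[of "\<lambda>k. k \<le> L"] by (simp add: atMost_def)
    finally show ?thesis .
  qed
  have "ennreal_pow (bn s p p (synth R v)) P
      = (\<integral>\<^sup>+L. (\<integral>\<^sup>+\<nu>. W L * ennreal_pow (ennreal (synth R v L \<nu>)) P \<partial>?cs) \<partial>?cs)"
    unfolding P_def bn_pow[OF p(1) pf] W_def t_def ..
  also have "\<dots> \<le> (\<integral>\<^sup>+L. (\<integral>\<^sup>+\<nu>. W L * (\<integral>\<^sup>+k. (\<integral>\<^sup>+\<mu>. V k \<mu> L \<nu> \<partial>?cs) * indicator {..L} k \<partial>?cs) \<partial>?cs) \<partial>?cs)"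
    by (intro nn_integral_mono mult_left_mono pw) auto
  also have "\<dots> = (\<integral>\<^sup>+L. (\<integral>\<^sup>+\<nu>. (\<integral>\<^sup>+k. (\<integral>\<^sup>+\<mu>. W L * V k \<mu> L \<nu> * indicator {..L} k \<partial>?cs) \<partial>?cs) \<partial>?cs) \<partial>?cs)"
    by (simp add: nn_integral_cmult nn_integral_multc mult.assoc)
  also have "\<dots> = (\<integral>\<^sup>+L. (\<integral>\<^sup>+k. (\<integral>\<^sup>+\<nu>. (\<integral>\<^sup>+\<mu>. W L * V k \<mu> L \<nu> * indicator {..L} k \<partial>?cs) \<partial>?cs) \<partial>?cs) \<partial>?cs)"
    by (intro nn_integral_cong nn_integral_count_space_nn_integral) auto
  also have "\<dots> = (\<integral>\<^sup>+k. (\<integral>\<^sup>+L. (\<integral>\<^sup>+\<nu>. (\<integral>\<^sup>+\<mu>. W L * V k \<mu> L \<nu> * indicator {..L} k \<partial>?cs) \<partial>?cs) \<partial>?cs) \<partial>?cs)"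
    by (intro nn_integral_count_space_nn_integral) auto
  also have "\<dots> = (\<integral>\<^sup>+k. (\<integral>\<^sup>+L. (\<integral>\<^sup>+\<mu>. (\<integral>\<^sup>+\<nu>. W L * V k \<mu> L \<nu> * indicator {..L} k \<partial>?cs) \<partial>?cs) \<partial>?cs) \<partial>?cs)"
    by (intro nn_integral_cong nn_integral_count_space_nn_integral) auto
  also have "\<dots> = (\<integral>\<^sup>+k. (\<integral>\<^sup>+\<mu>. (\<integral>\<^sup>+L. (\<integral>\<^sup>+\<nu>. W L * V k \<mu> L \<nu> * indicator {..L} k \<partial>?cs) \<partial>?cs) \<partial>?cs) \<partial>?cs)"
    by (intro nn_integral_cong nn_integral_count_space_nn_integral) auto
  also have "\<dots> = (\<integral>\<^sup>+k. (\<integral>\<^sup>+\<mu>. W k * ennreal_pow (bn s p p (\<lambda>i. v k \<mu> (k + i))) P \<partial>?cs) \<partial>?cs)"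
  proof (intro nn_integral_cong)
    fix k \<mu>
    have "(\<integral>\<^sup>+L. (\<integral>\<^sup>+\<nu>. W L * V k \<mu> L \<nu> * indicator {..L} k \<partial>?cs) \<partial>?cs)
        = (\<integral>\<^sup>+L. (\<integral>\<^sup>+\<nu>. W L * V k \<mu> L \<nu> \<partial>?cs) * indicator {k..} L \<partial>?cs)"
      by (intro nn_integral_cong) (auto simp: indicator_def)
    also have "\<dots> = (\<integral>\<^sup>+L. (\<integral>\<^sup>+\<nu>. W L * V k \<mu> L \<nu> \<partial>?cs) \<partial>count_space {k..})"
      by (simp add: nn_integral_count_space_indicator)
    also have "\<dots> = (\<integral>\<^sup>+i. (\<integral>\<^sup>+\<nu>. W (k + i) * V k \<mu> (k + i) \<nu> \<partial>?cs) \<partial>?cs)"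
      by (rule nn_integral_bij_count_space[symmetric], rule bij_betw_byWitness[where f' = "\<lambda>L. L - k"]) auto
    also have "\<dots> = (\<integral>\<^sup>+i. W k * (\<integral>\<^sup>+\<nu>. W i * V k \<mu> (k + i) \<nu> \<partial>?cs) \<partial>?cs)"
      unfolding W mult.assoc by (intro nn_integral_cong nn_integral_cmult) auto
    also have "\<dots> = W k * (\<integral>\<^sup>+i. (\<integral>\<^sup>+\<nu>. W i * V k \<mu> (k + i) \<nu> \<partial>?cs) \<partial>?cs)"
      by (intro nn_integral_cmult) auto
    also have "(\<integral>\<^sup>+i. (\<integral>\<^sup>+\<nu>. W i * V k \<mu> (k + i) \<nu> \<partial>?cs) \<partial>?cs) = ennreal_pow (bn s p p (\<lambda>i. v k \<mu> (k + i))) P"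
      unfolding P_def bn_pow[OF p(1) pf] W_def V_def t_def ..
    finally show "(\<integral>\<^sup>+L. (\<integral>\<^sup>+\<nu>. W L * V k \<mu> L \<nu> * indicator {..L} k \<partial>?cs) \<partial>?cs)
        = W k * ennreal_pow (bn s p p (\<lambda>i. v k \<mu> (k + i))) P" .
  qed
  also have "\<dots> \<le> (\<integral>\<^sup>+k. (\<integral>\<^sup>+\<mu>. W k * ennreal_pow (ennreal A * ennreal (u k \<mu>)) P \<partial>?cs) \<partial>?cs)"
    using P by (intro nn_integral_mono mult_left_mono ennreal_pow_mono le) auto
  also have "\<dots> = (\<integral>\<^sup>+k. (\<integral>\<^sup>+\<mu>. ennreal_pow (ennreal A) P * (W k * ennreal_pow (ennreal (u k \<mu>)) P) \<partial>?cs) \<partial>?cs)"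
    unfolding ennreal_pow_mult by (simp only: mult.left_commute)
  also have "\<dots> = ennreal_pow (ennreal A) P * (\<integral>\<^sup>+k. (\<integral>\<^sup>+\<mu>. W k * ennreal_pow (ennreal (u k \<mu>)) P \<partial>?cs) \<partial>?cs)"
    by (simp add: nn_integral_cmult)
  also have "(\<integral>\<^sup>+k. (\<integral>\<^sup>+\<mu>. W k * ennreal_pow (ennreal (u k \<mu>)) P \<partial>?cs) \<partial>?cs) = ennreal_pow (bn s p p u) P"
    unfolding P_def bn_pow[OF p(1) pf] W_def t_def ..
  finally have "ennreal_pow (bn s p p (synth R v)) P \<le> ennreal_pow (ennreal A * bn s p p u) P"
    unfolding ennreal_pow_mult .
  then show ?thesis using P by (subst (asm) ennreal_pow_le_iff) (auto simp: ennreal_pow_pow)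
qed

subsection \<open>Algebra of the sequence quasi-norms\<close>

lemma lev_mono: "(\<And>m. u j m \<le> v j m) \<Longrightarrow> lev s p u j \<le> lev s p v j"
  unfolding lev_def by (intro mult_left_mono Lp_qnorm_count_mono ennreal_leI) auto

lemma bn_mono: "(\<And>j m. u j m \<le> v j m) \<Longrightarrow> bn s p q u \<le> bn s p q v"
  unfolding bn_def by (intro Lp_qnorm_count_mono lev_mono)

lemma bn_cmult_le:
  assumes "0 < p" "0 < q" "0 \<le> c"
  shows "bn s p q (\<lambda>j m. c * u j m) \<le> ennreal c * bn s p q u"
proof -
  have "lev s p (\<lambda>j m. c * u j m) j \<le> ennreal c * lev s p u j" for j
    unfolding lev_def ennreal_mult'[OF assms(3)] mult.left_commute[of "ennreal c"]
    by (intro mult_left_mono Lp_qnorm_cmult assms) auto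
  then have "bn s p q (\<lambda>j m. c * u j m) \<le> Lp_qnorm (count_space UNIV) q (\<lambda>j. ennreal c * lev s p u j)"
    unfolding bn_def by (intro Lp_qnorm_count_mono)
  also have "\<dots> \<le> ennreal c * bn s p q u" unfolding bn_def by (intro Lp_qnorm_cmult assms) auto
  finally show ?thesis .
qed

lemma bn_sum_le:
  fixes w :: "'i \<Rightarrow> nat \<Rightarrow> int^'n \<Rightarrow> real"
  assumes p: "0 < p" and q: "0 < q" and I: "finite I" "card I \<le> N"
    and w0: "\<And>i j m. i \<in> I \<Longrightarrow> 0 \<le> w i j m" and le: "\<And>i. i \<in> I \<Longrightarrow> bn s p q (w i) \<le> B"
  shows "bn s p q (\<lambda>j m. \<Sum>i\<in>I. w i j m) \<le> ennreal (sum_const p N * sum_const q N) * B"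
proof -
  let ?cs = "count_space UNIV"
  have "lev s p (\<lambda>j m. \<Sum>i\<in>I. w i j m) j \<le> ennreal (sum_const p N) * (\<Sum>i\<in>I. lev s p (w i) j)" for j
  proof -
    define c where "c = ennreal (2 powr (real j * (s - real CARD('n) * enn2real (1 / p))))"
    have "Lp_qnorm ?cs p (\<lambda>m. \<Sum>i\<in>I. c * ennreal (w i j m)) \<le> ennreal (sum_const p N) * (\<Sum>i\<in>I. lev s p (w i) j)"
    proof (rule Lp_qnorm_sum_le[OF p I])
      fix i assume i: "i \<in> I"
      have "Lp_qnorm ?cs p (\<lambda>m. c * ennreal (w i j m)) \<le> lev s p (w i) j"
        unfolding lev_def c_def by (rule Lp_qnorm_cmult[OF _ p]) simp
      also have "\<dots> \<le> (\<Sum>i\<in>I. lev s p (w i) j)" using i I by (intro member_le_sum) auto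
      finally show "Lp_qnorm ?cs p (\<lambda>m. c * ennreal (w i j m)) \<le> (\<Sum>i\<in>I. lev s p (w i) j)" .
    qed auto
    then have "Lp_qnorm ?cs p (\<lambda>m. c * (\<Sum>i\<in>I. ennreal (w i j m))) \<le> ennreal (sum_const p N) * (\<Sum>i\<in>I. lev s p (w i) j)"
      by (simp add: sum_distrib_left)
    moreover have "c * Lp_qnorm ?cs p (\<lambda>m. \<Sum>i\<in>I. ennreal (w i j m)) \<le> Lp_qnorm ?cs p (\<lambda>m. c * (\<Sum>i\<in>I. ennreal (w i j m)))"
    proof -
      define c' where "c' = ennreal (2 powr - (real j * (s - real CARD('n) * enn2real (1 / p))))"
      have cc: "c' * (c * z) = z" "c * (c' * z) = z" for z by (simp_all add: c_def c'_def)
      have "Lp_qnorm ?cs p (\<lambda>m. c' * (c * (\<Sum>i\<in>I. ennreal (w i j m)))) \<le> c' * Lp_qnorm ?cs p (\<lambda>m. c * (\<Sum>i\<in>I. ennreal (w i j m)))"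
        by (rule Lp_qnorm_cmult[OF _ p]) simp
      from mult_left_mono[OF this[unfolded cc], of c] show ?thesis unfolding cc by simp
    qed
    moreover have "lev s p (\<lambda>j m. \<Sum>i\<in>I. w i j m) j = c * Lp_qnorm ?cs p (\<lambda>m. \<Sum>i\<in>I. ennreal (w i j m))"
      unfolding lev_def c_def using w0 by (simp add: sum_ennreal)
    ultimately show ?thesis by (simp only:)
  qed
  then have "bn s p q (\<lambda>j m. \<Sum>i\<in>I. w i j m) \<le> Lp_qnorm ?cs q (\<lambda>j. ennreal (sum_const p N) * (\<Sum>i\<in>I. lev s p (w i) j))"
    unfolding bn_def by (intro Lp_qnorm_count_mono)
  also have "\<dots> \<le> ennreal (sum_const p N) * Lp_qnorm ?cs q (\<lambda>j. \<Sum>i\<in>I. lev s p (w i) j)"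
    by (intro Lp_qnorm_cmult q) auto
  also have "\<dots> \<le> ennreal (sum_const p N) * (ennreal (sum_const q N) * B)"
    by (intro mult_left_mono Lp_qnorm_sum_le[OF q I]) (use le in \<open>auto simp: bn_def\<close>)
  also have "\<dots> = ennreal (sum_const p N * sum_const q N) * B"
    using sum_const_pos[OF p, of N] sum_const_pos[OF q, of N] by (simp add: ennreal_mult mult.assoc)
  finally show ?thesis .
qed

lemma has_sum_finite_sum:
  fixes f :: "'i \<Rightarrow> 'a \<Rightarrow> 'b::real_normed_vector"
  assumes "finite I" "\<And>i. i \<in> I \<Longrightarrow> (f i has_sum s i) A"
  shows "((\<lambda>a. \<Sum>i\<in>I. f i a) has_sum (\<Sum>i\<in>I. s i)) A"
  using assms by (induction rule: finite_induct) (auto intro!: has_sum_add)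

section \<open>Multiplication by self-similar functions\<close>

definition mult_const :: "nat \<Rightarrow> real \<Rightarrow> nat \<Rightarrow> ennreal \<Rightarrow> ennreal \<Rightarrow> real" where
  "mult_const n d K p q = (let N = cube_count n (d + sqrt (real n)) in sum_const p N * sum_const q N * 2 ^ K)"

text \<open>At the scale of the \<open>(k, \<mu>)\<close>-th term of \<open>f\<close> the function \<open>m\<close> is, by self-similarity, a
  finite sum of decomposed functions \<open>\<psi>(2\<^sup>k\<cdot> - l) m\<close> with \<open>l\<close> near \<open>\<mu>\<close>. Multiplying their pieces with
  the piece of \<open>f\<close>, which is smooth on this scale, decomposes \<open>m f\<close> term by term.\<close>

lemma mult_term_decompositions:
  fixes \<psi> :: "real^'n \<Rightarrow> real" and m f :: "real^'n \<Rightarrow> complex"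
  assumes \<psi>: "resolution_fun \<psi>" and p: "0 < p" and q: "0 < q" and r: "0 < r" and d: "0 < d" and s: "0 < s" and A: "0 \<le> A"
    and m: "\<And>k l. \<exists>w. decomp d K1 (\<lambda>x. of_real (\<psi> (x - lattice_vec l)) * m ((1 / 2 ^ k) *\<^sub>R x)) w \<and> bn \<sigma> p r w \<le> ennreal A"
    and f: "decomp d K2 f u"
  shows "\<exists>v. (\<forall>k \<mu> L \<nu>. 0 \<le> v k \<mu> L \<nu>) \<and>
    (\<forall>k \<mu>. bn \<sigma> p r (\<lambda>i. v k \<mu> (k + i)) \<le> ennreal (mult_const CARD('n) d (min K1 K2) p r * A) * ennreal (u k \<mu>)) \<and>
    (bn s p q (synth (2 * d) v) < \<infinity> \<longrightarrow> decomp d (min K1 K2) (\<lambda>x. m x * f x) (synth (2 * d) v))"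
proof -
  let ?K = "min K1 K2" and ?rn = "sqrt (real CARD('n))"
  define M where "M k l x = complex_of_real (\<psi> (x - lattice_vec l)) * m ((1 / 2 ^ k) *\<^sub>R x)" for k :: nat and l x
  have "\<exists>w. decomp d K1 (M k l) w \<and> bn \<sigma> p r w \<le> ennreal A" for k l
    unfolding M_def[abs_def] by (rule m)
  then obtain w where w: "\<And>k l. decomp d K1 (M k l) (w k l)" "\<And>k l. bn \<sigma> p r (w k l) \<le> ennreal A" by metis
  obtain G where G: "\<And>k l i \<nu>. piece d K1 i \<nu> (w k l i \<nu>) (G k l i \<nu>)"
    and GS: "\<And>k l. AE x in lebesgue. ((\<lambda>(i, \<nu>). G k l i \<nu> x) has_sum M k l x) UNIV"
  proof -
    define Q where "Q k l G \<longleftrightarrow> (\<forall>i \<nu>. piece d K1 i \<nu> (w k l i \<nu>) (G i \<nu>)) \<and>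
      (AE x in lebesgue. ((\<lambda>(i, \<nu>). G i \<nu> x) has_sum M k l x) UNIV)" for k l G
    have "\<exists>G. Q k l G" for k l using w(1)[of k l] unfolding decomp_def Q_def .
    then have Q: "Q k l (SOME G. Q k l G)" for k l by (rule someI_ex)
    show ?thesis using that[of "\<lambda>k l. SOME G. Q k l G"] Q unfolding Q_def by blast
  qed
  obtain g where g: "\<And>k \<mu>. piece d K2 k \<mu> (u k \<mu>) (g k \<mu>)"
    and gS: "AE x in lebesgue. ((\<lambda>(k, \<mu>). g k \<mu> x) has_sum f x) UNIV"
    using f unfolding decomp_def by blast
  have w0: "0 \<le> w k l i \<nu>" for k l i \<nu> using piece_nonneg[OF G] .
  have u0: "0 \<le> u k \<mu>" for k \<mu> using piece_nonneg[OF g] .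
  define Nl where "Nl \<mu> = {l::int^'n. \<forall>i. \<bar>real_of_int (\<mu> $ i) - of_int (l $ i)\<bar> \<le> d + ?rn}" for \<mu> :: "int^'n"
  have Nl: "finite (Nl \<mu>)" "card (Nl \<mu>) \<le> cube_count CARD('n) (d + ?rn)" for \<mu>
    unfolding Nl_def by (rule near_lattice_points)+
  let ?near = "\<lambda>k \<mu> L \<nu>. k \<le> L \<and> \<mu> \<in> near (2 * d) k L \<nu>"
  define v where "v k \<mu> L \<nu> = (if ?near k \<mu> L \<nu> then \<Sum>l\<in>Nl \<mu>. 2 ^ ?K * (u k \<mu> * w k l (L - k) \<nu>) else 0)" for k \<mu> L \<nu>
  define h where "h k \<mu> L \<nu> x = (if ?near k \<mu> L \<nu> then \<Sum>l\<in>Nl \<mu>. g k \<mu> x * G k l (L - k) \<nu> (2 ^ k *\<^sub>R x) else 0)" for k \<mu> L \<nu> x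
  have v0: "0 \<le> v k \<mu> L \<nu>" for k \<mu> L \<nu> unfolding v_def using w0 u0 by (auto intro!: sum_nonneg)
  have h: "piece d ?K L \<nu> (v k \<mu> L \<nu>) (h k \<mu> L \<nu>)" for k \<mu> L \<nu>
  proof (cases "?near k \<mu> L \<nu>")
    case True
    have "piece d ?K L \<nu> (2 ^ ?K * (u k \<mu> * w k l (L - k) \<nu>)) (\<lambda>x. g k \<mu> x * G k l (L - k) \<nu> (2 ^ k *\<^sub>R x))" for l
    proof (rule piece_mult)
      show "Cbd ?K (u k \<mu>) (2 ^ k) (g k \<mu>)" using piece_le[OF g, of ?K k \<mu>] by (auto simp: piece_def)
      have "piece d K1 (L - k + k) \<nu> (w k l (L - k) \<nu>) (\<lambda>x. G k l (L - k) \<nu> (2 ^ k *\<^sub>R x + lattice_vec 0))"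
        using piece_dilate[OF G[of "L - k" \<nu> k l], of k 0] by (simp add: vec_eq_iff)
      then show "piece d ?K L \<nu> (w k l (L - k) \<nu>) (\<lambda>x. G k l (L - k) \<nu> (2 ^ k *\<^sub>R x))"
        using True piece_le[of d K1 L \<nu> _ _ ?K] by (simp add: lattice_vec_def zero_vec_def[symmetric])
    qed (use True in auto)
    then show ?thesis unfolding v_def h_def[abs_def] using True Nl(1) by (simp add: piece_sum)
  next
    case False
    have "h k \<mu> L \<nu> = (\<lambda>x. 0)" "v k \<mu> L \<nu> = 0" using False by (auto simp: v_def h_def fun_eq_iff)
    then show ?thesis by (simp add: piece_zero)
  qed
  have bnv: "bn \<sigma> p r (\<lambda>i. v k \<mu> (k + i)) \<le> ennreal (mult_const CARD('n) d ?K p r * A) * ennreal (u k \<mu>)" for k \<mu>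
  proof -
    have "bn \<sigma> p r (\<lambda>i. v k \<mu> (k + i)) \<le> bn \<sigma> p r (\<lambda>i \<nu>. \<Sum>l\<in>Nl \<mu>. 2 ^ ?K * u k \<mu> * w k l i \<nu>)"
      by (rule bn_mono) (use w0 u0 in \<open>auto simp: v_def mult.assoc intro!: sum_nonneg\<close>)
    also have "\<dots> \<le> ennreal (sum_const p (cube_count CARD('n) (d + ?rn)) * sum_const r (cube_count CARD('n) (d + ?rn)))
        * (ennreal (2 ^ ?K * u k \<mu>) * ennreal A)"
    proof (rule bn_sum_le[OF p r Nl])
      fix l
      have "bn \<sigma> p r (\<lambda>i \<nu>. 2 ^ ?K * u k \<mu> * w k l i \<nu>) \<le> ennreal (2 ^ ?K * u k \<mu>) * bn \<sigma> p r (w k l)"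
        using u0 by (intro bn_cmult_le p r) auto
      also have "\<dots> \<le> ennreal (2 ^ ?K * u k \<mu>) * ennreal A" by (intro mult_left_mono w(2)) auto
      finally show "bn \<sigma> p r (\<lambda>i \<nu>. 2 ^ ?K * u k \<mu> * w k l i \<nu>) \<le> ennreal (2 ^ ?K * u k \<mu>) * ennreal A" .
    qed (use w0 u0 in auto)
    also have "\<dots> = ennreal (mult_const CARD('n) d ?K p r * A) * ennreal (u k \<mu>)"
      using A u0[of k \<mu>] sum_const_pos[OF p, THEN less_imp_le] sum_const_pos[OF r, THEN less_imp_le]
      by (simp add: mult_const_def Let_def ennreal_mult[symmetric] mult_ac)
    finally show ?thesis .
  qed
  have F: "AE x in lebesgue. \<forall>k \<mu>. ((\<lambda>(L, \<nu>). h k \<mu> L \<nu> x) has_sum m x * g k \<mu> x) UNIV"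
  proof -
    have "AE x in lebesgue. ((\<lambda>(i, \<nu>). G k l i \<nu> (2 ^ k *\<^sub>R x + 0)) has_sum M k l (2 ^ k *\<^sub>R x + 0)) UNIV" for k l
      by (rule AE_affine[OF GS]) simp
    then have "AE x in lebesgue. \<forall>k l. ((\<lambda>(i, \<nu>). G k l i \<nu> (2 ^ k *\<^sub>R x)) has_sum M k l (2 ^ k *\<^sub>R x)) UNIV"
      by (simp add: AE_all_countable)
    then show ?thesis
    proof (eventually_elim, intro allI)
      fix x k \<mu>
      assume S: "\<forall>k l. ((\<lambda>(i, \<nu>). G k l i \<nu> (2 ^ k *\<^sub>R x)) has_sum M k l (2 ^ k *\<^sub>R x)) UNIV"
      let ?P = "\<lambda>(i, \<nu>). \<Sum>l\<in>Nl \<mu>. g k \<mu> x * G k l i \<nu> (2 ^ k *\<^sub>R x)"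
      have "((\<lambda>a. \<Sum>l\<in>Nl \<mu>. g k \<mu> x * (case a of (i, \<nu>) \<Rightarrow> G k l i \<nu> (2 ^ k *\<^sub>R x)))
          has_sum (\<Sum>l\<in>Nl \<mu>. g k \<mu> x * M k l (2 ^ k *\<^sub>R x))) UNIV"
        by (intro has_sum_finite_sum Nl has_sum_cmult_right S[rule_format])
      then have P: "(?P has_sum (\<Sum>l\<in>Nl \<mu>. g k \<mu> x * M k l (2 ^ k *\<^sub>R x))) UNIV"
        by (simp add: case_prod_unfold)
      have "(\<Sum>l\<in>Nl \<mu>. g k \<mu> x * M k l (2 ^ k *\<^sub>R x)) = m x * g k \<mu> x"
      proof (cases "g k \<mu> x = 0")
        case False
        then have x: "x \<in> dil_cube d k \<mu>" using g[of k \<mu>] by (auto simp: piece_def)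
        have out: "\<psi> (2 ^ k *\<^sub>R x - lattice_vec l) = 0" if "l \<notin> Nl \<mu>" for l
        proof (rule ccontr)
          assume nz: "\<psi> (2 ^ k *\<^sub>R x - lattice_vec l) \<noteq> 0"
          have "\<bar>real_of_int (\<mu> $ i) - of_int (l $ i)\<bar> \<le> d + ?rn" for i
          proof -
            have "\<bar>2 ^ k * x $ i - of_int (\<mu> $ i)\<bar> \<le> d" using x by (simp add: mem_dil_cube)
            moreover have "\<bar>2 ^ k * x $ i - of_int (l $ i)\<bar> \<le> ?rn"
              using resolution_fun_supp[OF \<psi> nz, of i] by (simp add: lattice_vec_def)
            ultimately show ?thesis by linarith
          qed
          then show False using that by (simp add: Nl_def)
        qed
        have "((\<lambda>l. \<psi> (2 ^ k *\<^sub>R x - lattice_vec l)) has_sum (\<Sum>l\<in>Nl \<mu>. \<psi> (2 ^ k *\<^sub>R x - lattice_vec l))) UNIV"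
          by (rule has_sum_finite_neutralI[OF Nl(1)]) (use out in auto)
        moreover have "((\<lambda>l. \<psi> (2 ^ k *\<^sub>R x - lattice_vec l)) has_sum 1) UNIV"
          using \<psi> by (simp add: resolution_fun_def)
        ultimately have one: "(\<Sum>l\<in>Nl \<mu>. \<psi> (2 ^ k *\<^sub>R x - lattice_vec l)) = 1" by (rule has_sum_unique)
        have "(\<Sum>l\<in>Nl \<mu>. g k \<mu> x * M k l (2 ^ k *\<^sub>R x))
            = (\<Sum>l\<in>Nl \<mu>. (m x * g k \<mu> x) * complex_of_real (\<psi> (2 ^ k *\<^sub>R x - lattice_vec l)))"
          by (simp add: M_def mult_ac)
        also have "\<dots> = (m x * g k \<mu> x) * complex_of_real (\<Sum>l\<in>Nl \<mu>. \<psi> (2 ^ k *\<^sub>R x - lattice_vec l))"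
          by (simp add: sum_distrib_left)
        finally show ?thesis by (simp add: one)
      qed simp
      with P have P': "(?P has_sum m x * g k \<mu> x) UNIV" by simp
      have hP: "h k \<mu> (k + i) \<nu> x = ?P (i, \<nu>)" for i \<nu>
      proof (cases "\<mu> \<in> near (2 * d) k (k + i) \<nu>")
        case False
        have z: "g k \<mu> x * G k l i \<nu> (2 ^ k *\<^sub>R x) = 0" for l
        proof (rule ccontr)
          assume "g k \<mu> x * G k l i \<nu> (2 ^ k *\<^sub>R x) \<noteq> 0"
          then have x: "x \<in> dil_cube d k \<mu>" "2 ^ k *\<^sub>R x \<in> dil_cube d i \<nu>"
            using g[of k \<mu>] G[of i \<nu> k l] by (auto simp: piece_def)
          have "\<bar>of_int (\<nu> $ a) / 2 ^ i - of_int (\<mu> $ a)\<bar> \<le> 2 * d" for a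
          proof -
            have 1: "\<bar>2 ^ k * x $ a - of_int (\<mu> $ a)\<bar> \<le> d" using x(1) by (simp add: mem_dil_cube)
            have 2: "\<bar>2 ^ i * (2 ^ k * x $ a) - of_int (\<nu> $ a)\<bar> \<le> d" using x(2) by (simp add: mem_dil_cube)
            have "2 ^ k * x $ a - of_int (\<nu> $ a) / 2 ^ i = (2 ^ i * (2 ^ k * x $ a) - of_int (\<nu> $ a)) / 2 ^ i"
              by (simp add: field_simps)
            then have "\<bar>2 ^ k * x $ a - of_int (\<nu> $ a) / 2 ^ i\<bar> = \<bar>2 ^ i * (2 ^ k * x $ a) - of_int (\<nu> $ a)\<bar> / 2 ^ i"
              by simp
            also have "\<dots> \<le> d / 1" using 2 d by (intro frac_le) auto
            finally show ?thesis using 1 by linarith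
          qed
          then show False using False by (simp add: near_def)
        qed
        have "(\<Sum>l\<in>Nl \<mu>. g k \<mu> x * G k l i \<nu> (2 ^ k *\<^sub>R x)) = 0" by (rule sum.neutral) (use z in blast)
        then show ?thesis using False by (simp only: h_def prod.case if_False simp_thms)
      qed (simp add: h_def)
      have "((\<lambda>(L, \<nu>). h k \<mu> L \<nu> x) has_sum m x * g k \<mu> x) ({k..} \<times> UNIV) = (?P has_sum m x * g k \<mu> x) UNIV"
        by (rule has_sum_reindex_bij_witness[where i = "\<lambda>(i, \<nu>). (k + i, \<nu>)" and j = "\<lambda>(L, \<nu>). (L - k, \<nu>)"])
          (use hP[symmetric] in auto)
      moreover have "((\<lambda>(L, \<nu>). h k \<mu> L \<nu> x) has_sum m x * g k \<mu> x) ({k..} \<times> UNIV)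
          = ((\<lambda>(L, \<nu>). h k \<mu> L \<nu> x) has_sum m x * g k \<mu> x) UNIV"
        by (rule has_sum_cong_neutral) (auto simp: h_def split: if_splits)
      ultimately show "((\<lambda>(L, \<nu>). h k \<mu> L \<nu> x) has_sum m x * g k \<mu> x) UNIV" using P' by blast
    qed
  qed
  have S: "AE x in lebesgue. ((\<lambda>(k, \<mu>). m x * g k \<mu> x) has_sum m x * f x) UNIV"
    using gS
  proof eventually_elim
    case (elim x) then show ?case using has_sum_cmult_right[OF elim, of "m x"] by (simp add: case_prod_unfold)
  qed
  have "decomp d ?K (\<lambda>x. m x * f x) (synth (2 * d) v)" if b: "bn s p q (synth (2 * d) v) < \<infinity>"
    by (rule decomp_synth[OF p q d s b h _ F S]) (auto simp: v_def split: if_splits)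
  then show ?thesis using v0 bnv by (intro exI[of _ v]) blast
qed

lemma mult_const_nonneg: "0 < p \<Longrightarrow> 0 < q \<Longrightarrow> 0 \<le> mult_const n d K p q"
  using sum_const_pos[of p, THEN less_imp_le] sum_const_pos[of q, THEN less_imp_le]
  by (simp add: mult_const_def Let_def)

lemma mult_decomp_smoother:
  fixes \<psi> :: "real^'n \<Rightarrow> real" and m f :: "real^'n \<Rightarrow> complex"
  assumes \<psi>: "resolution_fun \<psi>" and p: "0 < p" and q: "0 < q" and d: "0 < d" and s: "0 < s" "s < \<sigma>" and A: "0 \<le> A"
    and m: "\<And>k l. \<exists>w. decomp d K1 (\<lambda>x. of_real (\<psi> (x - lattice_vec l)) * m ((1 / 2 ^ k) *\<^sub>R x)) w \<and> bn \<sigma> p q w \<le> ennreal A"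
    and f: "decomp d K2 f u" "bn s p q u < \<infinity>"
  obtains U where "decomp d (min K1 K2) (\<lambda>x. m x * f x) U"
    "bn s p q U \<le> ennreal (synth_const CARD('n) (2 * d) p q ((\<sigma> - s) / 2) * (mult_const CARD('n) d (min K1 K2) p q * A)) * bn s p q u"
proof -
  let ?B = "mult_const CARD('n) d (min K1 K2) p q * A"
  have B: "0 \<le> ?B" using A mult_const_nonneg[OF p q] by simp
  obtain v where v: "\<And>k \<mu> L \<nu>. 0 \<le> v k \<mu> L \<nu>"
    "\<And>k \<mu>. bn \<sigma> p q (\<lambda>i. v k \<mu> (k + i)) \<le> ennreal ?B * ennreal (u k \<mu>)"
    "bn s p q (synth (2 * d) v) < \<infinity> \<longrightarrow> decomp d (min K1 K2) (\<lambda>x. m x * f x) (synth (2 * d) v)"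
    using mult_term_decompositions[OF \<psi> p q q d s(1) A m f(1)] by blast
  have le: "bn s p q (synth (2 * d) v) \<le> ennreal (synth_const CARD('n) (2 * d) p q ((\<sigma> - s) / 2) * ?B) * bn s p q u"
  proof (rule bn_synth_smoother[OF p q s(2) B _ v(1)])
    fix k \<mu> i
    let ?e = "real CARD('n) * enn2real (1 / p)"
    have "Lp_qnorm (count_space UNIV) p (\<lambda>\<nu>. ennreal (v k \<mu> (k + i) \<nu>))
        \<le> ennreal (2 powr - (real i * (\<sigma> - ?e))) * bn \<sigma> p q (\<lambda>i. v k \<mu> (k + i))"
      by (rule level_norm_le[OF q])
    also have "\<dots> \<le> ennreal (2 powr - (real i * (\<sigma> - ?e))) * (ennreal ?B * ennreal (u k \<mu>))"
      by (intro mult_left_mono v(2)) auto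
    also have "\<dots> = ennreal (?B * 2 powr - (real i * (\<sigma> - ?e))) * ennreal (u k \<mu>)"
      unfolding ennreal_mult[OF B powr_ge_zero] by (simp only: mult_ac)
    finally show "Lp_qnorm (count_space UNIV) p (\<lambda>\<nu>. ennreal (v k \<mu> (k + i) \<nu>))
        \<le> ennreal (?B * 2 powr - (real i * (\<sigma> - ?e))) * ennreal (u k \<mu>)" .
  qed
  then have "bn s p q (synth (2 * d) v) < \<infinity>" using f(2) by (auto simp: ennreal_mult_less_top intro: le_less_trans)
  then show ?thesis using that v(3) le by blast
qed

lemma mult_decomp_p_le_1:
  fixes \<psi> :: "real^'n \<Rightarrow> real" and m f :: "real^'n \<Rightarrow> complex"
  assumes \<psi>: "resolution_fun \<psi>" and p: "0 < p" "p \<le> 1" and d: "0 < d" and s: "0 < s" and A: "0 \<le> A"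
    and m: "\<And>k l. \<exists>w. decomp d K (\<lambda>x. of_real (\<psi> (x - lattice_vec l)) * m ((1 / 2 ^ k) *\<^sub>R x)) w \<and> bn s p p w \<le> ennreal A"
    and f: "decomp d K f u" "bn s p p u < \<infinity>"
  obtains U where "decomp d K (\<lambda>x. m x * f x) U"
    "bn s p p U \<le> ennreal (mult_const CARD('n) d K p p * A) * bn s p p u"
proof -
  let ?B = "mult_const CARD('n) d K p p * A"
  obtain v where v: "\<And>k \<mu> L \<nu>. 0 \<le> v k \<mu> L \<nu>"
    "\<And>k \<mu>. bn s p p (\<lambda>i. v k \<mu> (k + i)) \<le> ennreal ?B * ennreal (u k \<mu>)"
    "bn s p p (synth (2 * d) v) < \<infinity> \<longrightarrow> decomp d K (\<lambda>x. m x * f x) (synth (2 * d) v)"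
    using mult_term_decompositions[OF \<psi> p(1) p(1) p(1) d s A m f(1)] unfolding min.idem by blast
  have le: "bn s p p (synth (2 * d) v) \<le> ennreal ?B * bn s p p u"
    by (rule bn_synth_p_le_1[OF p v(2,1)])
  then have "bn s p p (synth (2 * d) v) < \<infinity>" using f(2) by (auto simp: ennreal_mult_less_top intro: le_less_trans)
  then show ?thesis using that v(3) le by blast
qed

section \<open>Lagrange interpolation on cubes\<close>

subsection \<open>One variable\<close>

text \<open>The Lagrange basis polynomials for the nodes \<open>0, \<dots>, N - 1\<close>.\<close>

definition lag :: "nat \<Rightarrow> nat \<Rightarrow> real poly" where
  "lag N r = smult (1 / (\<Prod>j\<in>{..<N} - {r}. real r - real j)) (\<Prod>j\<in>{..<N} - {r}. [:- real j, 1:])"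

lemma lag_at: "k < N \<Longrightarrow> r < N \<Longrightarrow> poly (lag N r) (real k) = (if k = r then 1 else 0)"
  by (auto simp: lag_def poly_prod)

lemma degree_lag: "r < N \<Longrightarrow> degree (lag N r) < N"
proof -
  assume r: "r < N"
  have "degree (\<Prod>j\<in>{..<N} - {r}. [:- real j, 1:]) \<le> (\<Sum>j\<in>{..<N} - {r}. degree [:- real j, 1:])"
    using degree_prod_sum_le[of "{..<N} - {r}" "\<lambda>j. [:- real j, 1:]"] by simp
  also have "\<dots> < N" using r by simp
  finally show ?thesis unfolding lag_def using degree_smult_le le_less_trans by blast
qed

lemma lag_reproduce:
  assumes "degree P < N"
  shows "poly P t = (\<Sum>r<N. poly P (real r) * poly (lag N r) t)"
proof -
  define Q where "Q = (\<Sum>r<N. smult (poly P (real r)) (lag N r))"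
  have c: "card (real ` {..<N}) = N" by (simp add: card_image)
  have "P = Q"
  proof (rule poly_eqI_degree[of "real ` {..<N}"])
    fix x assume "x \<in> real ` {..<N}"
    then obtain k where k: "x = real k" "k < N" by auto
    have "poly Q x = (\<Sum>r<N. poly P (real r) * (if k = r then 1 else 0))"
      unfolding Q_def poly_sum k using k(2) by (intro sum.cong) (auto simp: lag_at)
    also have "\<dots> = (\<Sum>r<N. if k = r then poly P (real r) else 0)" by (intro sum.cong) auto
    also have "\<dots> = poly P x" using k by (simp add: sum.delta')
    finally show "poly P x = poly Q x" by simp
  next
    have "degree Q < N"
    proof -
      have "degree (smult (poly P (real r)) (lag N r)) \<le> N - 1" if "r < N" for r
        using degree_lag[OF that] degree_smult_le[of "poly P (real r)" "lag N r"] by linarith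
      then have "degree Q \<le> N - 1" unfolding Q_def by (intro degree_sum_le) auto
      then show ?thesis using assms by linarith
    qed
    then show "degree Q < card (real ` {..<N})" unfolding c .
  qed (use assms c in simp)
  then have "poly P t = poly Q t" by simp
  then show ?thesis by (simp add: Q_def poly_sum)
qed

lemma lag_bounded: "\<exists>\<Lambda>\<ge>0. \<forall>t. \<bar>t\<bar> \<le> R \<longrightarrow> (\<Sum>r<N. \<bar>poly (lag N r) t\<bar>) \<le> \<Lambda>"
proof -
  have "compact ((\<lambda>t. \<Sum>r<N. \<bar>poly (lag N r) t\<bar>) ` {- R..R})"
    by (intro compact_continuous_image continuous_intros) auto
  then obtain B where "\<forall>y\<in>(\<lambda>t. \<Sum>r<N. \<bar>poly (lag N r) t\<bar>) ` {- R..R}. norm y \<le> B"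
    using compact_imp_bounded bounded_iff by metis
  then have B: "(\<Sum>r<N. \<bar>poly (lag N r) t\<bar>) \<le> B" if "\<bar>t\<bar> \<le> R" for t
    using that by (force simp: abs_le_iff)
  show ?thesis
    by (intro exI[of _ "\<bar>B\<bar>"] conjI allI impI) (use B in \<open>auto intro: order_trans[OF B]\<close>)
qed

lemma D_iter_Cons: "D_iter (i # \<alpha>) f = partial_deriv i (D_iter \<alpha> f)"
  by (simp add: D_iter_def)

lemma Cbd_D_iter: "Cbd (K + length \<alpha>) A t f \<Longrightarrow> Cbd K (A * t ^ length \<alpha>) t (D_iter \<alpha> f)"
proof (induction \<alpha> arbitrary: A f rule: rev_induct)
  case (snoc i \<alpha>)
  then have "Cbd (K + length \<alpha>) (A * t) t (partial_deriv i f)" by (simp add: Cbd_Suc)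
  from snoc.IH[OF this] show ?case by (simp add: D_iter_snoc mult_ac)
qed simp

lemma partial_deriv_vector_derivative:
  fixes f :: "real^'n \<Rightarrow> complex"
  assumes "\<And>x. f differentiable (at x)"
  shows "((\<lambda>h. f (x + h *\<^sub>R axis i 1)) has_vector_derivative partial_deriv i f (x + h *\<^sub>R axis i 1)) (at h)"
proof -
  have "((\<lambda>h. f (x + h *\<^sub>R axis i 1)) has_derivative (\<lambda>k. frechet_derivative f (at (x + h *\<^sub>R axis i 1)) (k *\<^sub>R axis i 1))) (at h)"
    by (rule has_derivative_compose[where f = "\<lambda>h. x + h *\<^sub>R axis i 1"])
      (auto intro!: derivative_eq_intros has_derivative_frechet assms)
  then show ?thesis
    by (simp add: has_vector_derivative_def partial_deriv_def
        linear_cmul[OF has_derivative_linear[OF has_derivative_frechet[OF assms]]])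
qed

text \<open>The factor \<open>2\<close> comes from treating real and imaginary part separately, since the intermediate
  points in the remainder terms differ.\<close>

lemma Cbd_line_Taylor:
  fixes f :: "real^'n \<Rightarrow> complex"
  assumes f: "Cbd N A t f"
  obtains c :: "nat \<Rightarrow> complex" where
    "\<And>h. norm (f (x + h *\<^sub>R axis i 1) - (\<Sum>m<N. c m * of_real (h ^ m))) \<le> 2 * (A * t ^ N) * \<bar>h\<bar> ^ N"
proof -
  define D where "D m h = D_iter (replicate m i) f (x + h *\<^sub>R axis i 1)" for m h
  define c where "c m = D m 0 / of_real (fact m)" for m
  have d: "(D m has_vector_derivative D (Suc m) h) (at h)" if "m < N" for m h
  proof -
    have "Cbd (Suc (N - Suc m)) (A * t ^ m) t (D_iter (replicate m i) f)"
      using Cbd_D_iter[of "Suc (N - Suc m)" "replicate m i" A t f] f that by simp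
    then have "\<And>x. D_iter (replicate m i) f differentiable (at x)" by (simp add: Cbd_Suc)
    from partial_deriv_vector_derivative[OF this, of x i h]
    show ?thesis by (simp add: D_def[abs_def] D_iter_Cons)
  qed
  have bN: "norm (D N h) \<le> A * t ^ N" for h
    using f unfolding Cbd_def D_def by (metis length_replicate order_refl)
  have part: "\<bar>T (D 0 h) - (\<Sum>m<N. T (D m 0) / fact m * h ^ m)\<bar> \<le> A * t ^ N * \<bar>h\<bar> ^ N"
    if T: "bounded_linear T" "\<And>z. \<bar>T z\<bar> \<le> norm z" for T :: "complex \<Rightarrow> real" and h
  proof -
    have "\<exists>\<tau>. \<bar>\<tau>\<bar> \<le> \<bar>h\<bar> \<and> T (D 0 h) = (\<Sum>m<N. T (D m 0) / fact m * h ^ m) + T (D N \<tau>) / fact N * h ^ N"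
    proof (rule Maclaurin_bi_le[of "\<lambda>m h. T (D m h)" "\<lambda>h. T (D 0 h)"])
      show "\<forall>m \<tau>. m < N \<and> \<bar>\<tau>\<bar> \<le> \<bar>h\<bar> \<longrightarrow> ((\<lambda>h. T (D m h)) has_real_derivative T (D (Suc m) \<tau>)) (at \<tau>)"
        using bounded_linear.has_vector_derivative[OF T(1) d] by (simp add: has_real_derivative_iff_has_vector_derivative)
    qed simp
    then obtain \<tau> where "T (D 0 h) = (\<Sum>m<N. T (D m 0) / fact m * h ^ m) + T (D N \<tau>) / fact N * h ^ N" by blast
    then have e: "T (D 0 h) - (\<Sum>m<N. T (D m 0) / fact m * h ^ m) = T (D N \<tau>) / fact N * h ^ N" by linarith
    have "\<bar>T (D N \<tau>) / fact N\<bar> \<le> norm (D N \<tau>) / 1"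
      unfolding abs_divide using T(2) by (intro frac_le) (auto simp: fact_ge_1)
    then have "\<bar>T (D N \<tau>) / fact N\<bar> \<le> A * t ^ N" using bN[of \<tau>] by simp
    then show ?thesis unfolding e abs_mult power_abs by (rule mult_right_mono) simp
  qed
  have "norm (f (x + h *\<^sub>R axis i 1) - (\<Sum>m<N. c m * of_real (h ^ m))) \<le> 2 * (A * t ^ N) * \<bar>h\<bar> ^ N" for h
  proof -
    let ?z = "D 0 h - (\<Sum>m<N. c m * of_real (h ^ m))"
    have cm: "Re (c m * of_real (h ^ m)) = Re (D m 0) / fact m * h ^ m" "Im (c m * of_real (h ^ m)) = Im (D m 0) / fact m * h ^ m" for m
    proof -
      have e: "c m * of_real (h ^ m) = of_real (h ^ m / fact m) * D m 0"
        by (simp add: c_def)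
      show "Re (c m * of_real (h ^ m)) = Re (D m 0) / fact m * h ^ m" "Im (c m * of_real (h ^ m)) = Im (D m 0) / fact m * h ^ m"
        unfolding e times_complex.sel Re_complex_of_real Im_complex_of_real by simp_all
    qed
    have R: "\<bar>Re ?z\<bar> \<le> A * t ^ N * \<bar>h\<bar> ^ N"
      using part[OF bounded_linear_Re abs_Re_le_cmod, of h] by (simp only: minus_complex.sel Re_sum cm)
    have I: "\<bar>Im ?z\<bar> \<le> A * t ^ N * \<bar>h\<bar> ^ N"
      using part[OF bounded_linear_Im abs_Im_le_cmod, of h] by (simp only: minus_complex.sel Im_sum cm)
    have "norm ?z \<le> \<bar>Re ?z\<bar> + \<bar>Im ?z\<bar>" by (rule cmod_le)
    also have "\<dots> \<le> 2 * (A * t ^ N) * \<bar>h\<bar> ^ N" using R I by simp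
    finally show ?thesis by (simp add: D_def)
  qed
  then show ?thesis using that by blast
qed

definition upd :: "'n::finite \<Rightarrow> real \<Rightarrow> real^'n \<Rightarrow> real^'n" where
  "upd i h y = (\<chi> k. if k = i then h else y $ k)"

text \<open>Interpolation reproduces the Taylor polynomial, so the error is the interpolation error of
  the Taylor remainder, and the latter is small at all nodes.\<close>

lemma line_interpolation_error:
  assumes "0 \<le> R" "real N \<le> R"
  obtains C where "0 \<le> C" "\<And>(f :: real^'n \<Rightarrow> complex) A t y i. Cbd N A t f \<Longrightarrow> \<bar>y $ i\<bar> \<le> R \<Longrightarrow> 0 \<le> t \<Longrightarrow>
     norm (f y - (\<Sum>r<N. of_real (poly (lag N r) (y $ i)) * f (upd i (real r) y))) \<le> C * (A * t ^ N)"
proof -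
  obtain \<Lambda> where \<Lambda>: "0 \<le> \<Lambda>" "\<And>t. \<bar>t\<bar> \<le> R \<Longrightarrow> (\<Sum>r<N. \<bar>poly (lag N r) t\<bar>) \<le> \<Lambda>"
    using lag_bounded[of R N] by blast
  define C where "C = 2 * R ^ N * (1 + \<Lambda>)"
  have "norm (f y - (\<Sum>r<N. of_real (poly (lag N r) (y $ i)) * f (upd i (real r) y))) \<le> C * (A * t ^ N)"
    if f: "Cbd N A t f" and y: "\<bar>y $ i\<bar> \<le> R" and t: "0 \<le> t" for f :: "real^'n \<Rightarrow> complex" and A t y i
  proof -
    let ?x = "upd i 0 y" and ?l = "\<lambda>r. complex_of_real (poly (lag N r) (y $ i))"
    have A: "0 \<le> A * t ^ N" using Cbd_nonneg[OF f] t by simp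
    obtain c where c: "\<And>h. norm (f (?x + h *\<^sub>R axis i 1) - (\<Sum>m<N. c m * of_real (h ^ m))) \<le> 2 * (A * t ^ N) * \<bar>h\<bar> ^ N"
      using Cbd_line_Taylor[OF f] by blast
    have upd: "?x + h *\<^sub>R axis i 1 = upd i h y" for h by (auto simp: upd_def vec_eq_iff axis_def)
    have yy: "upd i (y $ i) y = y" by (simp add: upd_def vec_eq_iff)
    define Pl where "Pl h = (\<Sum>m<N. c m * of_real (h ^ m))" for h
    define e where "e h = f (upd i h y) - Pl h" for h
    have e: "norm (e h) \<le> 2 * (A * t ^ N) * R ^ N" if "\<bar>h\<bar> \<le> R" for h
    proof -
      have "norm (e h) \<le> 2 * (A * t ^ N) * \<bar>h\<bar> ^ N" using c[of h] unfolding upd e_def Pl_def .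
      also have "\<dots> \<le> 2 * (A * t ^ N) * R ^ N" using A that by (intro mult_left_mono power_mono) auto
      finally show ?thesis .
    qed
    have repr: "Pl (y $ i) = (\<Sum>r<N. ?l r * Pl (real r))"
    proof -
      have mono: "of_real ((y $ i) ^ m) = (\<Sum>r<N. ?l r * complex_of_real (real r ^ m))" if "m < N" for m
      proof -
        have "(y $ i) ^ m = (\<Sum>r<N. real r ^ m * poly (lag N r) (y $ i))"
          using lag_reproduce[of "monom 1 m" N "y $ i"] that by (simp add: degree_monom_eq poly_monom)
        then have "complex_of_real ((y $ i) ^ m) = complex_of_real (\<Sum>r<N. real r ^ m * poly (lag N r) (y $ i))" by simp
        then show ?thesis by (simp add: mult.commute)
      qed
      have "Pl (y $ i) = (\<Sum>m<N. c m * (\<Sum>r<N. ?l r * complex_of_real (real r ^ m)))"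
        unfolding Pl_def using mono by (intro sum.cong) auto
      also have "\<dots> = (\<Sum>m<N. \<Sum>r<N. ?l r * (c m * complex_of_real (real r ^ m)))"
        by (simp add: sum_distrib_left mult.left_commute)
      also have "\<dots> = (\<Sum>r<N. \<Sum>m<N. ?l r * (c m * complex_of_real (real r ^ m)))" by (rule sum.swap)
      also have "\<dots> = (\<Sum>r<N. ?l r * Pl (real r))" by (simp add: Pl_def sum_distrib_left)
      finally show ?thesis .
    qed
    have "f y - (\<Sum>r<N. ?l r * f (upd i (real r) y)) = e (y $ i) - (\<Sum>r<N. ?l r * e (real r))"
    proof -
      have "(\<Sum>r<N. ?l r * f (upd i (real r) y)) = (\<Sum>r<N. ?l r * e (real r)) + (\<Sum>r<N. ?l r * Pl (real r))"
        unfolding sum.distrib[symmetric] by (intro sum.cong) (auto simp: e_def algebra_simps)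
      then show ?thesis unfolding repr[symmetric] by (simp add: e_def yy)
    qed
    also have "norm \<dots> \<le> norm (e (y $ i)) + (\<Sum>r<N. norm (?l r * e (real r)))"
      by (intro order_trans[OF norm_triangle_ineq4] add_left_mono norm_sum)
    also have "\<dots> \<le> 2 * (A * t ^ N) * R ^ N + (\<Sum>r<N. \<bar>poly (lag N r) (y $ i)\<bar> * (2 * (A * t ^ N) * R ^ N))"
    proof (intro add_mono sum_mono)
      fix r assume "r \<in> {..<N}"
      then have "\<bar>real r\<bar> \<le> R" using assms by simp
      then show "norm (?l r * e (real r)) \<le> \<bar>poly (lag N r) (y $ i)\<bar> * (2 * (A * t ^ N) * R ^ N)"
        unfolding norm_mult norm_of_real by (intro mult_left_mono e) auto
    qed (use e y in auto)
    also have "\<dots> = (1 + (\<Sum>r<N. \<bar>poly (lag N r) (y $ i)\<bar>)) * (2 * (A * t ^ N) * R ^ N)"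
      by (simp add: sum_distrib_right distrib_right)
    also have "\<dots> \<le> (1 + \<Lambda>) * (2 * (A * t ^ N) * R ^ N)"
      using \<Lambda>(2)[OF y] A assms by (intro mult_right_mono) auto
    finally show ?thesis by (simp add: C_def mult_ac)
  qed
  moreover have "0 \<le> C" using assms \<Lambda> by (simp add: C_def)
  ultimately show ?thesis using that by blast
qed

subsection \<open>Several variables\<close>

definition tensor_lag :: "nat \<Rightarrow> 'n set \<Rightarrow> ('n \<Rightarrow> nat) \<Rightarrow> real^'n \<Rightarrow> real" where
  "tensor_lag N S g y = (\<Prod>k\<in>S. poly (lag N (g k)) (y $ k))"

definition grid :: "nat \<Rightarrow> 'n set \<Rightarrow> ('n \<Rightarrow> nat) set" where
  "grid N S = (\<Pi>\<^sub>E k\<in>S. {..<N})"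

definition interp :: "nat \<Rightarrow> 'n set \<Rightarrow> (real^'n \<Rightarrow> complex) \<Rightarrow> real^'n \<Rightarrow> complex" where
  "interp N S f y = (\<Sum>g\<in>grid N S. of_real (tensor_lag N S g y) * f (\<chi> k. if k \<in> S then real (g k) else y $ k))"

lemma finite_grid [simp]: "finite (grid N (S :: 'n::finite set))"
  unfolding grid_def by (intro finite_PiE) auto

lemma interp_insert:
  fixes y :: "real^'n"
  assumes "i \<notin> S"
  shows "interp N (insert i S) f y = (\<Sum>r<N. of_real (poly (lag N r) (y $ i)) * interp N S f (upd i (real r) y))"
proof -
  have "interp N (insert i S) f y = (\<Sum>(r, g)\<in>{..<N} \<times> grid N S. of_real (tensor_lag N (insert i S) (g(i := r)) y)
      * f (\<chi> k. if k \<in> insert i S then real ((g(i := r)) k) else y $ k))"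
    unfolding interp_def grid_def PiE_insert_eq
    by (subst sum.reindex[OF inj_combinator[OF assms]]) (simp add: case_prod_unfold)
  also have "\<dots> = (\<Sum>(r, g)\<in>{..<N} \<times> grid N S. of_real (poly (lag N r) (y $ i)) * (of_real (tensor_lag N S g (upd i (real r) y))
      * f (\<chi> k. if k \<in> S then real (g k) else upd i (real r) y $ k)))"
  proof (rule sum.cong, simp, clarify)
    fix r g
    have "tensor_lag N (insert i S) (g(i := r)) y = poly (lag N r) (y $ i) * tensor_lag N S g (upd i (real r) y)"
    proof -
      have "(\<Prod>k\<in>S. poly (lag N ((g(i := r)) k)) (y $ k)) = (\<Prod>k\<in>S. poly (lag N (g k)) (upd i (real r) y $ k))"
        using assms by (intro prod.cong) (auto simp: upd_def)
      then show ?thesis using assms by (simp add: tensor_lag_def)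
    qed
    moreover have "(\<chi> k. if k \<in> insert i S then real ((g(i := r)) k) else y $ k)
        = (\<chi> k. if k \<in> S then real (g k) else upd i (real r) y $ k)"
      using assms by (auto simp: vec_eq_iff upd_def)
    ultimately show "of_real (tensor_lag N (insert i S) (g(i := r)) y) * f (\<chi> k. if k \<in> insert i S then real ((g(i := r)) k) else y $ k)
      = of_real (poly (lag N r) (y $ i)) * (of_real (tensor_lag N S g (upd i (real r) y))
      * f (\<chi> k. if k \<in> S then real (g k) else upd i (real r) y $ k))" by simp
  qed
  also have "\<dots> = (\<Sum>r<N. of_real (poly (lag N r) (y $ i)) * interp N S f (upd i (real r) y))"
    by (simp add: interp_def sum.cartesian_product[symmetric] sum_distrib_left)
  finally show ?thesis .
qed

text \<open>Interpolating in one coordinate after the other, only pure derivatives of order \<open>N\<close> enter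
  the error, and these are under control for a function of class \<open>C\<^sup>N\<close>; a Taylor polynomial of
  the same tensor degree would need mixed derivatives of higher order.\<close>

lemma interp_error_exists:
  fixes R :: real and S :: "'n::finite set"
  assumes R: "0 \<le> R" "real N \<le> R"
  shows "\<exists>C\<ge>0. \<forall>(f :: real^'n \<Rightarrow> complex) A t y. Cbd N A t f \<longrightarrow> 0 \<le> t \<longrightarrow> (\<forall>i. \<bar>y $ i\<bar> \<le> R) \<longrightarrow>
     norm (f y - interp N S f y) \<le> C * (A * t ^ N)"
proof (induction S rule: finite_induct[OF finite])
  case 1
  have "interp N {} f y = f y" for f and y :: "real^'n"
    by (simp add: interp_def grid_def tensor_lag_def)
  then show ?case by (intro exI[of _ 0]) auto
next
  case (2 i S)
  then obtain E where E: "0 \<le> E" "\<And>(f :: real^'n \<Rightarrow> complex) A t y. Cbd N A t f \<Longrightarrow> 0 \<le> t \<Longrightarrow> (\<And>i. \<bar>y $ i\<bar> \<le> R) \<Longrightarrow>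
     norm (f y - interp N S f y) \<le> E * (A * t ^ N)" by blast
  obtain C where C: "0 \<le> C" "\<And>(f :: real^'n \<Rightarrow> complex) A t y i. Cbd N A t f \<Longrightarrow> \<bar>y $ i\<bar> \<le> R \<Longrightarrow> 0 \<le> t \<Longrightarrow>
     norm (f y - (\<Sum>r<N. of_real (poly (lag N r) (y $ i)) * f (upd i (real r) y))) \<le> C * (A * t ^ N)"
    using line_interpolation_error[OF R] by blast
  obtain \<Lambda> where \<Lambda>: "0 \<le> \<Lambda>" "\<And>t. \<bar>t\<bar> \<le> R \<Longrightarrow> (\<Sum>r<N. \<bar>poly (lag N r) t\<bar>) \<le> \<Lambda>"
    using lag_bounded[of R N] by blast
  have "norm (f y - interp N (insert i S) f y) \<le> (C + \<Lambda> * E) * (A * t ^ N)"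
    if f: "Cbd N A t f" and t: "0 \<le> t" and y: "\<And>i. \<bar>y $ i\<bar> \<le> R" for f :: "real^'n \<Rightarrow> complex" and A t y
  proof -
    let ?l = "\<lambda>r. complex_of_real (poly (lag N r) (y $ i))"
    have A: "0 \<le> A * t ^ N" using Cbd_nonneg[OF f] t by simp
    have e: "f y - interp N (insert i S) f y = (f y - (\<Sum>r<N. ?l r * f (upd i (real r) y)))
       + (\<Sum>r<N. ?l r * (f (upd i (real r) y) - interp N S f (upd i (real r) y)))"
      by (simp add: interp_insert[OF 2(2)] right_diff_distrib sum_subtractf)
    have "norm (f y - interp N (insert i S) f y) \<le> C * (A * t ^ N)
       + (\<Sum>r<N. norm (?l r * (f (upd i (real r) y) - interp N S f (upd i (real r) y))))"
      unfolding e by (intro order_trans[OF norm_triangle_ineq] add_mono C(2) f y t norm_sum)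
    also have "\<dots> \<le> C * (A * t ^ N) + (\<Sum>r<N. \<bar>poly (lag N r) (y $ i)\<bar> * (E * (A * t ^ N)))"
    proof (intro add_left_mono sum_mono)
      fix r assume r: "r \<in> {..<N}"
      have "\<bar>upd i (real r) y $ k\<bar> \<le> R" for k using y[of k] R r by (simp add: upd_def)
      then show "norm (?l r * (f (upd i (real r) y) - interp N S f (upd i (real r) y)))
          \<le> \<bar>poly (lag N r) (y $ i)\<bar> * (E * (A * t ^ N))"
        unfolding norm_mult norm_of_real by (intro mult_left_mono E(2) f t) auto
    qed
    also have "\<dots> = C * (A * t ^ N) + (\<Sum>r<N. \<bar>poly (lag N r) (y $ i)\<bar>) * (E * (A * t ^ N))"
      by (simp add: sum_distrib_right)
    also have "\<dots> \<le> C * (A * t ^ N) + \<Lambda> * (E * (A * t ^ N))"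
      using \<Lambda>(2)[OF y[of i]] by (intro add_left_mono mult_right_mono mult_nonneg_nonneg[OF E(1) A])
    finally show ?thesis by (simp add: algebra_simps)
  qed
  then show ?case using C(1) E(1) \<Lambda>(1) by (intro exI[of _ "C + \<Lambda> * E"]) auto
qed

definition node :: "('n::finite \<Rightarrow> nat) \<Rightarrow> real^'n" where
  "node g = (\<chi> k. real (g k))"

lemma interp_UNIV: "interp N UNIV f y = (\<Sum>g\<in>grid N UNIV. of_real (tensor_lag N UNIV g y) * f (node g))"
  by (simp add: interp_def node_def)

text \<open>As a product of polynomials of degree less than \<open>N\<close> in the single coordinates, a basis polynomial
  of one grid is reproduced by interpolation on any other grid.\<close>

lemma tensor_lag_reproduce:
  fixes b y :: "real^'n"
  assumes "g \<in> grid N UNIV"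
  shows "tensor_lag N UNIV g (r *\<^sub>R y + b)
    = (\<Sum>g'\<in>grid N UNIV. tensor_lag N UNIV g (r *\<^sub>R node g' + b) * tensor_lag N UNIV g' y)"
proof -
  define P where "P k = pcompose (lag N (g k)) [:b $ k, r:]" for k
  have gk: "g k < N" for k using assms by (auto simp: grid_def PiE_def Pi_def)
  have dP: "degree (P k) < N" for k
  proof -
    have "degree (P k) \<le> degree (lag N (g k)) * degree [:b $ k, r:]" unfolding P_def by (rule degree_pcompose_le)
    also have "\<dots> \<le> degree (lag N (g k)) * 1" by (intro mult_left_mono) auto
    finally show ?thesis using degree_lag[OF gk[of k]] by linarith
  qed
  have P: "poly (lag N (g k)) ((r *\<^sub>R z + b) $ k) = poly (P k) (z $ k)" for k and z :: "real^'n"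
    by (simp add: P_def poly_pcompose algebra_simps)
  have "tensor_lag N UNIV g (r *\<^sub>R y + b) = (\<Prod>k\<in>UNIV. \<Sum>j<N. poly (P k) (real j) * poly (lag N j) (y $ k))"
    unfolding tensor_lag_def P by (intro prod.cong lag_reproduce dP) auto
  also have "\<dots> = (\<Sum>g'\<in>grid N UNIV. \<Prod>k\<in>UNIV. poly (P k) (real (g' k)) * poly (lag N (g' k)) (y $ k))"
    unfolding grid_def by (rule prod_sum_PiE) auto
  also have "\<dots> = (\<Sum>g'\<in>grid N UNIV. tensor_lag N UNIV g (r *\<^sub>R node g' + b) * tensor_lag N UNIV g' y)"
    unfolding tensor_lag_def P by (simp add: node_def prod.distrib)
  finally show ?thesis .
qed

subsection \<open>Smoothness of the localized basis polynomials\<close>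

lemma C_class_lower: "C_class (Suc K) f \<Longrightarrow> C_class K f"
proof (induction K arbitrary: f)
  case 0
  then show ?case by (simp add: continuous_at_imp_continuous_on differentiable_imp_continuous_within)
next
  case (Suc K) then show ?case by auto
qed

lemma C_class_add: "C_class K f \<Longrightarrow> C_class K g \<Longrightarrow> C_class K (\<lambda>x. f x + g x)"
  by (induction K arbitrary: f g) (auto simp: partial_deriv_add intro!: continuous_intros)

lemma C_class_mult:
  fixes f g :: "real^'n \<Rightarrow> real"
  shows "C_class K f \<Longrightarrow> C_class K g \<Longrightarrow> C_class K (\<lambda>x. f x * g x)"
proof (induction K arbitrary: f g)
  case (Suc K)
  then have d: "\<And>x. f differentiable (at x)" "\<And>x. g differentiable (at x)" by auto
  have D: "((\<lambda>x. f x * g x) has_derivative (\<lambda>h. f x * frechet_derivative g (at x) h + frechet_derivative f (at x) h * g x)) (at x)" for x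
    by (intro has_derivative_mult has_derivative_frechet d)
  have "partial_deriv i (\<lambda>x. f x * g x) = (\<lambda>x. f x * partial_deriv i g x + partial_deriv i f x * g x)" for i
    by (rule ext, subst partial_deriv_eq[OF D]) (simp add: partial_deriv_def)
  moreover have "C_class K (\<lambda>x. f x * partial_deriv i g x + partial_deriv i f x * g x)" for i
    using Suc.prems C_class_lower by (intro C_class_add Suc.IH) auto
  ultimately show ?case using d by (auto intro: differentiable_mult)
qed (auto intro!: continuous_intros)

lemma C_class_coord: "C_class K (\<lambda>x::real^'n. x $ k)"
proof (cases K)
  case (Suc L)
  have D: "((\<lambda>x::real^'n. x $ k) has_derivative (\<lambda>h. h $ k)) (at x)" for x
    by (rule bounded_linear.has_derivative[OF bounded_linear_vec_nth]) (rule has_derivative_ident)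
  have "partial_deriv i (\<lambda>x::real^'n. x $ k) = (\<lambda>x. axis i 1 $ k)" for i
    by (rule ext, rule partial_deriv_eq[OF D])
  then show ?thesis using D unfolding Suc by (auto simp: C_class_const differentiable_def)
qed (auto intro!: continuous_intros)

lemma C_class_poly: "C_class K (\<lambda>x::real^'n. poly P (x $ k))"
  by (induction P) (auto intro!: C_class_add C_class_mult C_class_coord C_class_const)

lemma C_class_tensor_lag: "C_class K (\<lambda>x::real^'n. tensor_lag N S g x)"
  unfolding tensor_lag_def
  by (induction S rule: infinite_finite_induct) (auto intro!: C_class_mult C_class_poly C_class_const)

lemma localized_basis_Cbd:
  fixes \<phi> :: "real^'n \<Rightarrow> real"
  assumes "cube_partition \<phi>"
  obtains B where "0 \<le> B" "\<And>g. g \<in> grid N UNIV \<Longrightarrow> Cbd K B 1 (\<lambda>y. \<phi> y * tensor_lag N UNIV g y)"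
proof -
  have "\<exists>A. Cbd K A 1 (\<lambda>y. \<phi> y * tensor_lag N UNIV g y)" for g
  proof (rule C_class_compact_supp_bounded)
    have "C_class K \<phi>" using assms unfolding cube_partition_def Cbd_def by blast
    then show "C_class K (\<lambda>y. \<phi> y * tensor_lag N UNIV g y)" by (intro C_class_mult C_class_tensor_lag)
    show "compact (cbox (\<chi> i. -1) (\<chi> i. 1) :: (real^'n) set)" by (rule compact_cbox)
    show "\<phi> x * tensor_lag N UNIV g x = 0" if "x \<notin> cbox (\<chi> i. -1) (\<chi> i. 1)" for x
      using assms that unfolding cube_partition_def by (force simp: mem_box_cart abs_le_iff)
  qed
  then obtain A where A: "\<And>g. Cbd K (A g) 1 (\<lambda>y. \<phi> y * tensor_lag N UNIV g y)" by metis
  have A0: "0 \<le> A g" for g using Cbd_nonneg[OF A] .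
  have "Cbd K (\<Sum>g\<in>grid N UNIV. A g) 1 (\<lambda>y. \<phi> y * tensor_lag N UNIV g y)" if "g \<in> grid N UNIV" for g
    using A0 that by (intro Cbd_mono[OF A[of g]] member_le_sum) auto
  then show ?thesis using that[of "\<Sum>g\<in>grid N UNIV. A g"] A0 by (auto intro: sum_nonneg)
qed

section \<open>Atoms of low order as series of smooth atoms\<close>

lemma norm_sum_bounded:
  fixes f :: "'a \<Rightarrow> 'b::real_normed_vector"
  assumes "card I \<le> N" "\<And>i. i \<in> I \<Longrightarrow> norm (f i) \<le> B" "0 \<le> B"
  shows "norm (\<Sum>i\<in>I. f i) \<le> real N * B"
proof -
  have "norm (\<Sum>i\<in>I. f i) \<le> (\<Sum>i\<in>I. norm (f i))" by (rule norm_sum)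
  also have "\<dots> \<le> real (card I) * B" by (intro sum_bounded_above assms(2))
  also have "\<dots> \<le> real N * B" using assms by (intro mult_right_mono) auto
  finally show ?thesis .
qed

text \<open>The positions whose bump function in the partition of unity on level \<open>i\<close> may be nonzero at \<open>x\<close>.\<close>

definition nbrs :: "nat \<Rightarrow> real^'n \<Rightarrow> (int^'n) set" where
  "nbrs i x = {\<nu>. \<forall>a. \<bar>2 ^ i * x $ a - of_int (\<nu> $ a)\<bar> \<le> 1}"

lemma finite_nbrs: "finite (nbrs i x)" "card (nbrs i (x::real^'n)) \<le> cube_count CARD('n) 1"
  unfolding nbrs_def by (rule near_lattice_points)+

lemma cube_partition_scaled:
  fixes x :: "real^'n" assumes "cube_partition \<phi>"
  shows "\<phi> (2 ^ i *\<^sub>R x - lattice_vec \<nu>) \<noteq> 0 \<Longrightarrow> \<nu> \<in> nbrs i x"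
    and "(\<Sum>\<nu>\<in>nbrs i x. \<phi> (2 ^ i *\<^sub>R x - lattice_vec \<nu>)) = 1"
proof -
  show "\<nu> \<in> nbrs i x" if "\<phi> (2 ^ i *\<^sub>R x - lattice_vec \<nu>) \<noteq> 0"
    using assms that unfolding cube_partition_def nbrs_def by (auto simp: lattice_vec_def)
  have "(\<Sum>m | \<forall>a. \<bar>(2 ^ i *\<^sub>R x) $ a - of_int (m $ a)\<bar> \<le> 1. \<phi> (2 ^ i *\<^sub>R x - lattice_vec m)) = 1"
    using assms unfolding cube_partition_def by blast
  then show "(\<Sum>\<nu>\<in>nbrs i x. \<phi> (2 ^ i *\<^sub>R x - lattice_vec \<nu>)) = 1" by (simp add: nbrs_def)
qed

text \<open>The interpolation polynomial on the grid \<open>2\<^sup>-\<^sup>i(\<nu> + {0,\<dots>,N-1}\<^sup>n)\<close>.\<close>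

definition local_interp :: "nat \<Rightarrow> (real^'n \<Rightarrow> complex) \<Rightarrow> nat \<Rightarrow> int^'n \<Rightarrow> real^'n \<Rightarrow> complex" where
  "local_interp N F i \<nu> x = (\<Sum>g\<in>grid N UNIV. of_real (tensor_lag N UNIV g (2 ^ i *\<^sub>R x - lattice_vec \<nu>))
     * F ((1 / 2 ^ i) *\<^sub>R (node g + lattice_vec \<nu>)))"

lemma local_interp_error:
  fixes R :: real
  assumes "0 \<le> R" "real N \<le> R"
  obtains C where "0 \<le> C" "\<And>(F :: real^'n \<Rightarrow> complex) A i \<nu> x. Cbd N A 1 F \<Longrightarrow>
    (\<And>a. \<bar>2 ^ i * x $ a - of_int (\<nu> $ a)\<bar> \<le> R) \<Longrightarrow> norm (F x - local_interp N F i \<nu> x) \<le> C * (A * (1 / 2 ^ i) ^ N)"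
proof -
  obtain C where C: "0 \<le> C" "\<And>(f :: real^'n \<Rightarrow> complex) A t y. Cbd N A t f \<Longrightarrow> 0 \<le> t \<Longrightarrow> (\<And>i. \<bar>y $ i\<bar> \<le> R) \<Longrightarrow>
     norm (f y - interp N UNIV f y) \<le> C * (A * t ^ N)"
    using interp_error_exists[OF assms, of "UNIV :: 'n set"] by blast
  have "norm (F x - local_interp N F i \<nu> x) \<le> C * (A * (1 / 2 ^ i) ^ N)"
    if F: "Cbd N A 1 F" and x: "\<And>a. \<bar>2 ^ i * x $ a - of_int (\<nu> $ a)\<bar> \<le> R" for F :: "real^'n \<Rightarrow> complex" and A i \<nu> x
  proof -
    let ?f = "\<lambda>y. F ((1 / 2 ^ i) *\<^sub>R y + (1 / 2 ^ i) *\<^sub>R lattice_vec \<nu>)"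
    let ?y = "2 ^ i *\<^sub>R x - lattice_vec \<nu>"
    have f: "Cbd N A (1 * (1 / 2 ^ i)) ?f" by (rule Cbd_affine[OF _ _ F]) auto
    have "norm (?f ?y - interp N UNIV ?f ?y) \<le> C * (A * (1 * (1 / 2 ^ i)) ^ N)"
      by (rule C(2)[OF f]) (use x in \<open>auto simp: lattice_vec_def\<close>)
    moreover have "?f ?y = F x" by (simp add: scaleR_diff_right)
    moreover have "interp N UNIV ?f ?y = local_interp N F i \<nu> x"
      by (simp add: interp_UNIV local_interp_def scaleR_add_right)
    ultimately show ?thesis by simp
  qed
  then show ?thesis using that C(1) by blast
qed

text \<open>Since polynomials are reproduced, the difference of two interpolation polynomials is
  expressed in the basis of the coarser one, with coefficients that are interpolation errors.\<close>

lemma local_interp_diff: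
  fixes F :: "real^'n \<Rightarrow> complex"
  shows "local_interp N F (Suc i) \<nu>' x - local_interp N F i \<nu> x
    = (\<Sum>g\<in>grid N UNIV. of_real (tensor_lag N UNIV g (2 ^ i *\<^sub>R x - lattice_vec \<nu>))
       * (local_interp N F (Suc i) \<nu>' ((1 / 2 ^ i) *\<^sub>R (node g + lattice_vec \<nu>)) - F ((1 / 2 ^ i) *\<^sub>R (node g + lattice_vec \<nu>))))"
proof -
  let ?G = "grid N (UNIV :: 'n set)" and ?y = "2 ^ i *\<^sub>R x - lattice_vec \<nu>" and ?b = "2 *\<^sub>R lattice_vec \<nu> - lattice_vec \<nu>'"
  let ?z = "\<lambda>g. (1 / 2 ^ i) *\<^sub>R (node g + lattice_vec \<nu>)"
  let ?c = "\<lambda>g'. F ((1 / 2 ^ Suc i) *\<^sub>R (node g' + lattice_vec \<nu>'))"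
  have e1: "2 ^ Suc i *\<^sub>R x - lattice_vec \<nu>' = 2 *\<^sub>R ?y + ?b" by (simp add: vec_eq_iff algebra_simps)
  have e2: "2 ^ Suc i *\<^sub>R ?z g - lattice_vec \<nu>' = 2 *\<^sub>R node g + ?b" for g by (simp add: vec_eq_iff algebra_simps)
  have "local_interp N F (Suc i) \<nu>' x = (\<Sum>g'\<in>?G. of_real (tensor_lag N UNIV g' (2 *\<^sub>R ?y + ?b)) * ?c g')"
    unfolding local_interp_def e1 ..
  also have "\<dots> = (\<Sum>g'\<in>?G. of_real (\<Sum>g\<in>?G. tensor_lag N UNIV g' (2 *\<^sub>R node g + ?b) * tensor_lag N UNIV g ?y) * ?c g')"
    by (intro sum.cong refl) (subst tensor_lag_reproduce, auto)
  also have "\<dots> = (\<Sum>g'\<in>?G. \<Sum>g\<in>?G. of_real (tensor_lag N UNIV g ?y) * (of_real (tensor_lag N UNIV g' (2 *\<^sub>R node g + ?b)) * ?c g'))"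
    by (simp add: sum_distrib_left sum_distrib_right mult_ac)
  also have "\<dots> = (\<Sum>g\<in>?G. of_real (tensor_lag N UNIV g ?y) * (\<Sum>g'\<in>?G. of_real (tensor_lag N UNIV g' (2 *\<^sub>R node g + ?b)) * ?c g'))"
    by (subst sum.swap) (simp add: sum_distrib_left)
  also have "\<dots> = (\<Sum>g\<in>?G. of_real (tensor_lag N UNIV g ?y) * local_interp N F (Suc i) \<nu>' (?z g))"
    unfolding local_interp_def e2 ..
  finally show ?thesis
    by (simp add: local_interp_def[of N F i] sum_subtractf right_diff_distrib)
qed

text \<open>On level \<open>i\<close> there are of the order of \<open>2\<^bsup>in\<^esup>\<close> positions near the unit cube, each with a
  coefficient of size \<open>2\<^bsup>-iN\<^esup>\<close>.\<close>

definition smooth_size :: "real \<Rightarrow> real \<Rightarrow> nat \<Rightarrow> real \<Rightarrow> nat \<Rightarrow> int^'n \<Rightarrow> real" where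
  "smooth_size C R N A i \<nu> = (if \<forall>a. \<bar>of_int (\<nu> $ a)\<bar> \<le> R * 2 ^ i then C * A * (1 / 2 ^ i) ^ N else 0)"

text \<open>The functions \<open>S\<^sub>i F = \<Sum>\<^sub>\<nu> \<phi>(2\<^sup>i\<cdot> - \<nu>) T\<^sub>i\<^sub>,\<^sub>\<nu> F\<close>, with the local interpolation polynomials
  \<open>T\<^sub>i\<^sub>,\<^sub>\<nu> F\<close>, are smooth and approximate a function of class \<open>C\<^sup>N\<close> to the order \<open>2\<^bsup>-iN\<^esup>\<close>. The differences
  \<open>S\<^sub>i\<^sub>+\<^sub>1 F - S\<^sub>i F\<close> consist of smooth atoms with coefficients of size \<open>2\<^bsup>-iN\<^esup>\<close>.\<close>

lemma smooth_pieces_exist: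
  fixes \<phi> :: "real^'n \<Rightarrow> real"
  assumes \<phi>: "cube_partition \<phi>" and d: "1 \<le> d" and N: "1 \<le> N"
  obtains C R where "0 \<le> C" "0 \<le> R"
    "\<And>(F :: real^'n \<Rightarrow> complex) A. piece d N 0 0 A F \<Longrightarrow> \<exists>h. (\<forall>i \<nu>. piece d K i \<nu> (smooth_size C R N A i \<nu>) (h i \<nu>)) \<and>
       (\<forall>x. ((\<lambda>(i, \<nu>). h i \<nu> x) has_sum F x) UNIV)"
proof -
  let ?G = "grid N (UNIV :: 'n set)"
  \<comment> \<open>the nodes of a coarse grid have at most this distance, on the fine scale, from the finer position\<close>
  define R0 where "R0 = 2 * real N + 3"
  \<comment> \<open>beyond this distance all nodes lie outside the support of the function\<close>
  define R where "R = d + 2 * real N + 3"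
  obtain E where E: "0 \<le> E" "\<And>(F :: real^'n \<Rightarrow> complex) A i \<nu> x. Cbd N A 1 F \<Longrightarrow>
    (\<And>a. \<bar>2 ^ i * x $ a - of_int (\<nu> $ a)\<bar> \<le> R0) \<Longrightarrow> norm (F x - local_interp N F i \<nu> x) \<le> E * (A * (1 / 2 ^ i) ^ N)"
    using local_interp_error[of R0 N] by (auto simp: R0_def)
  obtain c0 where c0: "Cbd K c0 1 \<phi>" using \<phi> unfolding cube_partition_def by blast
  have c00: "0 \<le> c0" using Cbd_nonneg[OF c0] .
  obtain B where B: "0 \<le> B" "\<And>g. g \<in> ?G \<Longrightarrow> Cbd K B 1 (\<lambda>y. \<phi> y * tensor_lag N UNIV g y)"
    using localized_basis_Cbd[OF \<phi>] by blast
  let ?V = "\<lambda>\<nu>'. {\<nu>::int^'n. \<forall>a. \<bar>of_int (\<nu>' $ a) / 2 - real_of_int (\<nu> $ a)\<bar> \<le> 3 / 2}"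
  have V: "finite (?V \<nu>')" "card (?V \<nu>') \<le> cube_count CARD('n) (3 / 2)" for \<nu>'
    by (rule near_lattice_points)+
  define C1 where "C1 = real (card ?G) * B"
  define C2 where "C2 = 2 ^ K * (c0 * (real (cube_count CARD('n) (3 / 2)) * (real (card ?G) * (B * E))))"
  define C where "C = C1 + C2"
  have C12: "0 \<le> C1" "0 \<le> C2" using B c00 E by (auto simp: C1_def C2_def)
  have "\<exists>h. (\<forall>i \<nu>. piece d K i \<nu> (smooth_size C R N A i \<nu>) (h i \<nu>)) \<and> (\<forall>x. ((\<lambda>(i, \<nu>). h i \<nu> x) has_sum F x) UNIV)"
    if F: "piece d N 0 0 A F" for F :: "real^'n \<Rightarrow> complex" and A
  proof -
    have A: "0 \<le> A" using piece_nonneg[OF F] .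
    have FC: "Cbd N A 1 F" using F by (simp add: piece_def)
    let ?T = "local_interp N F"
    let ?ph = "\<lambda>i \<nu> x. complex_of_real (\<phi> (2 ^ i *\<^sub>R x - lattice_vec \<nu>))"
    have Fz: "F x = 0" if "\<bar>x $ a\<bar> > d" for x a
      using F that by (auto simp: piece_def mem_dil_cube) (metis not_less)
    have Tz: "?T i \<nu> x = 0" if a: "\<bar>of_int (\<nu> $ a)\<bar> > d * 2 ^ i + real N" for i \<nu> x a
    proof -
      have "F ((1 / 2 ^ i) *\<^sub>R (node g + lattice_vec \<nu>)) = 0" if g: "g \<in> ?G" for g
      proof (rule Fz)
        have "real (g a) \<le> real N" using g by (auto simp: grid_def PiE_def Pi_def less_imp_le)
        then have "\<bar>real (g a) + of_int (\<nu> $ a)\<bar> > d * 2 ^ i" using a by linarith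
        then have "\<bar>real (g a) + of_int (\<nu> $ a)\<bar> / 2 ^ i > d" by (simp add: pos_less_divide_eq)
        then show "\<bar>((1 / 2 ^ i) *\<^sub>R (node g + lattice_vec \<nu>)) $ a\<bar> > d"
          by (simp add: node_def lattice_vec_def abs_mult)
      qed
      then show ?thesis unfolding local_interp_def by (intro sum.neutral) auto
    qed
    define h where "h i \<nu> x = (case i of 0 \<Rightarrow> ?ph 0 \<nu> x * ?T 0 \<nu> x
      | Suc j \<Rightarrow> ?ph (Suc j) \<nu> x * (\<Sum>\<kappa>\<in>?V \<nu>. ?ph j \<kappa> x * (?T (Suc j) \<nu> x - ?T j \<kappa> x)))" for i \<nu> x
    have far: "h i \<nu> = (\<lambda>x. 0)" if nf: "\<not> (\<forall>a. \<bar>of_int (\<nu> $ a)\<bar> \<le> R * 2 ^ i)" for i \<nu>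
    proof -
      obtain a where a: "\<bar>of_int (\<nu> $ a)\<bar> > R * 2 ^ i" using nf unfolding not_all not_le by blast
      have R': "R * 2 ^ i \<ge> d * 2 ^ i + 2 * real N + 3"
      proof -
        have "(2 * real N + 3) * 1 \<le> (2 * real N + 3) * 2 ^ i" by (intro mult_left_mono) auto
        then show ?thesis by (simp add: R_def algebra_simps)
      qed
      have 1: "?T i \<nu> x = 0" for x by (rule Tz[of _ _ a]) (use a R' in linarith)
      show ?thesis
      proof (cases i)
        case (Suc j)
        have "?T j \<kappa> x = 0" if "\<kappa> \<in> ?V \<nu>" for \<kappa> x
        proof (rule Tz[of _ _ a])
          have "\<bar>of_int (\<nu> $ a) / 2 - real_of_int (\<kappa> $ a)\<bar> \<le> 3 / 2" using that by blast
          moreover have "\<bar>of_int (\<nu> $ a)\<bar> > 2 * (d * 2 ^ j) + 2 * real N + 3" using a R' unfolding Suc by simp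
          ultimately show "\<bar>of_int (\<kappa> $ a)\<bar> > d * 2 ^ j + real N" by linarith
        qed
        then show ?thesis using 1 by (auto simp: h_def Suc fun_eq_iff intro!: sum.neutral)
      qed (use 1 in \<open>auto simp: h_def fun_eq_iff\<close>)
    qed
    have Bg: "Cbd K B (2 ^ i) (\<lambda>x. complex_of_real (\<phi> (2 ^ i *\<^sub>R x - lattice_vec \<nu>) * tensor_lag N UNIV g (2 ^ i *\<^sub>R x - lattice_vec \<nu>)))"
      if "g \<in> ?G" for g i \<nu>
      using Cbd_of_real[OF Cbd_affine[OF _ _ B(2)[OF that], of "2 ^ i" "- lattice_vec \<nu>"]] by simp
    have near_piece: "piece d K i \<nu> (C * A * (1 / 2 ^ i) ^ N) (h i \<nu>)" for i \<nu>
    proof (cases i)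
      case 0
      have e: "h 0 \<nu> = (\<lambda>x. \<Sum>g\<in>?G. F (node g + lattice_vec \<nu>) *
          complex_of_real (\<phi> (2 ^ 0 *\<^sub>R x - lattice_vec \<nu>) * tensor_lag N UNIV g (2 ^ 0 *\<^sub>R x - lattice_vec \<nu>)))"
        by (simp add: h_def local_interp_def sum_distrib_left fun_eq_iff mult_ac)
      have "Cbd K (\<Sum>g\<in>?G. norm (F (node g + lattice_vec \<nu>)) * B) (2 ^ 0) (h 0 \<nu>)"
        unfolding e using Bg[of _ 0] by (intro Cbd_sum Cbd_cmult) auto
      moreover have "(\<Sum>g\<in>?G. norm (F (node g + lattice_vec \<nu>)) * B) \<le> C * A * (1 / 2 ^ 0) ^ N"
      proof -
        have "(\<Sum>g\<in>?G. norm (F (node g + lattice_vec \<nu>)) * B) \<le> real (card ?G) * (A * B)"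
          using B Cbd_norm_le[OF FC] by (intro sum_bounded_above mult_right_mono) auto
        also have "\<dots> = C1 * A" by (simp add: C1_def)
        also have "\<dots> \<le> C * A" using C12 A by (intro mult_right_mono) (auto simp: C_def)
        finally show ?thesis by simp
      qed
      ultimately have "Cbd K (C * A * (1 / 2 ^ 0) ^ N) (2 ^ 0) (h 0 \<nu>)" by (rule Cbd_mono) auto
      moreover have "h 0 \<nu> x = 0" if "x \<notin> dil_cube d 0 \<nu>" for x
        using cube_partition_piece[OF c0 \<phi> d, of 0 \<nu>] that by (simp add: h_def piece_def)
      ultimately show ?thesis unfolding 0 by (simp add: piece_def)
    next
      case (Suc j)
      let ?v = "\<lambda>g \<kappa>. ?T (Suc j) \<nu> ((1 / 2 ^ j) *\<^sub>R (node g + lattice_vec \<kappa>)) - F ((1 / 2 ^ j) *\<^sub>R (node g + lattice_vec \<kappa>))"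
      let ?b = "\<lambda>g \<kappa> x. complex_of_real (\<phi> (2 ^ j *\<^sub>R x - lattice_vec \<kappa>) * tensor_lag N UNIV g (2 ^ j *\<^sub>R x - lattice_vec \<kappa>))"
      have e: "h (Suc j) \<nu> = (\<lambda>x. (\<Sum>\<kappa>\<in>?V \<nu>. \<Sum>g\<in>?G. ?v g \<kappa> * ?b g \<kappa> x) * ?ph (Suc j) \<nu> x)"
        by (simp add: h_def local_interp_diff sum_distrib_left fun_eq_iff mult_ac)
      have v: "norm (?v g \<kappa>) \<le> E * (A * (1 / 2 ^ Suc j) ^ N)" if g: "g \<in> ?G" and \<kappa>: "\<kappa> \<in> ?V \<nu>" for g \<kappa>
        unfolding norm_minus_commute[of "?T (Suc j) \<nu> _"]
      proof (rule E(2)[OF FC])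
        fix a
        have 1: "real (g a) \<le> real N" using g by (auto simp: grid_def PiE_def Pi_def less_imp_le)
        have 2: "\<bar>of_int (\<nu> $ a) / 2 - real_of_int (\<kappa> $ a)\<bar> \<le> 3 / 2" using \<kappa> by blast
        have e: "2 ^ Suc j * ((1 / 2 ^ j) *\<^sub>R (node g + lattice_vec \<kappa>)) $ a = 2 * (real (g a) + of_int (\<kappa> $ a))"
          by (simp add: node_def lattice_vec_def)
        show "\<bar>2 ^ Suc j * ((1 / 2 ^ j) *\<^sub>R (node g + lattice_vec \<kappa>)) $ a - of_int (\<nu> $ a)\<bar> \<le> R0"
          unfolding R0_def e using 1 2 of_nat_0_le_iff[of "g a", where 'a = real] by argo
      qed
      have 1: "Cbd K (\<Sum>\<kappa>\<in>?V \<nu>. \<Sum>g\<in>?G. norm (?v g \<kappa>) * B) (2 ^ j) (\<lambda>x. \<Sum>\<kappa>\<in>?V \<nu>. \<Sum>g\<in>?G. ?v g \<kappa> * ?b g \<kappa> x)"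
        using V(1) Bg by (intro Cbd_sum Cbd_cmult) auto
      have "piece d K (Suc j) \<nu> (2 ^ K * ((\<Sum>\<kappa>\<in>?V \<nu>. \<Sum>g\<in>?G. norm (?v g \<kappa>) * B) * c0)) (h (Suc j) \<nu>)"
        unfolding e by (rule piece_mult[OF 1 _ _ cube_partition_piece[OF c0 \<phi> d]]) auto
      moreover have "2 ^ K * ((\<Sum>\<kappa>\<in>?V \<nu>. \<Sum>g\<in>?G. norm (?v g \<kappa>) * B) * c0) \<le> C * A * (1 / 2 ^ Suc j) ^ N"
      proof -
        let ?q = "E * (A * (1 / 2 ^ Suc j) ^ N) * B"
        have q0: "0 \<le> ?q" using E A B by simp
        have "(\<Sum>\<kappa>\<in>?V \<nu>. \<Sum>g\<in>?G. norm (?v g \<kappa>) * B) \<le> (\<Sum>\<kappa>\<in>?V \<nu>. real (card ?G) * ?q)"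
          using v B by (intro sum_mono sum_bounded_above mult_right_mono) auto
        also have "\<dots> \<le> real (cube_count CARD('n) (3 / 2)) * (real (card ?G) * ?q)"
          using V(2)[of \<nu>] q0 by (simp only: sum_constant) (intro mult_right_mono, auto)
        finally have "2 ^ K * ((\<Sum>\<kappa>\<in>?V \<nu>. \<Sum>g\<in>?G. norm (?v g \<kappa>) * B) * c0)
            \<le> 2 ^ K * ((real (cube_count CARD('n) (3 / 2)) * (real (card ?G) * ?q)) * c0)"
          using c00 by (intro mult_left_mono mult_right_mono) auto
        also have "\<dots> = C2 * (A * (1 / 2 ^ Suc j) ^ N)" by (simp add: C2_def mult_ac)
        also have "\<dots> \<le> C * (A * (1 / 2 ^ Suc j) ^ N)" using C12 A by (intro mult_right_mono) (auto simp: C_def)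
        finally show ?thesis by (simp add: mult.assoc)
      qed
      ultimately show ?thesis unfolding Suc by (rule piece_mono)
    qed
    have hp: "piece d K i \<nu> (smooth_size C R N A i \<nu>) (h i \<nu>)" for i \<nu>
      using near_piece[of i \<nu>] far[of \<nu> i] by (auto simp: smooth_size_def piece_zero)
    have "((\<lambda>(i, \<nu>). h i \<nu> x) has_sum F x) UNIV" for x
    proof -
      let ?Q = "\<lambda>i. {\<nu>. x \<in> dil_cube d i \<nu>}"
      define S where "S i = (\<Sum>\<nu>\<in>nbrs i x. ?ph i \<nu> x * ?T i \<nu> x)" for i
      have one: "(\<Sum>\<nu>\<in>nbrs i x. ?ph i \<nu> x) = 1" for i
        using cube_partition_scaled(2)[OF \<phi>, of i x] by (simp flip: of_real_sum)
      have nbQ: "nbrs i x \<subseteq> ?Q i" for i using d by (auto simp: nbrs_def mem_dil_cube intro: order_trans)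
      have phz: "?ph i \<nu> x = 0" if "\<nu> \<notin> nbrs i x" for i \<nu>
        using cube_partition_scaled(1)[OF \<phi>, of i x \<nu>] that by auto
      have lev0: "(\<Sum>\<nu>\<in>?Q 0. h 0 \<nu> x) = S 0"
        unfolding S_def by (rule sum.mono_neutral_cong_right[OF finite_cubes_at(1) nbQ]) (use phz[of _ 0] in \<open>auto simp: h_def\<close>)
      have levS: "(\<Sum>\<nu>\<in>?Q (Suc j). h (Suc j) \<nu> x) = S (Suc j) - S j" for j
      proof -
        have nb: "nbrs j x \<subseteq> ?V \<nu>" if "\<nu> \<in> nbrs (Suc j) x" for \<nu>
        proof
          fix \<kappa> assume \<kappa>: "\<kappa> \<in> nbrs j x"
          have "\<bar>of_int (\<nu> $ a) / 2 - real_of_int (\<kappa> $ a)\<bar> \<le> 3 / 2" for a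
          proof -
            have "\<bar>2 ^ j * x $ a - of_int (\<kappa> $ a)\<bar> \<le> 1" using \<kappa> by (simp add: nbrs_def)
            moreover have "\<bar>2 * (2 ^ j * x $ a) - of_int (\<nu> $ a)\<bar> \<le> 1" using that by (simp add: nbrs_def mult.assoc)
            ultimately show ?thesis by linarith
          qed
          then show "\<kappa> \<in> ?V \<nu>" by blast
        qed
        have "(\<Sum>\<nu>\<in>?Q (Suc j). h (Suc j) \<nu> x)
            = (\<Sum>\<nu>\<in>nbrs (Suc j) x. ?ph (Suc j) \<nu> x * (?T (Suc j) \<nu> x - S j))"
        proof (rule sum.mono_neutral_cong_right[OF finite_cubes_at(1) nbQ])
          show "\<forall>\<nu>\<in>?Q (Suc j) - nbrs (Suc j) x. h (Suc j) \<nu> x = 0" using phz[of _ "Suc j"] by (simp add: h_def)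
          fix \<nu> assume \<nu>: "\<nu> \<in> nbrs (Suc j) x"
          have "(\<Sum>\<kappa>\<in>?V \<nu>. ?ph j \<kappa> x * (?T (Suc j) \<nu> x - ?T j \<kappa> x)) = (\<Sum>\<kappa>\<in>nbrs j x. ?ph j \<kappa> x * (?T (Suc j) \<nu> x - ?T j \<kappa> x))"
            by (rule sum.mono_neutral_right[OF V(1) nb[OF \<nu>]]) (use phz in auto)
          also have "\<dots> = ?T (Suc j) \<nu> x - S j"
            by (simp add: right_diff_distrib sum_subtractf S_def sum_distrib_right[symmetric] one)
          finally show "h (Suc j) \<nu> x = ?ph (Suc j) \<nu> x * (?T (Suc j) \<nu> x - S j)" by (simp add: h_def)
        qed
        also have "\<dots> = S (Suc j) - S j"
          by (simp add: right_diff_distrib sum_subtractf S_def[of "Suc j"] sum_distrib_right[symmetric] one[of "Suc j", simplified])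
        finally show ?thesis .
      qed
      have part: "(\<Sum>i<Suc J. \<Sum>\<nu>\<in>?Q i. h i \<nu> x) = S J" for J
        by (induction J) (simp_all add: lev0 levS)
      let ?M = "real (cube_count CARD('n) 1)"
      have err: "norm (F x - S i) \<le> ?M * (c0 * (E * A)) * (1 / 2) ^ i" for i
      proof -
        have "F x - S i = (\<Sum>\<nu>\<in>nbrs i x. ?ph i \<nu> x * (F x - ?T i \<nu> x))"
          by (simp add: right_diff_distrib sum_subtractf S_def sum_distrib_right[symmetric] one)
        also have "norm \<dots> \<le> ?M * (c0 * (E * (A * (1 / 2 ^ i) ^ N)))"
        proof (rule norm_sum_bounded[OF finite_nbrs(2)])
          fix \<nu> assume \<nu>: "\<nu> \<in> nbrs i x"
          have "\<bar>\<phi> (2 ^ i *\<^sub>R x - lattice_vec \<nu>)\<bar> \<le> c0" using Cbd_norm_le[OF c0] by (simp add: real_norm_def[symmetric] del: real_norm_def)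
          moreover have "norm (F x - ?T i \<nu> x) \<le> E * (A * (1 / 2 ^ i) ^ N)"
          proof (rule E(2)[OF FC])
            have "1 \<le> R0" by (simp add: R0_def)
            then show "\<bar>2 ^ i * x $ a - of_int (\<nu> $ a)\<bar> \<le> R0" for a using \<nu> by (auto simp: nbrs_def intro: order_trans)
          qed
          ultimately show "norm (?ph i \<nu> x * (F x - ?T i \<nu> x)) \<le> c0 * (E * (A * (1 / 2 ^ i) ^ N))"
            unfolding norm_mult norm_of_real using c00 by (intro mult_mono) auto
        qed (use c00 E A in auto)
        also have "\<dots> \<le> ?M * (c0 * (E * (A * (1 / 2) ^ i)))"
        proof -
          have "((1::real) / 2 ^ i) ^ N \<le> (1 / 2 ^ i) ^ 1" using N by (intro power_decreasing) auto
          then show ?thesis using c00 E A by (intro mult_left_mono) (auto simp: power_one_over)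
        qed
        finally show ?thesis by (simp add: mult_ac)
      qed
      have "(\<lambda>i. ?M * (c0 * (E * A)) * (1 / 2) ^ i) \<longlonglongrightarrow> ?M * (c0 * (E * A)) * 0"
        by (intro tendsto_mult tendsto_const LIMSEQ_power_zero) simp
      then have "(\<lambda>i. F x - S i) \<longlonglongrightarrow> 0"
        unfolding mult_zero_right by (rule Lim_null_comparison[OF always_eventually, OF allI, OF err])
      then have "(\<lambda>i. F x - (F x - S i)) \<longlonglongrightarrow> F x - 0" by (intro tendsto_diff tendsto_const)
      then have "(\<lambda>J. \<Sum>i<Suc J. \<Sum>\<nu>\<in>?Q i. h i \<nu> x) \<longlonglongrightarrow> F x" unfolding part by simp
      then have sums: "(\<lambda>i. \<Sum>\<nu>\<in>?Q i. h i \<nu> x) sums F x"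
        unfolding sums_def by (rule LIMSEQ_imp_Suc)
      have fin: "(\<Sum>i. level_sum d i (smooth_size C R N A i) x) < \<infinity>"
      proof -
        let ?D = "real (cube_count CARD('n) d) * (C * A)"
        have D0: "0 \<le> ?D" using C12 A by (simp add: C_def)
        have le: "level_sum d i (smooth_size C R N A i) x \<le> ennreal (2 powr - (real i * 1)) * ennreal ?D" for i
        proof -
          have ss: "0 \<le> smooth_size C R N A i \<nu>" for \<nu> using C12 A by (simp add: smooth_size_def C_def)
          have "level_sum d i (smooth_size C R N A i) x = ennreal (\<Sum>\<nu>\<in>?Q i. smooth_size C R N A i \<nu>)"
            unfolding level_sum_def by (rule sum_ennreal) (rule ss)
          also have "\<dots> \<le> ennreal (real (cube_count CARD('n) d) * (C * A * (1 / 2 ^ i) ^ N))"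
          proof (rule ennreal_leI)
            have "(\<Sum>\<nu>\<in>?Q i. smooth_size C R N A i \<nu>) \<le> real (card (?Q i)) * (C * A * (1 / 2 ^ i) ^ N)"
              using C12 A by (intro sum_bounded_above) (auto simp: smooth_size_def C_def)
            also have "\<dots> \<le> real (cube_count CARD('n) d) * (C * A * (1 / 2 ^ i) ^ N)"
              using finite_cubes_at(2)[of x d i] C12 A by (intro mult_right_mono) (auto simp: C_def)
            finally show "(\<Sum>\<nu>\<in>?Q i. smooth_size C R N A i \<nu>) \<le> real (cube_count CARD('n) d) * (C * A * (1 / 2 ^ i) ^ N)" .
          qed
          also have "\<dots> \<le> ennreal (?D * (1 / 2 ^ i) ^ 1)"
          proof (rule ennreal_leI)
            have "((1::real) / 2 ^ i) ^ N \<le> (1 / 2 ^ i) ^ 1" using N by (intro power_decreasing) auto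
            then show "real (cube_count CARD('n) d) * (C * A * (1 / 2 ^ i) ^ N) \<le> ?D * (1 / 2 ^ i) ^ 1"
              using D0 by (simp only: mult.assoc[symmetric]) (intro mult_left_mono, auto)
          qed
          also have "?D * (1 / 2 ^ i) ^ 1 = 2 powr - (real i * 1) * ?D"
            by (simp add: powr_minus powr_realpow divide_inverse mult_ac)
          also have "ennreal \<dots> = ennreal (2 powr - (real i * 1)) * ennreal ?D" using D0 by (simp add: ennreal_mult)
          finally show ?thesis .
        qed
        have "(\<Sum>i. level_sum d i (smooth_size C R N A i) x) \<le> ennreal (1 / (1 - 2 powr - 1)) * ennreal ?D"
          using suminf_geometric_le[of 1 "\<lambda>i. level_sum d i (smooth_size C R N A i) x" "ennreal ?D"] le by simp
        then show ?thesis by (rule le_less_trans) (simp add: ennreal_mult_less_top)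
      qed
      show ?thesis unfolding pieces_has_sum_iff(1)[OF hp fin] by (rule sums)
    qed
    then show ?thesis using hp by (intro exI[of _ h]) blast
  qed
  moreover have "0 \<le> C" "0 \<le> R" using C12 d by (auto simp: C_def R_def)
  ultimately show ?thesis using that by blast
qed

lemma Lp_qnorm_finite_support_le:
  fixes f :: "'a \<Rightarrow> real"
  assumes p: "0 < p" and M: "finite S" "real (card S) \<le> M" and f: "\<And>i. i \<in> S \<Longrightarrow> f i \<le> B" "\<And>i. i \<notin> S \<Longrightarrow> f i = 0" and B: "0 \<le> B" "0 \<le> M"
  shows "Lp_qnorm (count_space UNIV) p (\<lambda>i. ennreal (f i)) \<le> ennreal (M powr enn2real (1 / p) * B)"
proof (cases "p = \<infinity>")
  case True
  show ?thesis
  proof (cases "M = 0")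
    case False
    have "f i \<le> B" for i using f B by (cases "i \<in> S") auto
    then show ?thesis unfolding True using False B by (intro Lp_qnorm_top_le AE_I2) (auto intro: ennreal_leI)
  next
    case True
    then have "S = {}" using M by simp
    then show ?thesis using f(2) p by simp
  qed
next
  case False
  define P where "P = enn2real p"
  have P: "0 < P" using enn2real_pos[OF p False] by (simp add: P_def)
  have "(\<integral>\<^sup>+i. ennreal_pow (ennreal (f i)) P \<partial>count_space UNIV) = (\<Sum>i\<in>S. ennreal_pow (ennreal (f i)) P)"
    by (rule nn_integral_count_space'[OF M(1)]) (use f(2) in auto)
  also have "\<dots> \<le> (\<Sum>i\<in>S. ennreal (B powr P))"
  proof (rule sum_mono)
    fix i assume "i \<in> S"
    then have "ennreal_pow (ennreal (f i)) P \<le> ennreal_pow (ennreal B) P"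
      using P f(1) by (intro ennreal_pow_mono ennreal_leI) auto
    then show "ennreal_pow (ennreal (f i)) P \<le> ennreal (B powr P)" using B by (simp add: ennreal_pow_ennreal)
  qed
  also have "\<dots> = ennreal (real (card S) * B powr P)"
    by (simp add: ennreal_of_nat_eq_real_of_nat ennreal_mult)
  also have "\<dots> \<le> ennreal (M * B powr P)" using M by (intro ennreal_leI mult_right_mono) auto
  also have "M * B powr P = (M powr enn2real (1 / p) * B) powr P"
    using B P by (simp add: enn2real_inverse P_def[symmetric] powr_mult powr_powr)
  also have "ennreal \<dots> = ennreal_pow (ennreal (M powr enn2real (1 / p) * B)) P"
    using B by (simp add: ennreal_pow_ennreal)
  finally show ?thesis unfolding Lp_qnorm_le_iff[OF p False] P_def .
qed

lemma cube_count_scaled: "0 \<le> R \<Longrightarrow> real (cube_count n (R * 2 ^ i)) \<le> (2 * R + 1) ^ n * 2 powr (real i * real n)"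
proof -
  assume R: "0 \<le> R"
  have "real (nat \<lfloor>2 * (R * 2 ^ i)\<rfloor> + 1) \<le> 2 * (R * 2 ^ i) + 1"
  proof -
    have "0 \<le> 2 * (R * 2 ^ i)" using R by simp
    then show ?thesis by linarith
  qed
  also have "\<dots> \<le> (2 * R + 1) * 2 ^ i" by (simp add: algebra_simps)
  finally have "real (nat \<lfloor>2 * (R * 2 ^ i)\<rfloor> + 1) ^ n \<le> ((2 * R + 1) * 2 ^ i) ^ n"
    by (rule power_mono) simp
  also have "\<dots> = (2 * R + 1) ^ n * 2 powr (real i * real n)"
    by (simp add: power_mult_distrib powr_realpow[symmetric] powr_powr flip: power_mult)
  finally show ?thesis by (simp add: cube_count_def)
qed

text \<open>Atoms of any order above \<open>s\<close> generate the same space: an atom of class \<open>C\<^sup>N\<close> is itself a series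
  of smoother atoms, and as a decomposition this series has smoothness \<open>N > s\<close>.\<close>

lemma decomp_change_order:
  fixes \<phi> :: "real^'n \<Rightarrow> real"
  assumes \<phi>: "cube_partition \<phi>" and d: "1 \<le> d" and p: "0 < p" and q: "0 < q" and s: "0 < s" "s < real N"
  shows "\<exists>C\<ge>0. \<forall>(f :: real^'n \<Rightarrow> complex) u. decomp d N f u \<longrightarrow> bn s p q u < \<infinity> \<longrightarrow>
    (\<exists>U. decomp d K f U \<and> bn s p q U \<le> ennreal C * bn s p q u)"
proof -
  have N: "1 \<le> N" using s by (cases N) auto
  obtain C R where C: "0 \<le> C" and R: "0 \<le> R" and sm: "\<And>(F :: real^'n \<Rightarrow> complex) A. piece d N 0 0 A F \<Longrightarrow>
      \<exists>h. (\<forall>i \<nu>. piece d K i \<nu> (smooth_size C R N A i \<nu>) (h i \<nu>)) \<and> (\<forall>x. ((\<lambda>(i, \<nu>). h i \<nu> x) has_sum F x) UNIV)"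
    using smooth_pieces_exist[OF \<phi> d N, of K] by blast
  define e where "e = real CARD('n) * enn2real (1 / p)"
  define D where "D = ((2 * R + 1) ^ CARD('n)) powr enn2real (1 / p) * C"
  have D: "0 \<le> D" using C by (simp add: D_def)
  have "\<exists>U. decomp d K f U \<and> bn s p q U \<le> ennreal (synth_const CARD('n) R p q ((real N - s) / 2) * D) * bn s p q u"
    if dec: "decomp d N f u" and fin: "bn s p q u < \<infinity>" for f :: "real^'n \<Rightarrow> complex" and u
  proof -
    obtain g where g: "\<And>k \<mu>. piece d N k \<mu> (u k \<mu>) (g k \<mu>)"
      and gS: "AE x in lebesgue. ((\<lambda>(k, \<mu>). g k \<mu> x) has_sum f x) UNIV"
      using dec unfolding decomp_def by blast
    have u0: "0 \<le> u k \<mu>" for k \<mu> using piece_nonneg[OF g] .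
    define F where "F k \<mu> y = g k \<mu> ((1 / 2 ^ k) *\<^sub>R (y + lattice_vec \<mu>))" for k \<mu> y
    have F: "piece d N 0 0 (u k \<mu>) (F k \<mu>)" for k \<mu>
    proof -
      have "piece d N 0 \<mu> (u k \<mu>) (\<lambda>x. g k \<mu> ((1 / 2 ^ k) *\<^sub>R x))"
        using piece_dilate_inverse[of d N 0 k \<mu> "u k \<mu>" "g k \<mu>"] g[of k \<mu>] by simp
      from piece_dilate[OF this, of 0 \<mu>] show ?thesis by (simp add: F_def[abs_def] zero_vec_def)
    qed
    define Q where "Q k \<mu> h \<longleftrightarrow> (\<forall>i \<nu>. piece d K i \<nu> (smooth_size C R N (u k \<mu>) i \<nu>) (h i \<nu>)) \<and>
      (\<forall>x. ((\<lambda>(i, \<nu>). h i \<nu> x) has_sum F k \<mu> x) UNIV)" for k \<mu> h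
    have "\<exists>h. Q k \<mu> h" for k \<mu> unfolding Q_def by (rule sm[OF F])
    then have Q: "Q k \<mu> (SOME h. Q k \<mu> h)" for k \<mu> by (rule someI_ex)
    define H where "H k \<mu> = (SOME h. Q k \<mu> h)" for k \<mu>
    have H: "piece d K i \<nu> (smooth_size C R N (u k \<mu>) i \<nu>) (H k \<mu> i \<nu>)"
      "((\<lambda>(i, \<nu>). H k \<mu> i \<nu> x) has_sum F k \<mu> x) UNIV" for k \<mu> i \<nu> x
      using Q[of k \<mu>] unfolding Q_def H_def by blast+
    let ?sh = "\<lambda>k \<mu> L \<nu>. (\<chi> a. \<nu> $ a - 2 ^ (L - k) * \<mu> $ a) :: int^'n"
    define v where "v k \<mu> L \<nu> = (if k \<le> L then smooth_size C R N (u k \<mu>) (L - k) (?sh k \<mu> L \<nu>) else 0)" for k \<mu> L \<nu>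
    define h where "h k \<mu> L \<nu> x = (if k \<le> L then H k \<mu> (L - k) (?sh k \<mu> L \<nu>) (2 ^ k *\<^sub>R x + lattice_vec (- \<mu>)) else 0)" for k \<mu> L \<nu> x
    have v0: "0 \<le> v k \<mu> L \<nu>" for k \<mu> L \<nu> using C u0 by (simp add: v_def smooth_size_def)
    have h: "piece d K L \<nu> (v k \<mu> L \<nu>) (h k \<mu> L \<nu>)" for k \<mu> L \<nu>
    proof (cases "k \<le> L")
      case True
      have "piece d K (L - k + k) (\<chi> a. ?sh k \<mu> L \<nu> $ a - 2 ^ (L - k) * (- \<mu>) $ a) (smooth_size C R N (u k \<mu>) (L - k) (?sh k \<mu> L \<nu>))
          (\<lambda>x. H k \<mu> (L - k) (?sh k \<mu> L \<nu>) (2 ^ k *\<^sub>R x + lattice_vec (- \<mu>)))"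
        by (rule piece_dilate[OF H(1)])
      moreover have "(\<chi> a. ?sh k \<mu> L \<nu> $ a - 2 ^ (L - k) * (- \<mu>) $ a) = \<nu>" by (simp add: vec_eq_iff)
      ultimately show ?thesis using True by (simp add: v_def h_def[abs_def])
    qed (simp add: v_def h_def[abs_def] piece_zero)
    have nr: "k \<le> L \<and> \<mu> \<in> near R k L \<nu>" if "v k \<mu> L \<nu> \<noteq> 0" for k \<mu> L \<nu>
    proof -
      have k: "k \<le> L" and n: "\<And>a. \<bar>of_int (?sh k \<mu> L \<nu> $ a)\<bar> \<le> R * 2 ^ (L - k)"
        using that by (auto simp: v_def smooth_size_def split: if_splits)
      have "\<bar>of_int (\<nu> $ a) / 2 ^ (L - k) - of_int (\<mu> $ a)\<bar> \<le> R" for a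
      proof -
        have "of_int (\<nu> $ a) / 2 ^ (L - k) - of_int (\<mu> $ a) = of_int (?sh k \<mu> L \<nu> $ a) / (2 ^ (L - k) :: real)"
          by (simp add: field_simps)
        then show ?thesis using n[of a] by (simp add: pos_divide_le_eq)
      qed
      then show ?thesis using k by (simp add: near_def)
    qed
    have hS: "((\<lambda>(L, \<nu>). h k \<mu> L \<nu> x) has_sum g k \<mu> x) UNIV" for k \<mu> x
    proof -
      let ?y = "2 ^ k *\<^sub>R x + lattice_vec (- \<mu>)"
      have neg: "lattice_vec (- \<mu>) = - lattice_vec \<mu>" by (simp add: lattice_vec_def vec_eq_iff)
      have "F k \<mu> ?y = g k \<mu> x" by (simp add: F_def neg)
      then have 1: "((\<lambda>(i, \<nu>). H k \<mu> i \<nu> ?y) has_sum g k \<mu> x) UNIV" using H(2)[of k \<mu> ?y] by simp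
      have "((\<lambda>(L, \<nu>). h k \<mu> L \<nu> x) has_sum g k \<mu> x) ({k..} \<times> UNIV) = ((\<lambda>(i, \<nu>). H k \<mu> i \<nu> ?y) has_sum g k \<mu> x) UNIV"
        by (rule has_sum_reindex_bij_witness[where i = "\<lambda>(i, \<nu>). (k + i, \<chi> a. \<nu> $ a + 2 ^ i * \<mu> $ a)"
              and j = "\<lambda>(L, \<nu>). (L - k, ?sh k \<mu> L \<nu>)"]) (auto simp: h_def vec_eq_iff)
      moreover have "((\<lambda>(L, \<nu>). h k \<mu> L \<nu> x) has_sum g k \<mu> x) ({k..} \<times> UNIV)
          = ((\<lambda>(L, \<nu>). h k \<mu> L \<nu> x) has_sum g k \<mu> x) UNIV"
        by (rule has_sum_cong_neutral) (auto simp: h_def split: if_splits)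
      ultimately show ?thesis using 1 by blast
    qed
    have le: "bn s p q (synth R v) \<le> ennreal (synth_const CARD('n) R p q ((real N - s) / 2) * D) * bn s p q u"
    proof (rule bn_synth_smoother[OF p q s(2) D _ v0])
      fix k i and \<mu> :: "int^'n"
      let ?S = "{\<nu>. \<forall>a. \<bar>real_of_int (2 ^ i * \<mu> $ a) - of_int (\<nu> $ a)\<bar> \<le> R * 2 ^ i}"
      have S: "finite ?S" "card ?S \<le> cube_count CARD('n) (R * 2 ^ i)"
        using near_lattice_points[of "\<lambda>a. real_of_int (2 ^ i * \<mu> $ a)" "R * 2 ^ i"] by simp_all
      have cS: "real (card ?S) \<le> (2 * R + 1) ^ CARD('n) * 2 powr (real i * real CARD('n))"
        using S(2) cube_count_scaled[OF R, of "CARD('n)" i] by linarith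
      have "Lp_qnorm (count_space UNIV) p (\<lambda>\<nu>. ennreal (v k \<mu> (k + i) \<nu>))
          \<le> ennreal (((2 * R + 1) ^ CARD('n) * 2 powr (real i * real CARD('n))) powr enn2real (1 / p) * (C * u k \<mu> * (1 / 2 ^ i) ^ N))"
      proof (rule Lp_qnorm_finite_support_le[OF p S(1) cS])
        show "v k \<mu> (k + i) \<nu> \<le> C * u k \<mu> * (1 / 2 ^ i) ^ N" for \<nu>
          using C u0[of k \<mu>] by (simp add: v_def smooth_size_def)
        show "v k \<mu> (k + i) \<nu> = 0" if "\<nu> \<notin> ?S" for \<nu>
          using that by (auto simp: v_def smooth_size_def abs_minus_commute)
      qed (use C u0 R in auto)
      also have "((2 * R + 1) ^ CARD('n) * 2 powr (real i * real CARD('n))) powr enn2real (1 / p) * (C * u k \<mu> * (1 / 2 ^ i) ^ N)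
          = D * 2 powr - (real i * (real N - e)) * u k \<mu>"
      proof -
        have "(1 / 2 ^ i) ^ N = (2::real) powr - (real i * real N)"
        proof -
          have "(2::real) powr - (real i * real N) = 1 / 2 powr real (i * N)" by (simp add: powr_minus_divide)
          also have "\<dots> = 1 / 2 ^ (i * N)" by (subst powr_realpow) auto
          also have "\<dots> = (1 / 2 ^ i) ^ N" by (simp add: power_one_over power_mult)
          finally show ?thesis ..
        qed
        moreover have "(2 powr (real i * real CARD('n))) powr enn2real (1 / p) * 2 powr - (real i * real N) = 2 powr - (real i * (real N - e))"
          unfolding powr_powr powr_add[symmetric] by (rule arg_cong[where f = "\<lambda>z. 2 powr z"]) (simp add: e_def algebra_simps)
        ultimately show ?thesis using R by (simp add: powr_mult D_def)
      qed
      also have "ennreal \<dots> = ennreal (D * 2 powr - (real i * (real N - e))) * ennreal (u k \<mu>)"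
        using D u0 by (intro ennreal_mult) auto
      finally show "Lp_qnorm (count_space UNIV) p (\<lambda>\<nu>. ennreal (v k \<mu> (k + i) \<nu>))
          \<le> ennreal (D * 2 powr - (real i * (real N - real CARD('n) * enn2real (1 / p)))) * ennreal (u k \<mu>)"
        by (simp add: e_def)
    qed
    then have b: "bn s p q (synth R v) < \<infinity>" using fin by (auto simp: ennreal_mult_less_top intro: le_less_trans)
    have "decomp d K f (synth R v)"
      by (rule decomp_synth[OF p q _ s(1) b h nr _ gS]) (use d hS in auto)
    then show ?thesis using le by blast
  qed
  moreover have "0 \<le> synth_const CARD('n) R p q ((real N - s) / 2) * D"
    using D geo_const_pos[OF p, of "(real N - s) / 2"] geo_const_pos[OF q, of "(real N - s) / 2"] s by (simp add: synth_const_def)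
  ultimately show ?thesis
    by (intro exI[of _ "synth_const CARD('n) R p q ((real N - s) / 2) * D"] conjI allI impI)
qed

section \<open>Homogeneity for functions with small support\<close>

lemma diff_pow_Suc: "(diff_op E ^^ Suc K) f x = (diff_op E ^^ K) f (x + E) - (diff_op E ^^ K) f x"
  unfolding funpow.simps(2) comp_apply by (rule diff_op_def)

lemma diff_pow_cong:
  fixes f g :: "real^'n \<Rightarrow> complex"
  shows "(\<And>r. r \<le> K \<Longrightarrow> f (x + real r *\<^sub>R E) = g (x + real r *\<^sub>R E)) \<Longrightarrow> (diff_op E ^^ K) f x = (diff_op E ^^ K) g x"
proof (induction K arbitrary: x)
  case 0 then show ?case using 0[of 0] by simp
next
  case (Suc K)
  have "f (x + E + real r *\<^sub>R E) = g (x + E + real r *\<^sub>R E)" if "r \<le> K" for r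
    using Suc.prems[of "Suc r"] that by (simp add: algebra_simps)
  then have "(diff_op E ^^ K) f (x + E) = (diff_op E ^^ K) g (x + E)" by (rule Suc.IH)
  moreover have "(diff_op E ^^ K) f x = (diff_op E ^^ K) g x" by (rule Suc.IH) (use Suc.prems in auto)
  ultimately show ?case by (simp only: diff_pow_Suc)
qed

lemma diff_pow_add:
  fixes f g :: "real^'n \<Rightarrow> complex"
  shows "(diff_op E ^^ K) (\<lambda>x. f x + g x) x = (diff_op E ^^ K) f x + (diff_op E ^^ K) g x"
  by (induction K arbitrary: x) (simp_all add: diff_pow_Suc del: funpow.simps(2))

lemma diff_pow_sum:
  fixes f :: "'i \<Rightarrow> real^'n \<Rightarrow> complex"
  shows "(diff_op E ^^ K) (\<lambda>x. \<Sum>i\<in>I. f i x) x = (\<Sum>i\<in>I. (diff_op E ^^ K) (f i) x)"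
  by (induction K arbitrary: x) (simp_all add: diff_pow_Suc sum_subtractf del: funpow.simps(2))

text \<open>All shifted terms of the difference drop out, and the term without shift has the sign
  \<open>(-1)\<^sup>K\<close>.\<close>

lemma diff_pow_vanishing:
  fixes f :: "real^'n \<Rightarrow> complex"
  assumes "\<And>r. 1 \<le> r \<Longrightarrow> f (x + real r *\<^sub>R E) = 0"
  shows "(diff_op E ^^ K) f x = (-1) ^ K * f x"
proof -
  have "(diff_op E ^^ K) f x = (-1) ^ K * f x \<and> (\<forall>r\<ge>1. (diff_op E ^^ K) f (x + real r *\<^sub>R E) = 0)"
  proof (induction K)
    case (Suc K)
    have e: "x + real r *\<^sub>R E + E = x + real (Suc r) *\<^sub>R E" for r by (simp add: algebra_simps)
    have "(diff_op E ^^ K) f (x + E) = 0" using Suc.IH[THEN conjunct2, rule_format, of 1] by simp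
    moreover have "(diff_op E ^^ K) f (x + real r *\<^sub>R E + E) = 0" if "1 \<le> r" for r
      unfolding e using Suc.IH by (metis One_nat_def Suc_le_mono le0)
    ultimately show ?case using Suc.IH by (auto simp: diff_pow_Suc simp del: funpow.simps(2))
  qed (use assms in auto)
  then show ?thesis by blast
qed

lemma decomp_scale:
  assumes "decomp d K f u" shows "decomp d K (\<lambda>x. c * f x) (\<lambda>j m. norm c * u j m)"
proof -
  obtain a where a: "\<And>j m. piece d K j m (u j m) (a j m)" "AE x in lebesgue. ((\<lambda>(j, m). a j m x) has_sum f x) UNIV"
    using assms unfolding decomp_def by blast
  have "AE x in lebesgue. ((\<lambda>(j, m). c * a j m x) has_sum (c * f x)) UNIV"
    using a(2)
  proof eventually_elim
    case (elim x) then show ?case using has_sum_cmult_right[OF elim, of c] by (simp add: case_prod_unfold)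
  qed
  then show ?thesis unfolding decomp_def using piece_cmult[OF a(1)] by (intro exI[of _ "\<lambda>j m x. c * a j m x"]) auto
qed

lemma bn_add_le:
  assumes "0 < p" "0 < q" "\<And>j m. 0 \<le> u j m" "\<And>j m. 0 \<le> v j m" "bn s p q u \<le> B" "bn s p q v \<le> B"
  shows "bn s p q (\<lambda>j m. u j m + v j m) \<le> ennreal (sum_const p 2 * sum_const q 2) * B"
  using bn_sum_le[of p q "UNIV :: bool set" 2 "\<lambda>b. if b then u else v" s B] assms
  by (simp add: UNIV_bool add.commute)

lemma decomp_nonneg: "decomp d K f u \<Longrightarrow> 0 \<le> u j m"
  unfolding decomp_def using piece_nonneg by blast

lemma bn_shift_le:
  fixes u :: "nat \<Rightarrow> int^'n \<Rightarrow> real"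
  assumes "0 < p" shows "bn s p q (\<lambda>j m. u j (\<chi> i. m $ i + 2 ^ j * l $ i)) \<le> bn s p q u"
proof -
  have "inj (\<lambda>m::int^'n. (\<chi> i. m $ i + 2 ^ j * l $ i) :: int^'n)" for j by (rule injI) (simp add: vec_eq_iff)
  from Lp_qnorm_count_inj[OF this assms]
  have "lev s p (\<lambda>j m. u j (\<chi> i. m $ i + 2 ^ j * l $ i)) j \<le> lev s p u j" for j
    unfolding lev_def by (rule mult_left_mono) simp
  then show ?thesis unfolding bn_def by (rule Lp_qnorm_count_mono)
qed

text \<open>Dropping the first \<open>j\<close> levels and renumbering the rest is what dilation by \<open>2\<^bsup>-j\<^esup>\<close> does to the
  coefficients.\<close>

lemma bn_level_shift_le:
  fixes u :: "nat \<Rightarrow> int^'n \<Rightarrow> real"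
  assumes "0 < p" "0 < q"
  shows "bn s p q (\<lambda>i. u (i + j)) \<le> ennreal (2 powr - (real j * (s - real CARD('n) * enn2real (1 / p)))) * bn s p q u"
proof -
  let ?c = "2 powr - (real j * (s - real CARD('n) * enn2real (1 / p)))"
  have "lev s p (\<lambda>i. u (i + j)) i = ennreal ?c * lev s p u (i + j)" for i
  proof -
    have "2 powr (real i * (s - real CARD('n) * enn2real (1 / p))) = ?c * 2 powr (real (i + j) * (s - real CARD('n) * enn2real (1 / p)))"
      unfolding powr_add[symmetric] by (rule arg_cong[where f = "\<lambda>z. 2 powr z"]) (simp add: algebra_simps)
    then show ?thesis unfolding lev_def by (simp only: ennreal_mult powr_ge_zero mult.assoc)
  qed
  then have "bn s p q (\<lambda>i. u (i + j)) = Lp_qnorm (count_space UNIV) q (\<lambda>i. ennreal ?c * lev s p u (i + j))"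
    unfolding bn_def by (intro arg_cong[where f = "Lp_qnorm (count_space UNIV) q"] ext)
  also have "\<dots> \<le> ennreal ?c * Lp_qnorm (count_space UNIV) q (\<lambda>i. lev s p u (i + j))"
    by (rule Lp_qnorm_cmult[OF _ assms(2)]) simp
  also have "\<dots> \<le> ennreal ?c * bn s p q u"
    unfolding bn_def by (intro mult_left_mono Lp_qnorm_count_inj[of "\<lambda>i. i + j"] assms) auto
  finally show ?thesis .
qed

lemma bn_single_level_le:
  fixes M :: "(int^'n) set"
  assumes p: "0 < p" and q: "0 < q" and M: "finite M" "card M \<le> N" and A: "0 \<le> A"
  shows "bn s p q (\<lambda>i m. if i = j \<and> m \<in> M then A else 0)
    \<le> ennreal (real N powr enn2real (1 / p) * A * 2 powr (real j * (s - real CARD('n) * enn2real (1 / p))))"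
proof -
  let ?u = "\<lambda>i m. if i = j \<and> m \<in> M then A else 0"
  let ?X = "real N powr enn2real (1 / p) * A * 2 powr (real j * (s - real CARD('n) * enn2real (1 / p)))"
  have X: "0 \<le> ?X" using A by simp
  have "lev s p ?u i \<le> ennreal (if i = j then ?X else 0)" for i
  proof (cases "i = j")
    case True
    have "Lp_qnorm (count_space UNIV) p (\<lambda>m. ennreal (?u i m)) \<le> ennreal (real N powr enn2real (1 / p) * A)"
      by (rule Lp_qnorm_finite_support_le[OF p M(1)]) (use M A True in auto)
    then have "lev s p ?u i \<le> ennreal (2 powr (real i * (s - real CARD('n) * enn2real (1 / p)))) * ennreal (real N powr enn2real (1 / p) * A)"
      unfolding lev_def by (rule mult_left_mono) simp
    also have "\<dots> = ennreal ?X" using A True by (simp add: ennreal_mult[symmetric] mult_ac)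
    finally show ?thesis using True by simp
  next
    case False then show ?thesis using p by (simp add: lev_def)
  qed
  then have "bn s p q ?u \<le> Lp_qnorm (count_space UNIV) q (\<lambda>i. ennreal (if i = j then ?X else 0))"
    unfolding bn_def by (intro Lp_qnorm_count_mono)
  also have "\<dots> \<le> ennreal (1 powr enn2real (1 / q) * ?X)"
    by (rule Lp_qnorm_finite_support_le[OF q, of "{j}"]) (use X in auto)
  finally show ?thesis by simp
qed

lemma decomp_diff_pow:
  fixes f :: "real^'n \<Rightarrow> complex" and l :: "int^'n"
  assumes p: "0 < p" and q: "0 < q" and f: "decomp d K f u" "bn s p q u \<le> B"
  shows "\<exists>U. decomp d K ((diff_op (lattice_vec l) ^^ r) f) U \<and> bn s p q U \<le> ennreal ((sum_const p 2 * sum_const q 2) ^ r) * B"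
proof (induction r)
  case 0 show ?case using f by (intro exI[of _ u]) simp
next
  case (Suc r)
  then obtain U where U: "decomp d K ((diff_op (lattice_vec l) ^^ r) f) U"
    "bn s p q U \<le> ennreal ((sum_const p 2 * sum_const q 2) ^ r) * B" by blast
  let ?c = "sum_const p 2 * sum_const q 2" and ?F = "(diff_op (lattice_vec l) ^^ r) f"
  let ?V = "\<lambda>j m. U j (\<chi> i. m $ i + 2 ^ j * l $ i)"
  have V: "decomp d K (\<lambda>x. ?F (x + lattice_vec l) + (-1) * ?F x) (\<lambda>j m. ?V j m + norm (-1 :: complex) * U j m)"
    by (intro decomp_add decomp_shift decomp_scale U(1))
  have e: "(\<lambda>x. ?F (x + lattice_vec l) + (-1) * ?F x) = (diff_op (lattice_vec l) ^^ Suc r) f"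
    by (simp add: diff_op_def[abs_def])
  have "bn s p q (\<lambda>j m. ?V j m + U j m) \<le> ennreal ?c * (ennreal (?c ^ r) * B)"
    using decomp_nonneg[OF U(1)] order_trans[OF bn_shift_le[OF p] U(2)] U(2) by (intro bn_add_le p q)
  also have "\<dots> = ennreal (?c ^ Suc r) * B"
    using sum_const_pos[OF p, of 2] sum_const_pos[OF q, of 2] by (simp add: ennreal_mult mult.assoc)
  finally show ?case using V unfolding e by (intro exI[of _ "\<lambda>j m. ?V j m + norm (-1 :: complex) * U j m"]) simp
qed

text \<open>The atoms of levels \<open>k \<ge> j\<close> are compatible with the dilation by \<open>2\<^bsup>-j\<^esup>\<close>, but the coarser ones
  become arbitrarily flat, and their coefficients are too large to be used directly when
  \<open>s \<ge> n/p\<close>. The support of the dilated function \<open>h(2\<^bsup>-j\<^esup>\<cdot>)\<close> helps: it is compact, so for a fixed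
  large step the \<open>K\<close>-th difference is \<open>\<plusminus>h(2\<^bsup>-j\<^esup>\<cdot>)\<close> on the support. The \<open>K\<close>-th difference of an atom of
  level \<open>k < j\<close> has a small norm of order \<open>2\<^bsup>-(j-k)K\<^esup>\<close>, which is summable since \<open>K > s\<close>.\<close>

lemma small_support_homogeneity:
  fixes \<phi> :: "real^'n \<Rightarrow> real" and \<rho> :: real
  assumes \<phi>: "cube_partition \<phi>" and d: "1 \<le> d" and p: "0 < p" and q: "0 < q" and s: "0 < s" "s < real K" and \<rho>: "0 \<le> \<rho>"
  shows "\<exists>C\<ge>0. \<forall>(h :: real^'n \<Rightarrow> complex) u j l. decomp d K h u \<longrightarrow> bn s p q u < \<infinity> \<longrightarrow>
    (\<forall>x i. \<rho> < \<bar>2 ^ j * x $ i - of_int (l $ i)\<bar> \<longrightarrow> h x = 0) \<longrightarrow>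
    (\<exists>U. decomp d K (\<lambda>x. h ((1 / 2 ^ j) *\<^sub>R x)) U \<and>
      bn s p q U \<le> ennreal (C * 2 powr - (real j * (s - real CARD('n) * enn2real (1 / p)))) * bn s p q u)"
proof -
  define e where "e = real CARD('n) * enn2real (1 / p)"
  have e0: "0 \<le> e" by (simp add: e_def)
  obtain A where A: "Cbd K A 1 \<phi>" using \<phi> unfolding cube_partition_def by blast
  have A0: "0 \<le> A" using Cbd_nonneg[OF A] .
  \<comment> \<open>a step larger than the sum of the radii of the supports of the cut-off function and of the dilated function\<close>
  obtain H :: nat where H: "2 * \<rho> + 3 \<le> real H" using real_arch_simple by blast
  have H1: "1 \<le> real H" using H \<rho> by linarith
  define i0 :: 'n where "i0 = (SOME i. True)"
  define El :: "int^'n" where "El = (\<chi> i. if i = i0 then int H else 0)"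
  define E where "E = lattice_vec El"
  have E: "E = real H *\<^sub>R axis i0 1" by (simp add: E_def El_def lattice_vec_def vec_eq_iff axis_def)
  have Ei: "(x + real r *\<^sub>R E) $ i = x $ i + (if i = i0 then real r * real H else 0)" for x r i
    by (simp add: E axis_def)
  define N0 where "N0 = cube_count CARD('n) (\<rho> + 1)"
  \<comment> \<open>a neighbourhood of the support that contains all its shifts in a \<open>K\<close>-th difference\<close>
  define R1 where "R1 = d + \<rho> + 2 + real K * real H"
  define N1 where "N1 = cube_count CARD('n) R1"
  define G where "G = 1 / (1 - 2 powr - (real K - s))"
  have G: "0 < G" using two_powr_less_1[of "real K - s"] s by (simp add: G_def)
  define c where "c = sum_const p 2 * sum_const q 2"
  have c: "0 < c" using sum_const_pos[OF p] sum_const_pos[OF q] by (simp add: c_def)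
  define C1 where "C1 = real N0 powr enn2real (1 / p) * (2 ^ K * (((2 * real H) ^ K * (real N1 * G)) * A))"
  define C2 where "C2 = 2 ^ K * (real N0 * A) * c ^ K"
  have C12: "0 \<le> C1" "0 \<le> C2" using A0 G c by (simp_all add: C1_def C2_def)
  have main: "\<exists>U. decomp d K (\<lambda>x. h ((1 / 2 ^ j) *\<^sub>R x)) U \<and>
      bn s p q U \<le> ennreal (c * (C1 + C2) * 2 powr - (real j * (s - e))) * bn s p q u"
    if dec: "decomp d K h u" and fin: "bn s p q u < \<infinity>" and supp: "\<forall>x i. \<rho> < \<bar>2 ^ j * x $ i - of_int (l $ i)\<bar> \<longrightarrow> h x = 0"
    for h :: "real^'n \<Rightarrow> complex" and u j l
  proof -
    obtain g where g: "\<And>k \<mu>. piece d K k \<mu> (u k \<mu>) (g k \<mu>)"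
      and gS: "AE x in lebesgue. ((\<lambda>(k, \<mu>). g k \<mu> x) has_sum h x) UNIV"
      using dec unfolding decomp_def by blast
    have u0: "0 \<le> u k \<mu>" for k \<mu> using piece_nonneg[OF g] .
    obtain b where b: "bn s p q u = ennreal b" "0 \<le> b" using fin by (cases "bn s p q u") auto
    have ub: "u k \<mu> \<le> 2 powr - (real k * (s - e)) * b" for k \<mu>
    proof -
      have "ennreal (u k \<mu>) \<le> ennreal (2 powr - (real k * (s - e))) * bn s p q u"
        unfolding e_def by (rule order_trans[OF Lp_qnorm_point_le[OF p, of "\<lambda>\<mu>. ennreal (u k \<mu>)" \<mu>] level_norm_le[OF q, of p u k s]])
      also have "\<dots> = ennreal (2 powr - (real k * (s - e)) * b)" using b by (simp add: ennreal_mult)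
      finally show ?thesis using b by (simp add: ennreal_le_iff)
    qed
    define t where "t x = h ((1 / 2 ^ j) *\<^sub>R x)" for x
    have tz: "t x = 0" if "\<rho> < \<bar>x $ i - of_int (l $ i)\<bar>" for x i
      unfolding t_def by (rule supp[rule_format, of _ i]) (use that in simp)
    let ?G = "\<lambda>k \<mu> x. g k \<mu> ((1 / 2 ^ j) *\<^sub>R x)"
    define M where "M = {m::int^'n. \<forall>i. \<bar>real_of_int (l $ i) - of_int (m $ i)\<bar> \<le> \<rho> + 1}"
    have M: "finite M" "card M \<le> N0" unfolding M_def N0_def by (rule near_lattice_points)+
    let ?f = "\<lambda>m x. complex_of_real (\<phi> (x - lattice_vec m))"
    define w where "w x = (\<Sum>m\<in>M. ?f m x)" for x
    have fz: "\<bar>x $ i - of_int (m $ i)\<bar> \<le> 1" if "?f m x \<noteq> 0" for m x i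
      using \<phi> that unfolding cube_partition_def by (auto simp: lattice_vec_def)
    have w1: "w x = 1" if x: "\<And>i. \<bar>x $ i - of_int (l $ i)\<bar> \<le> \<rho>" for x
    proof -
      have "nbrs 0 x \<subseteq> M"
      proof
        fix m assume "m \<in> nbrs 0 x"
        then have m1: "\<bar>x $ i - of_int (m $ i)\<bar> \<le> 1" for i by (simp add: nbrs_def)
        have "\<bar>real_of_int (l $ i) - of_int (m $ i)\<bar> \<le> \<rho> + 1" for i using x[of i] m1[of i] by argo
        then show "m \<in> M" by (simp add: M_def)
      qed
      note sub = this
      have out: "?f m x = 0" if "m \<notin> nbrs 0 x" for m
        using cube_partition_scaled(1)[OF \<phi>, of 0 x m] that by auto
      have "w x = (\<Sum>m\<in>nbrs 0 x. ?f m x)"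
        unfolding w_def by (rule sum.mono_neutral_right[OF M(1) sub]) (use out in blast)
      then show ?thesis using cube_partition_scaled(2)[OF \<phi>, of 0 x] by (simp flip: of_real_sum)
    qed
    have wz: "\<bar>x $ i - of_int (l $ i)\<bar> \<le> \<rho> + 2" if wx: "w x \<noteq> 0" for x i
    proof -
      obtain m where m: "m \<in> M" "?f m x \<noteq> 0" using wx unfolding w_def by (meson sum.neutral)
      have "\<bar>real_of_int (l $ i) - of_int (m $ i)\<bar> \<le> \<rho> + 1" using m(1) by (simp add: M_def)
      then show ?thesis using fz[OF m(2), of i] by linarith
    qed
    \<comment> \<open>where the cut-off function does not vanish, all shifts leave the support\<close>
    have tw: "t x = (-1) ^ K * w x * (diff_op E ^^ K) t x" for x
    proof (cases "w x = 0")
      case True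
      then have "\<not> (\<forall>i. \<bar>x $ i - of_int (l $ i)\<bar> \<le> \<rho>)" using w1[of x] by auto
      then obtain i where "\<rho> < \<bar>x $ i - of_int (l $ i)\<bar>" unfolding not_all not_le by blast
      then show ?thesis using tz True by simp
    next
      case False
      have "t (x + real r *\<^sub>R E) = 0" if r: "1 \<le> r" for r
      proof (rule tz[of _ i0])
        have "1 * real H \<le> real r * real H" using r by (intro mult_right_mono) auto
        then show "\<rho> < \<bar>(x + real r *\<^sub>R E) $ i0 - of_int (l $ i0)\<bar>"
          using wz[OF False, of i0] H unfolding Ei by simp
      qed
      then have D: "(diff_op E ^^ K) t x = (-1) ^ K * t x" by (rule diff_pow_vanishing)
      have "t x = w x * t x"
      proof (cases "\<forall>i. \<bar>x $ i - of_int (l $ i)\<bar> \<le> \<rho>")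
        case True then show ?thesis using w1 by simp
      next
        case False
        then obtain i where "\<rho> < \<bar>x $ i - of_int (l $ i)\<bar>" unfolding not_all not_le by blast
        then show ?thesis using tz by simp
      qed
      moreover have "(-1 :: complex) ^ K * (-1) ^ K = 1" by (simp flip: power_mult_distrib)
      ultimately show ?thesis unfolding D by (metis (no_types, lifting) mult.assoc mult.commute mult_1)
    qed
    \<comment> \<open>the part of the coarse levels that is visible from the support of the cut-off function\<close>
    define P where "P x = (\<Sum>(k, \<mu>)\<in>(SIGMA k:{..<j}. near R1 k j l). ?G k \<mu> x)" for x
    define Q where "Q x = (\<Sum>\<^sub>\<infinity>(k, \<mu>)\<in>{j..} \<times> UNIV. ?G k \<mu> x)" for x
    have finS: "finite (SIGMA k:{..<j}. near R1 k j l)" by (intro finite_SigmaI near_finite) auto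
    have AEt: "AE x in lebesgue. ((\<lambda>(k, \<mu>). ?G k \<mu> x) has_sum t x) UNIV"
      using AE_affine[OF gS, of "1 / 2 ^ j" 0] by (simp add: t_def)
    have QS: "((\<lambda>(k, \<mu>). ?G k \<mu> x) has_sum Q x) ({j..} \<times> UNIV)" if "((\<lambda>(k, \<mu>). ?G k \<mu> x) has_sum t x) UNIV" for x
      unfolding Q_def using that has_sum_imp_summable summable_on_subset_banach by (intro has_sum_infsum) blast
    have Qdec: "decomp d K Q (\<lambda>i. u (i + j))"
      unfolding decomp_def
    proof (intro exI conjI allI)
      show "piece d K i \<nu> (u (i + j) \<nu>) (\<lambda>x. ?G (i + j) \<nu> x)" for i \<nu> by (rule piece_dilate_inverse[OF g])
      show "AE x in lebesgue. ((\<lambda>(i, \<nu>). ?G (i + j) \<nu> x) has_sum Q x) UNIV"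
        using AEt
      proof eventually_elim
        case (elim x)
        have "((\<lambda>(k, \<mu>). ?G k \<mu> x) has_sum Q x) ({j..} \<times> UNIV) = ((\<lambda>(i, \<nu>). ?G (i + j) \<nu> x) has_sum Q x) UNIV"
          by (rule has_sum_reindex_bij_witness[where i = "\<lambda>(i, \<nu>). (i + j, \<nu>)" and j = "\<lambda>(k, \<mu>). (k - j, \<mu>)"]) auto
        then show ?case using QS[OF elim] by blast
      qed
    qed
    have split: "t y = P y + Q y" if S: "((\<lambda>(k, \<mu>). ?G k \<mu> y) has_sum t y) UNIV"
      and y: "\<And>i. \<bar>y $ i - of_int (l $ i)\<bar> \<le> \<rho> + 2 + real K * real H" for y
    proof -
      have "?G k \<mu> y = 0" if k: "k < j" and \<mu>: "\<mu> \<notin> near R1 k j l" for k \<mu>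
      proof (rule ccontr)
        assume "?G k \<mu> y \<noteq> 0"
        then have cu: "(1 / 2 ^ j) *\<^sub>R y \<in> dil_cube d k \<mu>" using g[of k \<mu>] by (auto simp: piece_def)
        have "\<bar>of_int (l $ i) / 2 ^ (j - k) - of_int (\<mu> $ i)\<bar> \<le> R1" for i
        proof -
          have eq: "2 ^ k * ((1 / 2 ^ j) *\<^sub>R y) $ i = y $ i / 2 ^ (j - k)"
            using k by (simp add: power_diff)
          have 1: "\<bar>y $ i / 2 ^ (j - k) - of_int (\<mu> $ i)\<bar> \<le> d" using cu unfolding mem_dil_cube eq[symmetric] by blast
          have "\<bar>y $ i / 2 ^ (j - k) - of_int (l $ i) / 2 ^ (j - k)\<bar> = \<bar>y $ i - of_int (l $ i)\<bar> / 2 ^ (j - k)"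
            by (simp add: diff_divide_distrib[symmetric])
          also have "\<dots> \<le> (\<rho> + 2 + real K * real H) / 1" using y[of i] by (intro frac_le) auto
          finally have 2: "\<bar>y $ i / 2 ^ (j - k) - of_int (l $ i) / 2 ^ (j - k)\<bar> \<le> \<rho> + 2 + real K * real H" by simp
          have tri: "\<bar>b - m\<bar> \<le> d + B" if "\<bar>a - b\<bar> \<le> B" "\<bar>a - m\<bar> \<le> d" for a b m B :: real
            using that by linarith
          show ?thesis using tri[OF 2 1] by (simp only: R1_def add.assoc)
        qed
        then show False using \<mu> by (simp add: near_def)
      qed
      then have PS: "((\<lambda>(k, \<mu>). ?G k \<mu> y) has_sum P y) ({..<j} \<times> UNIV)"
        unfolding P_def by (intro has_sum_finite_neutralI[OF finS]) auto
      have "((\<lambda>(k, \<mu>). ?G k \<mu> y) has_sum (P y + Q y)) ({..<j} \<times> UNIV \<union> {j..} \<times> UNIV)"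
        by (intro has_sum_Un_disjoint PS QS S) auto
      moreover have "{..<j} \<times> UNIV \<union> {j..} \<times> UNIV = (UNIV :: (nat \<times> (int^'n)) set)" by auto
      ultimately show ?thesis using has_sum_unique[OF S] by simp
    qed
    have "AE x in lebesgue. \<forall>r. ((\<lambda>(k, \<mu>). ?G k \<mu> (1 *\<^sub>R x + real r *\<^sub>R E)) has_sum t (1 *\<^sub>R x + real r *\<^sub>R E)) UNIV"
      unfolding AE_all_countable by (intro allI AE_affine[OF AEt]) simp
    then have AE_t: "AE x in lebesgue. w x * ((-1) ^ K * (diff_op E ^^ K) P x) + ((-1) ^ K * w x) * (diff_op E ^^ K) Q x = t x"
    proof eventually_elim
      case (elim x)
      show ?case
      proof (cases "w x = 0")
        case False
        have "(diff_op E ^^ K) t x = (diff_op E ^^ K) (\<lambda>x. P x + Q x) x"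
        proof (rule diff_pow_cong)
          fix r assume r: "r \<le> K"
          show "t (x + real r *\<^sub>R E) = P (x + real r *\<^sub>R E) + Q (x + real r *\<^sub>R E)"
          proof (rule split)
            show "((\<lambda>(k, \<mu>). ?G k \<mu> (x + real r *\<^sub>R E)) has_sum t (x + real r *\<^sub>R E)) UNIV" using elim by simp
            fix i
            have "real r * real H \<le> real K * real H" using r by (intro mult_right_mono) auto
            then have "\<bar>if i = i0 then real r * real H else 0\<bar> \<le> real K * real H" by auto
            then show "\<bar>(x + real r *\<^sub>R E) $ i - of_int (l $ i)\<bar> \<le> \<rho> + 2 + real K * real H"
              unfolding Ei using wz[OF False, of i] by linarith
          qed
        qed
        then show ?thesis unfolding diff_pow_add tw[of x] by (simp add: algebra_simps)
      qed (use tw[of x] in simp)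
    qed
    \<comment> \<open>the differences of the dilated coarse atoms gain \<open>2\<^bsup>-(j-k)K\<^esup>\<close>, which outweighs the growth of their coefficients\<close>
    let ?s = "2 powr - (real j * (s - e))"
    let ?BP = "(2 * real H) ^ K * (real N1 * G) * (?s * b)"
    have DP: "Cbd K ?BP 1 ((diff_op E ^^ K) P)"
    proof -
      let ?\<tau> = "\<lambda>k. 2 ^ k * (1 / 2 ^ j) :: real"
      have Gp: "Cbd K ((2 * real H) ^ K * (u k \<mu> * ?\<tau> k ^ K)) 1 ((diff_op E ^^ K) (?G k \<mu>))" for k \<mu>
        unfolding E
      proof (rule Cbd_diff_pow[OF H1])
        have "Cbd K (u k \<mu>) (?\<tau> k) (\<lambda>x. g k \<mu> ((1 / 2 ^ j) *\<^sub>R x + 0))"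
          using g by (intro Cbd_affine) (auto simp: piece_def)
        then show "Cbd K (u k \<mu>) (?\<tau> k) (?G k \<mu>)" by simp
      qed simp
      let ?S = "SIGMA k:{..<j}. near R1 k j l"
      have eP: "(diff_op E ^^ K) P = (\<lambda>x. \<Sum>a\<in>?S. (diff_op E ^^ K) (?G (fst a) (snd a)) x)"
        unfolding P_def[abs_def] case_prod_unfold diff_pow_sum[symmetric] by (rule ext) simp
      have "Cbd K (\<Sum>a\<in>?S. (2 * real H) ^ K * (u (fst a) (snd a) * ?\<tau> (fst a) ^ K)) 1 ((diff_op E ^^ K) P)"
        unfolding eP by (intro Cbd_sum finS Gp) simp
      moreover have "(\<Sum>a\<in>?S. (2 * real H) ^ K * (u (fst a) (snd a) * ?\<tau> (fst a) ^ K)) \<le> ?BP"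
      proof -
        have term_le: "u k \<mu> * ?\<tau> k ^ K \<le> (?s * b) * (2 powr - (real K - s)) ^ (j - k)" if "k < j" for k \<mu>
        proof -
          have tk: "?\<tau> k ^ K = 2 powr - (real (j - k) * real K)"
          proof -
            have "?\<tau> k = 2 powr - real (j - k)"
              using that by (simp add: of_nat_diff powr_diff powr_realpow)
            then show ?thesis by (simp add: powr_realpow[symmetric] powr_powr)
          qed
          have "u k \<mu> * ?\<tau> k ^ K \<le> (2 powr - (real k * (s - e)) * b) * 2 powr - (real (j - k) * real K)"
            unfolding tk by (intro mult_right_mono ub) simp
          also have "\<dots> = (2 powr - (real k * (s - e)) * 2 powr - (real (j - k) * real K)) * b" by simp
          also have "2 powr - (real k * (s - e)) * 2 powr - (real (j - k) * real K) = ?s * 2 powr - (real (j - k) * (real K - s + e))"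
            unfolding powr_add[symmetric] using that
            by (intro arg_cong[where f = "\<lambda>z. 2 powr z"]) (simp add: of_nat_diff algebra_simps)
          \<comment> \<open>the additional decay \<open>e = n/p \<ge> 0\<close> is given away\<close>
          also have "(?s * 2 powr - (real (j - k) * (real K - s + e))) * b \<le> (?s * 2 powr - (real (j - k) * (real K - s))) * b"
            using e0 b(2) by (intro mult_right_mono mult_left_mono powr_mono) (auto intro: mult_left_mono)
          also have "2 powr - (real (j - k) * (real K - s)) = (2 powr - (real K - s)) ^ (j - k)"
          proof -
            have "- (real (j - k) * (real K - s)) = - (real K - s) * real (j - k)" by (simp add: algebra_simps)
            then have "2 powr - (real (j - k) * (real K - s)) = (2 powr - (real K - s)) powr real (j - k)"
              by (simp only: powr_powr)
            also have "\<dots> = (2 powr - (real K - s)) ^ (j - k)" by (rule powr_realpow) simp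
            finally show ?thesis .
          qed
          finally show ?thesis by (simp add: mult_ac)
        qed
        have "(\<Sum>a\<in>?S. (2 * real H) ^ K * (u (fst a) (snd a) * ?\<tau> (fst a) ^ K))
            = (2 * real H) ^ K * (\<Sum>k<j. \<Sum>\<mu>\<in>near R1 k j l. u k \<mu> * ?\<tau> k ^ K)"
          unfolding sum_distrib_left by (subst sum.Sigma) (auto simp: near_finite case_prod_unfold)
        also have "\<dots> \<le> (2 * real H) ^ K * (\<Sum>k<j. real N1 * ((?s * b) * (2 powr - (real K - s)) ^ (j - k)))"
        proof (intro mult_left_mono sum_mono)
          fix k assume k: "k \<in> {..<j}"
          have "(\<Sum>\<mu>\<in>near R1 k j l. u k \<mu> * ?\<tau> k ^ K) \<le> real (card (near R1 k j l)) * ((?s * b) * (2 powr - (real K - s)) ^ (j - k))"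
            using k by (intro sum_bounded_above term_le) auto
          also have "\<dots> \<le> real N1 * ((?s * b) * (2 powr - (real K - s)) ^ (j - k))"
            unfolding N1_def using near_finite(2)[of R1 k j l] b by (intro mult_right_mono) auto
          finally show "(\<Sum>\<mu>\<in>near R1 k j l. u k \<mu> * ?\<tau> k ^ K) \<le> real N1 * ((?s * b) * (2 powr - (real K - s)) ^ (j - k))" .
        qed simp
        also have "\<dots> = (2 * real H) ^ K * (real N1 * ((?s * b) * (\<Sum>k<j. (2 powr - (real K - s)) ^ (j - k))))"
          by (simp add: sum_distrib_left)
        also have "\<dots> \<le> (2 * real H) ^ K * (real N1 * ((?s * b) * G))"
        proof (intro mult_left_mono)
          let ?z = "2 powr - (real K - s)"
          have z: "0 \<le> ?z" "?z < 1" using two_powr_less_1[of "real K - s"] s by auto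
          have "(\<Sum>k<j. ?z ^ (j - k)) = (\<Sum>i=1..j. ?z ^ i)"
            by (rule sum.reindex_bij_witness[where i = "\<lambda>i. j - i" and j = "\<lambda>k. j - k"]) auto
          also have "\<dots> \<le> (\<Sum>i. ?z ^ i)"
            by (rule sum_le_suminf) (use z in \<open>auto intro: summable_geometric\<close>)
          also have "\<dots> = G" unfolding G_def by (rule suminf_geometric) (use z in auto)
          finally show "(\<Sum>k<j. ?z ^ (j - k)) \<le> G" .
        qed (use b in auto)
        finally show ?thesis by (simp add: mult_ac)
      qed
      ultimately show ?thesis by (rule Cbd_mono) auto
    qed
    have BP0: "0 \<le> ?BP" using Cbd_nonneg[OF DP] .
    have D0: "0 \<le> 2 ^ K * (?BP * A)" using mult_nonneg_nonneg[OF BP0 A0] by simp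
    let ?u1 = "\<lambda>i m. if i = 0 \<and> m \<in> M then 2 ^ K * (?BP * A) else 0"
    have dec1: "decomp d K (\<lambda>x. \<Sum>m\<in>M. ((-1) ^ K * (diff_op E ^^ K) P x) * ?f m x) ?u1"
    proof (rule decomp_single_level[OF M(1)])
      fix m
      have pm: "piece d K 0 m A (\<lambda>x. ?f m x)" using cube_partition_piece[OF A \<phi> d, of 0 m] by simp
      have "Cbd K ?BP 1 (\<lambda>x. (-1) ^ K * (diff_op E ^^ K) P x)"
        using Cbd_cmult[OF DP, of "(-1) ^ K"] by (simp add: norm_power)
      from piece_mult[OF this _ _ pm]
      show "piece d K 0 m (2 ^ K * (?BP * A)) (\<lambda>x. ((-1) ^ K * (diff_op E ^^ K) P x) * ?f m x)" by simp
    qed (use BP0 A0 in simp)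
    have bn1: "bn s p q ?u1 \<le> ennreal (C1 * ?s) * bn s p q u"
    proof -
      have "bn s p q ?u1 \<le> ennreal (real N0 powr enn2real (1 / p) * (2 ^ K * (?BP * A)) * 2 powr (real 0 * (s - e)))"
        by (rule bn_single_level_le[OF p q M D0, where s = s and j = 0, folded e_def])
      also have "real N0 powr enn2real (1 / p) * (2 ^ K * (?BP * A)) * 2 powr (real 0 * (s - e)) = (C1 * ?s) * b"
        by (simp add: C1_def mult_ac)
      also have "ennreal \<dots> = ennreal (C1 * ?s) * bn s p q u"
        unfolding b(1) using C12 b(2) by (intro ennreal_mult) auto
      finally show ?thesis .
    qed
    \<comment> \<open>on the fine levels the differences merely add shifted copies of atoms\<close>
    obtain V where V: "decomp d K ((diff_op E ^^ K) Q) V" "bn s p q V \<le> ennreal (c ^ K) * (ennreal ?s * bn s p q u)"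
      using decomp_diff_pow[OF p q Qdec bn_level_shift_le[OF p q, of s u j], where l = El and r = K]
      unfolding E_def c_def e_def by blast
    have "Cbd K (\<Sum>m\<in>M. A) 1 w"
      unfolding w_def[abs_def] using Cbd_translate[of 1 K A \<phi> "- lattice_vec m" for m] A M(1) by (intro Cbd_sum Cbd_of_real) auto
    then have "Cbd K (real N0 * A) 1 w"
      by (rule Cbd_mono) (use M(2) A0 in \<open>auto intro: mult_right_mono\<close>)
    from Cbd_cmult[OF this, of "(-1) ^ K"] have Wc: "Cbd K (real N0 * A) 1 (\<lambda>x. (-1) ^ K * w x)" by (simp add: norm_power)
    let ?u2 = "\<lambda>i m. 2 ^ K * (real N0 * A * V i m)"
    have dec2: "decomp d K (\<lambda>x. ((-1) ^ K * w x) * (diff_op E ^^ K) Q x) ?u2"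
      by (rule decomp_cmult[OF V(1) Wc])
    have bn2: "bn s p q ?u2 \<le> ennreal (C2 * ?s) * bn s p q u"
    proof -
      have "bn s p q (\<lambda>i m. (2 ^ K * (real N0 * A)) * V i m) \<le> ennreal (2 ^ K * (real N0 * A)) * bn s p q V"
        using A0 by (intro bn_cmult_le p q) auto
      also have "\<dots> \<le> ennreal (2 ^ K * (real N0 * A)) * (ennreal (c ^ K) * (ennreal ?s * bn s p q u))"
        by (intro mult_left_mono V(2)) simp
      also have "\<dots> = ennreal (C2 * ?s) * bn s p q u"
        using A0 c by (simp add: C2_def ennreal_mult mult.assoc)
      finally show ?thesis by (simp add: mult.assoc)
    qed
    have "decomp d K t (\<lambda>i m. ?u1 i m + ?u2 i m)"
    proof (rule decomp_cong_AE[OF decomp_add[OF dec1 dec2]])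
      show "AE x in lebesgue. (\<Sum>m\<in>M. ((-1) ^ K * (diff_op E ^^ K) P x) * ?f m x) + ((-1) ^ K * w x) * (diff_op E ^^ K) Q x = t x"
        using AE_t by eventually_elim (simp add: w_def sum_distrib_right sum_distrib_left mult_ac)
    qed
    moreover have "bn s p q (\<lambda>i m. ?u1 i m + ?u2 i m) \<le> ennreal c * (ennreal ((C1 + C2) * ?s) * bn s p q u)"
      unfolding c_def
    proof (rule bn_add_le[OF p q decomp_nonneg[OF dec1] decomp_nonneg[OF dec2]])
      show "bn s p q ?u1 \<le> ennreal ((C1 + C2) * ?s) * bn s p q u"
        by (rule order_trans[OF bn1]) (use C12 in \<open>auto intro!: mult_right_mono ennreal_leI\<close>)
      show "bn s p q ?u2 \<le> ennreal ((C1 + C2) * ?s) * bn s p q u"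
        by (rule order_trans[OF bn2]) (use C12 in \<open>auto intro!: mult_right_mono ennreal_leI\<close>)
    qed
    moreover have "ennreal c * (ennreal ((C1 + C2) * ?s) * bn s p q u) = ennreal (c * (C1 + C2) * ?s) * bn s p q u"
      using c C12 by (simp add: ennreal_mult mult.assoc)
    ultimately show ?thesis unfolding t_def[abs_def] by (intro exI[of _ "\<lambda>i m. ?u1 i m + ?u2 i m"]) simp
  qed
  have "0 \<le> c * (C1 + C2)" using c C12 by simp
  then show ?thesis using main unfolding e_def by (intro exI[of _ "c * (C1 + C2)"] conjI allI impI)
qed

section \<open>Multipliers and self-similar functions\<close>

text \<open>Estimates for arbitrary decompositions pass to the infimum.\<close>

lemma Besov_qnorm_transfer:
  assumes pos: "0 < p" "0 < q" "0 < d" "0 < s" and k: "0 < k"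
    and f': "f' \<in> borel_measurable lebesgue"
    and step: "\<And>u. decomp d K f u \<Longrightarrow> bn s p q u < \<infinity> \<Longrightarrow> \<exists>U. decomp d K' f' U \<and> bn s p q U \<le> ennreal k * bn s p q u"
  shows "Besov_qnorm d K' s p q f' \<le> ennreal k * Besov_qnorm d K s p q f"
proof -
  have inv: "ennreal (1 / k) * (ennreal k * z) = z" "ennreal k * (ennreal (1 / k) * z) = z" for z
    using k by (simp_all add: mult.assoc[symmetric] ennreal_mult[symmetric])
  have "ennreal (1 / k) * Besov_qnorm d K' s p q f' \<le> Besov_qnorm d K s p q f"
  proof (rule dense_ge)
    fix B assume "Besov_qnorm d K s p q f < B"
    then obtain u where u: "decomp d K f u" "bn s p q u < B" using Besov_qnorm_lessD[OF pos] by blast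
    have fin: "bn s p q u < \<infinity>" using u(2) by (metis infinity_ennreal_def less_le_trans top_greatest)
    obtain U where U: "decomp d K' f' U" "bn s p q U \<le> ennreal k * bn s p q u" using step[OF u(1) fin] by blast
    have "bn s p q U < \<infinity>" using U(2) fin by (auto simp: ennreal_mult_less_top intro: le_less_trans)
    then have "Besov_qnorm d K' s p q f' \<le> ennreal k * bn s p q u"
      using order_trans[OF Besov_qnorm_le_bn(1)[OF pos f' U(1)] U(2)] by blast
    from mult_left_mono[OF this, of "ennreal (1 / k)"] show "ennreal (1 / k) * Besov_qnorm d K' s p q f' \<le> B"
      unfolding inv using u(2) by (auto intro: order_trans less_imp_le)
  qed
  from mult_left_mono[OF this, of "ennreal k"] show ?thesis unfolding inv by simp
qed

lemma two_powr_minus_scaleR: "(2 powr (- real j)) *\<^sub>R x = (1 / 2 ^ j) *\<^sub>R x"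
  by (simp add: powr_minus powr_realpow divide_inverse)

lemma Lp_loc_measurable: "m \<in> Lp_loc p \<Longrightarrow> m \<in> borel_measurable lebesgue"
  by (simp add: Lp_loc_def)

lemma Cbd_measurable:
  assumes "Cbd K A t (f :: real^'n \<Rightarrow> complex)" shows "f \<in> borel_measurable lebesgue"
  using measurable_completion[of f lborel borel] borel_measurable_continuous_onI[of f] Cbd_continuous[OF assms] by auto

text \<open>Cut up by the partition of unity, \<open>\<psi>(2\<^sup>j\<cdot> - l)\<close> consists of boundedly many atoms of level \<open>j\<close>.\<close>

lemma resolution_fun_Besov:
  fixes \<psi> :: "real^'n \<Rightarrow> real"
  assumes \<psi>: "resolution_fun \<psi>" and d: "1 \<le> d" and p: "0 < p" and q: "0 < q" and s: "0 < s"
  obtains C where "0 < C" "\<And>j l. (\<lambda>x. complex_of_real (\<psi> (2 ^ j *\<^sub>R x - lattice_vec l))) \<in> Besov d K s p q"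
    "\<And>j l. Besov_qnorm d K s p q (\<lambda>x. complex_of_real (\<psi> (2 ^ j *\<^sub>R x - lattice_vec l)))
       \<le> ennreal (C * 2 powr (real j * (s - real CARD('n) * enn2real (1 / p))))"
proof -
  obtain \<phi> :: "real^'n \<Rightarrow> real" where \<phi>: "cube_partition \<phi>" using ex_cube_partition[OF \<psi>] by blast
  obtain A where A: "Cbd K A 1 \<phi>" using \<phi> unfolding cube_partition_def by blast
  obtain B where B: "Cbd K B 1 \<psi>" using resolution_fun_Cbd[OF \<psi>] .
  have AB: "0 \<le> A" "0 \<le> B" using Cbd_nonneg[OF A] Cbd_nonneg[OF B] by auto
  let ?\<rho> = "sqrt (real CARD('n))"
  define N where "N = cube_count CARD('n) (?\<rho> + 1)"
  let ?D = "2 ^ K * (B * A)"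
  define C where "C = real N powr enn2real (1 / p) * ?D + 1"
  have C: "0 < C" using AB by (simp add: C_def add_nonneg_pos)
  have d0: "0 < d" using d by simp
  note pos = p q d0 s
  have main: "f \<in> Besov d K s p q \<and> Besov_qnorm d K s p q f
      \<le> ennreal (C * 2 powr (real j * (s - real CARD('n) * enn2real (1 / p))))"
    if f: "f = (\<lambda>x. complex_of_real (\<psi> (2 ^ j *\<^sub>R x - lattice_vec l)))" for f j l
  proof -
    define M where "M = {m::int^'n. \<forall>i. \<bar>real_of_int (l $ i) - of_int (m $ i)\<bar> \<le> ?\<rho> + 1}"
    have M: "finite M" "card M \<le> N" unfolding M_def N_def by (rule near_lattice_points)+
    have fC: "Cbd K B (2 ^ j) f"
      unfolding f using Cbd_of_real[OF Cbd_affine[OF _ _ B, of "2 ^ j" "- lattice_vec l"]] by simp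
    let ?ph = "\<lambda>m x. complex_of_real (\<phi> (2 ^ j *\<^sub>R x - lattice_vec m))"
    have eq: "f x = (\<Sum>m\<in>M. f x * ?ph m x)" for x
    proof (cases "f x = 0")
      case False
      have "\<psi> (2 ^ j *\<^sub>R x - lattice_vec l) \<noteq> 0" using False by (simp add: f)
      from resolution_fun_supp[OF \<psi> this] have x: "\<bar>2 ^ j * x $ i - of_int (l $ i)\<bar> \<le> ?\<rho>" for i
        by (simp add: lattice_vec_def)
      have "nbrs j x \<subseteq> M"
      proof
        fix m assume "m \<in> nbrs j x"
        then have m: "\<bar>2 ^ j * x $ i - of_int (m $ i)\<bar> \<le> 1" for i by (simp add: nbrs_def)
        have "\<bar>real_of_int (l $ i) - of_int (m $ i)\<bar> \<le> ?\<rho> + 1" for i using x[of i] m[of i] by (simp only: abs_le_iff) linarith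
        then show "m \<in> M" by (simp add: M_def)
      qed
      then have "(\<Sum>m\<in>M. ?ph m x) = (\<Sum>m\<in>nbrs j x. ?ph m x)"
        using cube_partition_scaled(1)[OF \<phi>, of j x] by (intro sum.mono_neutral_right M) auto
      also have "\<dots> = 1" using cube_partition_scaled(2)[OF \<phi>, of j x] by (simp flip: of_real_sum)
      finally show ?thesis by (simp add: sum_distrib_left[symmetric])
    qed simp
    have "decomp d K (\<lambda>x. \<Sum>m\<in>M. f x * ?ph m x) (\<lambda>i m. if i = j \<and> m \<in> M then ?D else 0)"
      by (rule decomp_single_level[OF M(1)]) (use AB in \<open>auto intro: piece_mult[OF fC _ _ cube_partition_piece[OF A \<phi> d]]\<close>)
    then have dec: "decomp d K f (\<lambda>i m. if i = j \<and> m \<in> M then ?D else 0)" using eq by simp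
    have le: "bn s p q (\<lambda>i m. if i = j \<and> m \<in> M then ?D else 0)
        \<le> ennreal (C * 2 powr (real j * (s - real CARD('n) * enn2real (1 / p))))"
      by (rule order_trans[OF bn_single_level_le[OF p q M]]) (use AB in \<open>auto simp: C_def intro!: ennreal_leI mult_right_mono\<close>)
    have fin: "bn s p q (\<lambda>i m. if i = j \<and> m \<in> M then ?D else 0) < \<infinity>" using le by (rule le_less_trans) simp
    note L = Besov_qnorm_le_bn[OF pos Cbd_measurable[OF fC] dec fin]
    show ?thesis using L(2) order_trans[OF L(1) le] by blast
  qed
  show ?thesis by (rule that[OF C]) (use main in blast)+
qed

text \<open>The multiplier is tested on the functions \<open>\<psi>(2\<^sup>j\<cdot> - l)\<close>. The factor \<open>2\<^bsup>j(s-n/p)\<^esup>\<close> in their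
  quasi-norm is compensated by the dilation of the product back to unit scale.\<close>

lemma multiplier_bound_selfs:
  fixes \<psi> :: "real^'n \<Rightarrow> real"
  assumes \<psi>: "resolution_fun \<psi>" and d: "1 \<le> d" and p: "0 < p" and q: "0 < q" and s: "0 < s" "s < real K"
  obtains C where "0 < C" "\<And>m B. m \<in> multipliers d K s p q \<Longrightarrow>
    (\<And>f. f \<in> Besov d K s p q \<Longrightarrow> Besov_qnorm d K s p q (\<lambda>x. m x * f x) \<le> B * Besov_qnorm d K s p q f) \<Longrightarrow>
    selfs_qnorm \<psi> d K s p q m \<le> ennreal C * B"
proof -
  obtain \<phi> :: "real^'n \<Rightarrow> real" where \<phi>: "cube_partition \<phi>" using ex_cube_partition[OF \<psi>] by blast
  let ?\<rho> = "sqrt (real CARD('n))" and ?e = "real CARD('n) * enn2real (1 / p)"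
  have d0: "0 < d" using d by simp
  note pos = p q d0 s(1)
  obtain C1 where C1: "0 < C1" "\<And>j l. (\<lambda>x. complex_of_real (\<psi> (2 ^ j *\<^sub>R x - lattice_vec l))) \<in> Besov d K s p q"
    "\<And>j l. Besov_qnorm d K s p q (\<lambda>x. complex_of_real (\<psi> (2 ^ j *\<^sub>R x - lattice_vec l))) \<le> ennreal (C1 * 2 powr (real j * (s - ?e)))"
    using resolution_fun_Besov[OF \<psi> d p q s(1), of K] by blast
  obtain C2 where C2: "0 \<le> C2" "\<forall>(h :: real^'n \<Rightarrow> complex) u j l. decomp d K h u \<longrightarrow> bn s p q u < \<infinity> \<longrightarrow>
    (\<forall>x i. ?\<rho> < \<bar>2 ^ j * x $ i - of_int (l $ i)\<bar> \<longrightarrow> h x = 0) \<longrightarrow>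
    (\<exists>U. decomp d K (\<lambda>x. h ((1 / 2 ^ j) *\<^sub>R x)) U \<and> bn s p q U \<le> ennreal (C2 * 2 powr - (real j * (s - ?e))) * bn s p q u)"
    using small_support_homogeneity[OF \<phi> d p q s real_sqrt_ge_zero[OF of_nat_0_le_iff, of "CARD('n)"]] by blast
  define C where "C = (C2 + 1) * C1"
  have C: "0 < C" using C1 C2 by (simp add: C_def)
  have "selfs_qnorm \<psi> d K s p q m \<le> ennreal C * B"
    if m: "m \<in> multipliers d K s p q"
      and B: "\<And>f. f \<in> Besov d K s p q \<Longrightarrow> Besov_qnorm d K s p q (\<lambda>x. m x * f x) \<le> B * Besov_qnorm d K s p q f" for m B
    unfolding selfs_qnorm_def
  proof (rule SUP_least, clarify)
    fix j :: nat and l :: "int^'n"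
    have mm: "m \<in> borel_measurable lebesgue" using m by (auto simp: multipliers_def intro: Lp_loc_measurable)
    let ?f = "\<lambda>x. complex_of_real (\<psi> (2 ^ j *\<^sub>R x - lattice_vec l))"
    define h where "h x = m x * ?f x" for x
    have hz: "h x = 0" if "?\<rho> < \<bar>2 ^ j * x $ i - of_int (l $ i)\<bar>" for x i
      using resolution_fun_supp[OF \<psi>, of "2 ^ j *\<^sub>R x - lattice_vec l" i] that by (force simp: h_def lattice_vec_def)
    let ?t = "2 powr - (real j * (s - ?e))"
    have hm: "h \<in> borel_measurable lebesgue"
      unfolding h_def[abs_def] using mm Besov_measurable[OF C1(2)[of j l]] by (rule borel_measurable_times)
    have "Besov_qnorm d K s p q (\<lambda>x. h ((1 / 2 ^ j) *\<^sub>R x)) \<le> ennreal ((C2 + 1) * ?t) * Besov_qnorm d K s p q h"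
    proof (rule Besov_qnorm_transfer[OF pos])
      fix u assume u: "decomp d K h u" "bn s p q u < \<infinity>"
      obtain U where U: "decomp d K (\<lambda>x. h ((1 / 2 ^ j) *\<^sub>R x)) U" "bn s p q U \<le> ennreal (C2 * ?t) * bn s p q u"
        using C2(2)[rule_format, OF u, of j l] hz by blast
      have "ennreal (C2 * ?t) * bn s p q u \<le> ennreal ((C2 + 1) * ?t) * bn s p q u"
        by (intro mult_right_mono ennreal_leI) auto
      then show "\<exists>U. decomp d K (\<lambda>x. h ((1 / 2 ^ j) *\<^sub>R x)) U \<and> bn s p q U \<le> ennreal ((C2 + 1) * ?t) * bn s p q u"
        using U order_trans by blast
    qed (use C2(1) measurable_scale_lebesgue[OF hm] in auto)
    also have "\<dots> \<le> ennreal ((C2 + 1) * ?t) * (B * ennreal (C1 * 2 powr (real j * (s - ?e))))"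
    proof (rule mult_left_mono)
      have "Besov_qnorm d K s p q h \<le> B * Besov_qnorm d K s p q ?f" unfolding h_def[abs_def] by (rule B[OF C1(2)])
      also have "\<dots> \<le> B * ennreal (C1 * 2 powr (real j * (s - ?e)))" by (rule mult_left_mono[OF C1(3)]) simp
      finally show "Besov_qnorm d K s p q h \<le> B * ennreal (C1 * 2 powr (real j * (s - ?e)))" .
    qed simp
    also have "\<dots> = ennreal (((C2 + 1) * ?t) * (C1 * 2 powr (real j * (s - ?e)))) * B"
      using C1(1) C2(1) by (subst ennreal_mult) (auto simp: mult_ac)
    also have "((C2 + 1) * ?t) * (C1 * 2 powr (real j * (s - ?e))) = C * (?t * 2 powr (real j * (s - ?e)))"
      by (simp add: C_def)
    also have "?t * 2 powr (real j * (s - ?e)) = 1" unfolding powr_add[symmetric] by simp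
    also have "(\<lambda>x. h ((1 / 2 ^ j) *\<^sub>R x)) = (\<lambda>x. of_real (\<psi> (x - lattice_vec l)) * m (2 powr - real j *\<^sub>R x))"
      unfolding two_powr_minus_scaleR by (simp add: h_def fun_eq_iff)
    finally show "Besov_qnorm d K s p q (\<lambda>x. of_real (\<psi> (x - lattice_vec l)) * m (2 powr - real j *\<^sub>R x)) \<le> ennreal C * B"
      by simp
  qed
  then show ?thesis using that C by blast
qed

lemma le_mult_Inf:
  assumes k: "0 < k" and le: "\<And>B. B \<in> S \<Longrightarrow> x \<le> ennreal k * B"
  shows "x \<le> ennreal k * Inf S"
proof -
  have inv: "ennreal (1 / k) * (ennreal k * z) = z" "ennreal k * (ennreal (1 / k) * z) = z" for z
    using k by (simp_all add: mult.assoc[symmetric] ennreal_mult[symmetric])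
  have "ennreal (1 / k) * x \<le> Inf S"
  proof (rule Inf_greatest)
    fix B assume "B \<in> S"
    from mult_left_mono[OF le[OF this], of "ennreal (1 / k)"] show "ennreal (1 / k) * x \<le> B" unfolding inv by simp
  qed
  from mult_left_mono[OF this, of "ennreal k"] show ?thesis unfolding inv by simp
qed

lemma multipliers_embedded_selfs:
  fixes \<psi> :: "real^'n \<Rightarrow> real"
  assumes \<psi>: "resolution_fun \<psi>" and d: "1 \<le> d" and p: "0 < p" and q: "0 < q" and s: "0 < s" "s < real K"
  shows "cont_embedded (multipliers d K s p q) (multiplier_qnorm d K s p q) (selfs \<psi> d K s p q) (selfs_qnorm \<psi> d K s p q)"
proof -
  obtain C where C: "0 < C" "\<And>m B. m \<in> multipliers d K s p q \<Longrightarrow>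
    (\<And>f. f \<in> Besov d K s p q \<Longrightarrow> Besov_qnorm d K s p q (\<lambda>x. m x * f x) \<le> B * Besov_qnorm d K s p q f) \<Longrightarrow>
    selfs_qnorm \<psi> d K s p q m \<le> ennreal C * B"
    using multiplier_bound_selfs[OF assms] by blast
  have "m \<in> selfs \<psi> d K s p q" if m: "m \<in> multipliers d K s p q" for m
  proof -
    obtain B :: real where "\<And>f. f \<in> Besov d K s p q \<Longrightarrow> Besov_qnorm d K s p q (\<lambda>x. m x * f x) \<le> ennreal B * Besov_qnorm d K s p q f"
      using m unfolding multipliers_def by blast
    from C(2)[OF m this] have "selfs_qnorm \<psi> d K s p q m < \<infinity>"
      by (rule le_less_trans) (simp_all add: ennreal_mult_less_top)
    then show ?thesis using m by (simp add: selfs_def multipliers_def)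
  qed
  moreover have "selfs_qnorm \<psi> d K s p q m \<le> ennreal C * multiplier_qnorm d K s p q m" if m: "m \<in> multipliers d K s p q" for m
    unfolding multiplier_qnorm_def by (rule le_mult_Inf[OF C(1)]) (use C(2)[OF m] in blast)
  ultimately show ?thesis unfolding cont_embedded_def using C(1) by blast
qed

lemma selfs_decomp:
  assumes pos: "0 < p" "0 < q" "0 < d" "0 < s" and A: "selfs_qnorm \<psi> d K s p q m < ennreal A"
  shows "\<exists>w. decomp d K (\<lambda>x. of_real (\<psi> (x - lattice_vec l)) * m ((1 / 2 ^ k) *\<^sub>R x)) w \<and> bn s p q w \<le> ennreal A"
proof -
  have "Besov_qnorm d K s p q (\<lambda>x. of_real (\<psi> (x - lattice_vec l)) * m (2 powr - real k *\<^sub>R x)) \<le> selfs_qnorm \<psi> d K s p q m"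
    unfolding selfs_qnorm_def by (rule SUP_upper2[of "(k, l)"]) auto
  then have lt: "Besov_qnorm d K s p q (\<lambda>x. of_real (\<psi> (x - lattice_vec l)) * m ((1 / 2 ^ k) *\<^sub>R x)) < ennreal A"
    using A unfolding two_powr_minus_scaleR by (rule le_less_trans)
  show ?thesis by (rule Besov_qnorm_lessD[OF pos lt]) (intro exI conjI, assumption, rule less_imp_le)
qed

lemma multipliersI:
  assumes pos: "0 < p" "0 < q" "0 < d" "0 < s" and m: "m \<in> Lp_loc (min 1 p)" and C: "0 < C"
    and step: "\<And>f u. f \<in> borel_measurable lebesgue \<Longrightarrow> decomp d K f u \<Longrightarrow> bn s p q u < \<infinity> \<Longrightarrow>
      \<exists>U. decomp d K (\<lambda>x. m x * f x) U \<and> bn s p q U \<le> ennreal C * bn s p q u"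
  shows "m \<in> multipliers d K s p q" "multiplier_qnorm d K s p q m \<le> ennreal C"
proof -
  have main: "(\<lambda>x. m x * f x) \<in> Besov d K s p q \<and> Besov_qnorm d K s p q (\<lambda>x. m x * f x) \<le> ennreal C * Besov_qnorm d K s p q f"
    if f: "f \<in> Besov d K s p q" for f
  proof -
    have fm: "f \<in> borel_measurable lebesgue" by (rule Besov_measurable[OF f])
    have mf: "(\<lambda>x. m x * f x) \<in> borel_measurable lebesgue"
      using Lp_loc_measurable[OF m] fm by (rule borel_measurable_times)
    have le: "Besov_qnorm d K s p q (\<lambda>x. m x * f x) \<le> ennreal C * Besov_qnorm d K s p q f"
      by (rule Besov_qnorm_transfer[OF pos C mf]) (rule step[OF fm])
    have "Besov_qnorm d K s p q (\<lambda>x. m x * f x) < \<infinity>"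
      using Besov_qnorm_finite[OF f] by (intro le_less_trans[OF le]) (simp add: ennreal_mult_less_top)
    then have "(\<lambda>x. m x * f x) \<in> Besov d K s p q" using Besov_qnorm_lessD[OF pos] by blast
    then show ?thesis using le by blast
  qed
  show "m \<in> multipliers d K s p q" unfolding multipliers_def using m main by blast
  show "multiplier_qnorm d K s p q m \<le> ennreal C"
    unfolding multiplier_qnorm_def by (rule Inf_lower) (use main in blast)
qed

text \<open>The product of the atoms of \<open>f\<close> and of \<open>m\<close> has the lower one of the two orders, which still
  exceeds \<open>s\<close>; the order is raised again afterwards.\<close>

lemma selfs_smoother_multiplier:
  fixes \<psi> :: "real^'n \<Rightarrow> real"
  assumes \<psi>: "resolution_fun \<psi>" and d: "1 \<le> d" and p: "0 < p" and q: "0 < q"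
    and s: "0 < s" "s < \<sigma>" "s < real K" "s < real K'"
    and m: "m \<in> selfs \<psi> d K' \<sigma> p q"
  shows "m \<in> multipliers d K s p q"
proof -
  obtain \<phi> :: "real^'n \<Rightarrow> real" where \<phi>: "cube_partition \<phi>" using ex_cube_partition[OF \<psi>] by blast
  have d0: "0 < d" and \<sigma>: "0 < \<sigma>" using d s by auto
  let ?N = "min K' K"
  have N: "s < real ?N" using s(3,4) by simp
  obtain D where D: "0 \<le> D" "\<forall>(f :: real^'n \<Rightarrow> complex) u. decomp d ?N f u \<longrightarrow> bn s p q u < \<infinity> \<longrightarrow>
    (\<exists>U. decomp d K f U \<and> bn s p q U \<le> ennreal D * bn s p q u)"
    using decomp_change_order[OF \<phi> d p q s(1) N, of K] by blast
  obtain a where a: "0 \<le> a" "selfs_qnorm \<psi> d K' \<sigma> p q m = ennreal a"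
    using m unfolding selfs_def by (cases "selfs_qnorm \<psi> d K' \<sigma> p q m") auto
  have A: "selfs_qnorm \<psi> d K' \<sigma> p q m < ennreal (a + 1)" "0 \<le> a + 1" using a by (auto simp: ennreal_less_iff)
  define E where "E = synth_const CARD('n) (2 * d) p q ((\<sigma> - s) / 2) * (mult_const CARD('n) d ?N p q * (a + 1))"
  show ?thesis
  proof (rule multipliersI(1)[OF p q d0 s(1)])
    show "m \<in> Lp_loc (min 1 p)" using m by (simp add: selfs_def)
    show "0 < D * \<bar>E\<bar> + 1" using D by (simp add: add_nonneg_pos)
    fix f :: "real^'n \<Rightarrow> complex" and u assume f: "decomp d K f u" "bn s p q u < \<infinity>"
    obtain U where U: "decomp d ?N (\<lambda>x. m x * f x) U" "bn s p q U \<le> ennreal E * bn s p q u"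
      unfolding E_def using mult_decomp_smoother[OF \<psi> p q d0 s(1,2) A(2) selfs_decomp[OF p q d0 \<sigma> A(1)] f] by blast
    have "bn s p q U < \<infinity>" using U(2) f(2) by (auto simp: ennreal_mult_less_top intro: le_less_trans)
    from D(2)[rule_format, OF U(1) this] obtain W where W: "decomp d K (\<lambda>x. m x * f x) W" "bn s p q W \<le> ennreal D * bn s p q U" by blast
    note W(2)
    also have "ennreal D * bn s p q U \<le> ennreal D * (ennreal \<bar>E\<bar> * bn s p q u)"
      by (intro mult_left_mono order_trans[OF U(2)] mult_right_mono ennreal_leI) auto
    also have "\<dots> = ennreal (D * \<bar>E\<bar>) * bn s p q u" using D by (simp add: ennreal_mult mult.assoc)
    also have "\<dots> \<le> ennreal (D * \<bar>E\<bar> + 1) * bn s p q u" by (intro mult_right_mono ennreal_leI) auto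
    finally show "\<exists>U. decomp d K (\<lambda>x. m x * f x) U \<and> bn s p q U \<le> ennreal (D * \<bar>E\<bar> + 1) * bn s p q u"
      using W(1) by blast
  qed
qed

text \<open>For \<open>p \<le> 1\<close> the multiplier estimate holds with every constant above the self-similar
  quasi-norm, hence with the quasi-norm itself.\<close>

lemma selfs_embedded_multipliers:
  fixes \<psi> :: "real^'n \<Rightarrow> real"
  assumes \<psi>: "resolution_fun \<psi>" and d: "1 \<le> d" and p: "0 < p" "p \<le> 1" and s: "0 < s"
  shows "cont_embedded (selfs \<psi> d K s p p) (selfs_qnorm \<psi> d K s p p) (multipliers d K s p p) (multiplier_qnorm d K s p p)"
proof -
  have d0: "0 < d" using d by simp
  let ?c = "mult_const CARD('n) d K p p"
  define C where "C = ?c + 1"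
  have c0: "0 \<le> ?c" by (rule mult_const_nonneg[OF p(1) p(1)])
  have C: "0 < C" using c0 by (simp add: C_def)
  have main: "m \<in> multipliers d K s p p \<and> multiplier_qnorm d K s p p m \<le> ennreal (C * A)"
    if m: "m \<in> selfs \<psi> d K s p p" and A: "selfs_qnorm \<psi> d K s p p m < ennreal A" for m A
  proof -
    have A0: "0 < A" using A by (metis ennreal_neg leI not_less_zero)
    have "m \<in> Lp_loc (min 1 p)" using m by (simp add: selfs_def)
    note I = multipliersI[OF p(1) p(1) d0 s this, of "C * A" K]
    have step: "\<exists>U. decomp d K (\<lambda>x. m x * f x) U \<and> bn s p p U \<le> ennreal (C * A) * bn s p p u"
      if f: "decomp d K f u" "bn s p p u < \<infinity>" for f u
    proof -
      obtain U where U: "decomp d K (\<lambda>x. m x * f x) U" "bn s p p U \<le> ennreal (?c * A) * bn s p p u"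
        using mult_decomp_p_le_1[OF \<psi> p d0 s less_imp_le[OF A0] selfs_decomp[OF p(1) p(1) d0 s A] f] by blast
      have "ennreal (?c * A) * bn s p p u \<le> ennreal (C * A) * bn s p p u"
        using A0 by (intro mult_right_mono ennreal_leI) (auto simp: C_def)
      then show ?thesis using U order_trans by blast
    qed
    show ?thesis using I step C A0 by simp
  qed
  have "m \<in> multipliers d K s p p" if m: "m \<in> selfs \<psi> d K s p p" for m
  proof -
    obtain a where a: "0 \<le> a" "selfs_qnorm \<psi> d K s p p m = ennreal a"
      using m unfolding selfs_def by (cases "selfs_qnorm \<psi> d K s p p m") auto
    have "selfs_qnorm \<psi> d K s p p m < ennreal (a + 1)" using a by (auto simp: ennreal_less_iff)
    then show ?thesis using main m by blast
  qed
  moreover have "multiplier_qnorm d K s p p m \<le> ennreal C * selfs_qnorm \<psi> d K s p p m" if m: "m \<in> selfs \<psi> d K s p p" for m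
  proof -
    have "multiplier_qnorm d K s p p m \<le> ennreal C * B" if B: "selfs_qnorm \<psi> d K s p p m < B" for B
    proof (cases B)
      case (real A)
      then have "multiplier_qnorm d K s p p m \<le> ennreal (C * A)" using main[OF m, of A] B by simp
      also have "\<dots> = ennreal C * B" using real C by (simp add: ennreal_mult)
      finally show ?thesis .
    next
      case top then show ?thesis using C by (simp add: ennreal_mult_top)
    qed
    then have "multiplier_qnorm d K s p p m \<le> ennreal C * Inf {B. selfs_qnorm \<psi> d K s p p m < B}"
      by (intro le_mult_Inf[OF C]) auto
    also have "Inf {B. selfs_qnorm \<psi> d K s p p m < B} \<le> selfs_qnorm \<psi> d K s p p m"
      by (rule dense_ge) (auto intro: Inf_lower)
    finally show ?thesis by (simp add: mult_left_mono)
  qed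
  ultimately show ?thesis unfolding cont_embedded_def using C by blast
qed

theorem theorem5p4:
  fixes s d :: real and p q :: ennreal and K :: "real \<Rightarrow> nat" and \<psi> :: "real^'n \<Rightarrow> real"
  assumes "1 < d"
    and "\<And>\<sigma>. 0 < \<sigma> \<Longrightarrow> 1 + \<lfloor>\<sigma>\<rfloor> \<le> int (K \<sigma>)"
    and "resolution_fun \<psi>"
    and "0 < s" and "0 < p" and "0 < q"
  shows "(selfs_plus \<psi> d K s p q \<subseteq> multipliers d (K s) s p q
          \<and> cont_embedded (multipliers d (K s) s p q) (multiplier_qnorm d (K s) s p q)
                          (selfs \<psi> d (K s) s p q) (selfs_qnorm \<psi> d (K s) s p q))
       \<and> (p \<le> 1 \<longrightarrow>
            multipliers d (K s) s p p = selfs \<psi> d (K s) s p p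
          \<and> cont_embedded (multipliers d (K s) s p p) (multiplier_qnorm d (K s) s p p)
                          (selfs \<psi> d (K s) s p p) (selfs_qnorm \<psi> d (K s) s p p)
          \<and> cont_embedded (selfs \<psi> d (K s) s p p) (selfs_qnorm \<psi> d (K s) s p p)
                          (multipliers d (K s) s p p) (multiplier_qnorm d (K s) s p p))"
proof -
  have d: "1 \<le> d" using assms(1) by simp
  have K: "\<sigma> < real (K \<sigma>)" if "0 < \<sigma>" for \<sigma>
    using assms(2)[OF that] by linarith
  have "selfs_plus \<psi> d K s p q \<subseteq> multipliers d (K s) s p q"
  proof
    fix m assume "m \<in> selfs_plus \<psi> d K s p q"
    then obtain \<sigma> where \<sigma>: "s < \<sigma>" "m \<in> selfs \<psi> d (K \<sigma>) \<sigma> p q" by (auto simp: selfs_plus_def)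
    show "m \<in> multipliers d (K s) s p q"
      by (rule selfs_smoother_multiplier[OF assms(3) d assms(5,6,4) \<sigma>(1) K[OF assms(4)] _ \<sigma>(2)])
        (use K[of \<sigma>] \<sigma>(1) assms(4) in linarith)
  qed
  moreover have emb: "cont_embedded (multipliers d (K s) s p q') (multiplier_qnorm d (K s) s p q')
      (selfs \<psi> d (K s) s p q') (selfs_qnorm \<psi> d (K s) s p q')" if "0 < q'" for q'
    by (rule multipliers_embedded_selfs[OF assms(3) d assms(5) that assms(4) K[OF assms(4)]])
  moreover have emb2: "cont_embedded (selfs \<psi> d (K s) s p p) (selfs_qnorm \<psi> d (K s) s p p)
      (multipliers d (K s) s p p) (multiplier_qnorm d (K s) s p p)" if "p \<le> 1"
    by (rule selfs_embedded_multipliers[OF assms(3) d assms(5) that assms(4)])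
  moreover have "multipliers d (K s) s p p = selfs \<psi> d (K s) s p p" if "p \<le> 1"
    using emb[OF assms(5)] emb2[OF that] unfolding cont_embedded_def by blast
  ultimately show ?thesis using assms(5,6) by blast
qed

end
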